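(* Both $d_{AM}$ and $d_{AC}$ define metrics on the asymptotic Teichmüller space $AT(\mathbb{D})$.
   Context: **Spaces.** $\mathbb{D}$ is the open unit disk and $\mathbb{S}^1$ its boundary. $T(\mathbb{D})$ is the set of quasisymmetric (orientation-preserving) homeomorphisms of $\mathbb{S}^1$ fixing $1,-1,i$. An orientation-preserving homeomorphism $h$ of $\mathbb{S}^1$ is symmetric if $(1+\delta(x,t))^{-1}\le \frac{|h(e^{i(x+t)})-h(e^{ix})|}{|h(e^{ix})-h(e^{i(x-t)})|}\le 1+\delta(x,t)$ for all $x$ and all small $t>0$, where $\delta(x,t)\to0$ uniformly in $x$ as $t\to0$. $AT(\mathbb{D})$ is the quotient of $T(\mathbb{D})$ by the subgroup of symmetric elements: $[h_1]=[h_2]$ if and only if $h_1\circ h_2^{-1}$ is symmetric. **Quadruples and quadrilaterals.** A quadruple $Q=\{a,b,c,d\}$ consists of four distinct points on $\mathbb{S}^1$ in counterclockwise order; it determines the topological quadrilateral $\mathbb{D}(a,b,c,d)$ ($\mathbb{D}$ with these marked boundary points), and $h(Q)=\{h(a),h(b),h(c),h(d)\}$. $M(Q)$ is the conformal modulus of $\mathbb{D}(a,b,c,d)$: the number $M>0$ such that $\mathbb{D}$ maps conformally onto the rectangle with vertices $0,M,M+i,i$ with $a,b,c,d$ going to these vertices in order (the reciprocal convention gives the same $d_{AM}$ below). The cross ratio is $cr(Q)=\frac{(b-a)(d-c)}{(c-b)(d-a)}$. The minimal scale is $s(Q)=\min\{|a-b|,|b-c|,|c-d|,|d-a|\}$.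 A sequence $\{Q_n\}$ of topological quadrilaterals is degenerating if $s(Q_n)\to0$. A sequence $\{Q_n\}$ of quadruples is degenerating if $cr(Q_n)=1$ for every $n$ and $s(Q_n)\to0$. **$d_{AM}$.** For $[h]\in AT(\mathbb{D})$, $K_{am}([h])=\sup_{\{Q_n\}}\limsup_{n\to\infty}\frac{M(h(Q_n))}{M(Q_n)}$, the supremum over all degenerating sequences of topological quadrilaterals; $d_{AM}([h_1],[h_2])=\frac12\log K_{am}([h_2\circ h_1^{-1}])$. **$d_{AC}$.** $d_{AC}([h_1],[h_2])=\sup_{\{Q_n\}}\limsup_{n\to\infty}\left|\log\frac{cr(h_2(Q_n))}{cr(h_1(Q_n))}\right|$, the supremum over all degenerating sequences of quadruples. *)

theory Defs
  imports "HOL-Complex_Analysis.Complex_Analysis"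
begin

abbreviation circle :: "complex set" where
  "circle \<equiv> sphere 0 1"

text \<open>
  Maps of the circle are functions on all of \<^typ>\<open>complex\<close>; only their values on the circle
  matter. Preservation of orientation is expressed by an increasing lift to the real line.
\<close>

definition op_circle_homeo :: "(complex \<Rightarrow> complex) \<Rightarrow> bool" where
  "op_circle_homeo h \<longleftrightarrow>
     (\<exists>g. homeomorphism circle circle h g) \<and>
     (\<exists>f::real \<Rightarrow> real. continuous_on UNIV f \<and> strict_mono f \<and> (\<forall>x. h (cis x) = cis (f x)))"

definition symm_ratio :: "(complex \<Rightarrow> complex) \<Rightarrow> real \<Rightarrow> real \<Rightarrow> real" where
  "symm_ratio h x t =
     cmod (h (cis (x + t)) - h (cis x)) / cmod (h (cis x) - h (cis (x - t)))"

definition quasisymmetric :: "(complex \<Rightarrow> complex) \<Rightarrow> bool" where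
  "quasisymmetric h \<longleftrightarrow> op_circle_homeo h \<and>
     (\<exists>C\<ge>1. \<forall>x t. 0 < t \<and> t < pi \<longrightarrow> 1 / C \<le> symm_ratio h x t \<and> symm_ratio h x t \<le> C)"

definition symmetric :: "(complex \<Rightarrow> complex) \<Rightarrow> bool" where
  "symmetric h \<longleftrightarrow> op_circle_homeo h \<and>
     (\<exists>\<delta> :: real \<Rightarrow> real \<Rightarrow> real.
        uniform_limit UNIV (\<lambda>t x. \<delta> x t) (\<lambda>x. 0) (at_right 0) \<and>
        (\<forall>\<^sub>F t in at_right 0. \<forall>x.
           inverse (1 + \<delta> x t) \<le> symm_ratio h x t \<and> symm_ratio h x t \<le> 1 + \<delta> x t))"

text \<open>
  Extensionality makes the elements of the Teichmueller space correspond exactly to maps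
  defined on the circle only.
\<close>

definition Teich :: "(complex \<Rightarrow> complex) set" where
  "Teich = {h \<in> extensional circle. quasisymmetric h \<and> h 1 = 1 \<and> h (-1) = -1 \<and> h \<i> = \<i>}"

abbreviation circle_inv :: "(complex \<Rightarrow> complex) \<Rightarrow> complex \<Rightarrow> complex" where
  "circle_inv h \<equiv> inv_into circle h"

definition AT_rel :: "((complex \<Rightarrow> complex) \<times> (complex \<Rightarrow> complex)) set" where
  "AT_rel = {(h1, h2). h1 \<in> Teich \<and> h2 \<in> Teich \<and> symmetric (h1 \<circ> circle_inv h2)}"

definition AT_space :: "(complex \<Rightarrow> complex) set set" where
  "AT_space = Teich // AT_rel"

definition AT_class :: "(complex \<Rightarrow> complex) \<Rightarrow> (complex \<Rightarrow> complex) set" where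
  "AT_class h = AT_rel `` {h}"

type_synonym quad = "complex \<times> complex \<times> complex \<times> complex"

definition is_quadruple :: "quad \<Rightarrow> bool" where
  "is_quadruple = (\<lambda>(a, b, c, d).
     \<exists>t1 t2 t3 t4. t1 < t2 \<and> t2 < t3 \<and> t3 < t4 \<and> t4 < t1 + 2 * pi \<and>
       a = cis t1 \<and> b = cis t2 \<and> c = cis t3 \<and> d = cis t4)"

definition map_quad :: "(complex \<Rightarrow> complex) \<Rightarrow> quad \<Rightarrow> quad" where
  "map_quad h = (\<lambda>(a, b, c, d). (h a, h b, h c, h d))"

text \<open>
  Conformal maps of the disk onto a rectangle extend homeomorphically to the closures
  (Caratheodory), so the extension is taken as part of the data.
\<close>

definition quad_modulus :: "quad \<Rightarrow> real" where
  "quad_modulus = (\<lambda>(a, b, c, d). THE M. 0 < M \<and>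
     (\<exists>f g. f holomorphic_on ball 0 1 \<and>
        f ` ball 0 1 = box 0 (Complex M 1) \<and>
        homeomorphism (cball 0 1) (cbox 0 (Complex M 1)) f g \<and>
        f a = 0 \<and> f b = of_real M \<and> f c = Complex M 1 \<and> f d = \<i>))"

definition cross_ratio :: "quad \<Rightarrow> complex" where
  "cross_ratio = (\<lambda>(a, b, c, d). ((b - a) * (d - c)) / ((c - b) * (d - a)))"

definition min_scale :: "quad \<Rightarrow> real" where
  "min_scale = (\<lambda>(a, b, c, d). Min {cmod (a - b), cmod (b - c), cmod (c - d), cmod (d - a)})"

definition degenerating_quadrilaterals :: "(nat \<Rightarrow> quad) \<Rightarrow> bool" where
  "degenerating_quadrilaterals Q \<longleftrightarrow>
     (\<forall>n. is_quadruple (Q n)) \<and> (\<lambda>n. min_scale (Q n)) \<longlonglongrightarrow> 0"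

definition degenerating_quadruples :: "(nat \<Rightarrow> quad) \<Rightarrow> bool" where
  "degenerating_quadruples Q \<longleftrightarrow>
     (\<forall>n. is_quadruple (Q n) \<and> cross_ratio (Q n) = 1) \<and> (\<lambda>n. min_scale (Q n)) \<longlonglongrightarrow> 0"

text \<open>
  The suprema are taken in \<^typ>\<open>ereal\<close>, so that their finiteness is not presupposed.
\<close>

definition K_am :: "(complex \<Rightarrow> complex) \<Rightarrow> ereal" where
  "K_am h = (SUP Q \<in> {Q. degenerating_quadrilaterals Q}.
     limsup (\<lambda>n. ereal (quad_modulus (map_quad h (Q n)) / quad_modulus (Q n))))"

definition ln_ereal :: "ereal \<Rightarrow> ereal" where
  "ln_ereal x = (if x \<le> 0 then - \<infinity> else if x = \<infinity> then \<infinity> else ereal (ln (real_of_ereal x)))"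

definition d_AM :: "(complex \<Rightarrow> complex) \<Rightarrow> (complex \<Rightarrow> complex) \<Rightarrow> ereal" where
  "d_AM h1 h2 = ereal (1 / 2) * ln_ereal (K_am (h2 \<circ> circle_inv h1))"

text \<open>
  Cross ratios of quadruples are positive real numbers, on which the principal branch of the
  complex logarithm is the real logarithm.
\<close>

definition d_AC :: "(complex \<Rightarrow> complex) \<Rightarrow> (complex \<Rightarrow> complex) \<Rightarrow> ereal" where
  "d_AC h1 h2 = (SUP Q \<in> {Q. degenerating_quadruples Q}.
     limsup (\<lambda>n. ereal (cmod (ln
       (cross_ratio (map_quad h2 (Q n)) / cross_ratio (map_quad h1 (Q n)))))))"

end

theory Submission
  imports Defs "HOL-Real_Asymp.Real_Asymp"
begin

text \<open>
  The modulus of a quadruple is an increasing function \<open>mu\<close> of its cross ratio: after a disk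
  automorphism the quadruple is symmetric about both axes, and an explicit Schwarz--Christoffel
  map takes the disk onto a rectangle. With \<open>nu x = ln (mu (exp x))\<close> both distances compare, along
  small quadruples, a function of the logarithmic cross ratios of the images: the difference of
  the logarithmic cross ratios on harmonic quadruples for \<^const>\<open>d_AC\<close>, half the difference of
  \<open>nu\<close> of them on all quadruples for \<^const>\<open>d_AM\<close>. Hence the triangle inequality and symmetry are
  immediate, and it remains to see that both are finite and vanish exactly on pairs of maps that
  differ by a symmetric one.

  Finiteness holds because a quasisymmetric map distorts logarithmic cross ratios at most
  linearly, up to a bounded error, while \<open>nu\<close> grows like the logarithm. For the kernel, harmonic
  quadruples consisting of three close equidistant points and the antipode of the middle one
  recover the quotients in the definition of symmetric maps. Conversely, if two lifts have the
  same asymptotic quotients on adjacent intervals of equal length, subdivision extends this to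
  adjacent intervals of comparable length, hence to all small quadruples with bounded cross
  ratio; for unbounded cross ratios, linear distortion with factors close to 1 suffices.
\<close>

section \<open>Uniqueness of the modulus\<close>

text \<open>The two distances test different quadruples. \<open>d_AC\<close> sees only those that
  are harmonic before either map is applied, so the quotient of the two maps meets them with an
  arbitrary but bounded cross ratio; \<open>d_AM\<close> sees all quadruples, also those whose
  modulus tends to 0 or infinity. A single estimate serves both: under a symmetric map the
  logarithmic cross ratio x of a small quadruple changes by at most e * (1 + |x|). For bounded x
  this is a small absolute error, as \<open>d_AC\<close> requires; for large x it is only a small
  relative error, but \<open>nu\<close> turns a factor close to 1 into a small summand. The slopes
  of the linear distortion are log_2 (1 + 1/C) and log_2 (1 + C) for a doubling constant C. Both
  tend to 1 as C tends to 1, and at small scales a symmetric map has doubling constants arbitrarily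
  close to 1. \<open>K_am\<close> bounds a ratio from one side only; cyclic rotation of the
  quadruple inverts its modulus, which supplies the other side.\<close>

definition is_modulus :: "quad \<Rightarrow> real \<Rightarrow> bool" where
  "is_modulus = (\<lambda>(a, b, c, d) M. 0 < M \<and>
     (\<exists>f g. f holomorphic_on ball 0 1 \<and>
        f ` ball 0 1 = box 0 (Complex M 1) \<and>
        homeomorphism (cball 0 1) (cbox 0 (Complex M 1)) f g \<and>
        f a = 0 \<and> f b = of_real M \<and> f c = Complex M 1 \<and> f d = \<i>))"

lemma quad_modulus_eq_THE: "quad_modulus Q = (THE M. is_modulus Q M)"
  by (cases Q) (simp add: quad_modulus_def is_modulus_def)

section \<open>Paths along the boundary of a rectangle\<close>

definition rect_corners :: "real \<Rightarrow> complex set" where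
  "rect_corners M = {0, of_real M, Complex M 1, \<i>}"

definition rect_edges :: "real \<Rightarrow> complex set" where
  "rect_edges M = cbox 0 (Complex M 1) - box 0 (Complex M 1) - rect_corners M"

lemma mem_rect_edges:
  "z \<in> rect_edges M \<longleftrightarrow> 0 \<le> Re z \<and> Re z \<le> M \<and> 0 \<le> Im z \<and> Im z \<le> 1 \<and>
     \<not> (0 < Re z \<and> Re z < M \<and> 0 < Im z \<and> Im z < 1) \<and>
     \<not> ((Re z = 0 \<or> Re z = M) \<and> (Im z = 0 \<or> Im z = 1))"
  by (cases "z") (auto simp: rect_edges_def rect_corners_def in_cbox_complex_iff in_box_complex_iff
     complex_eq_iff)

text \<open>A point on two different closed sides is a corner, and \<open>rect_edges\<close> leaves
  the corners out. So the four closed sides cut the connected image of the open interval into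
  disjoint relatively closed pieces, one of which is everything; closedness of that side adds the
  two end points.\<close>

lemma path_on_rect_edge:
  fixes \<gamma> :: "real \<Rightarrow> complex"
  assumes "0 < M" and cont: "continuous_on {0..1} \<gamma>"
    and edge: "\<And>t. 0 < t \<Longrightarrow> t < 1 \<Longrightarrow> \<gamma> t \<in> rect_edges M"
  shows "(\<forall>t\<in>{0..1}. Im (\<gamma> t) = 0) \<or> (\<forall>t\<in>{0..1}. Im (\<gamma> t) = 1) \<or>
         (\<forall>t\<in>{0..1}. Re (\<gamma> t) = 0) \<or> (\<forall>t\<in>{0..1}. Re (\<gamma> t) = M)"
proof -
  define C where "C = \<gamma> ` {0<..<1}"
  define B T L R where "B = {z. Im z = 0} \<inter> cbox 0 (Complex M 1)"
    and "T = {z. Im z = 1} \<inter> cbox 0 (Complex M 1)"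
    and "L = {z. Re z = 0} \<inter> cbox 0 (Complex M 1)" and "R = {z. Re z = M} \<inter> cbox 0 (Complex M 1)"
  note BTLR = B_def T_def L_def R_def
  have cl: "closed B" "closed T" "closed L" "closed R"
    unfolding BTLR by (intro closed_Int closed_cbox closed_Collect_eq continuous_intros)+
  have conn: "connected C"
    unfolding C_def by (intro connected_continuous_image continuous_on_subset[OF cont]) auto
  have CE: "C \<subseteq> rect_edges M" using edge by (auto simp: C_def)
  have dj: "z \<in> B \<union> T \<union> L \<union> R" "\<not> ((Re z = 0 \<or> Re z = M) \<and> (Im z = 0 \<or> Im z = 1))" if "z \<in> C" for z
  proof -
    have "z \<in> rect_edges M" using CE that by blast
    then show "z \<in> B \<union> T \<union> L \<union> R" "\<not> ((Re z = 0 \<or> Re z = M) \<and> (Im z = 0 \<or> Im z = 1))"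
      unfolding mem_rect_edges BTLR Un_iff Int_iff mem_Collect_eq in_cbox_complex_iff by auto
  qed
  have cov: "C \<subseteq> B \<union> T \<union> L \<union> R" using dj(1) by blast
  have sp: "C \<inter> S = {} \<or> C \<subseteq> S"
    if "\<And>z. z \<in> C \<Longrightarrow> z \<in> S \<Longrightarrow> z \<notin> S'" "C \<subseteq> S \<union> S'" "closed S" "closed S'" for S S'
    using connected_closedD[OF conn _ that(2,3,4)] that(1,2) by blast
  have in_BTLR: "z \<in> B \<Longrightarrow> Im z = 0" "z \<in> T \<Longrightarrow> Im z = 1" "z \<in> L \<Longrightarrow> Re z = 0" "z \<in> R \<Longrightarrow> Re z = M" for z
    by (auto simp: BTLR)
  have 1: "C \<inter> B = {} \<or> C \<subseteq> B"
  proof (rule sp[of _ "T \<union> L \<union> R"])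
    show "z \<notin> T \<union> L \<union> R" if "z \<in> C" "z \<in> B" for z
      using dj(2)[OF that(1)] in_BTLR[of z] that(2) \<open>0 < M\<close> by auto
  qed (use cov cl in auto)
  have 2: "C \<inter> T = {} \<or> C \<subseteq> T"
  proof (rule sp[of _ "B \<union> L \<union> R"])
    show "z \<notin> B \<union> L \<union> R" if "z \<in> C" "z \<in> T" for z
      using dj(2)[OF that(1)] in_BTLR[of z] that(2) \<open>0 < M\<close> by auto
  qed (use cov cl in auto)
  have 3: "C \<inter> L = {} \<or> C \<subseteq> L"
  proof (rule sp[of _ "B \<union> T \<union> R"])
    show "z \<notin> B \<union> T \<union> R" if "z \<in> C" "z \<in> L" for z
      using dj(2)[OF that(1)] in_BTLR[of z] that(2) \<open>0 < M\<close> by auto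
  qed (use cov cl in auto)
  have "C \<subseteq> B \<or> C \<subseteq> T \<or> C \<subseteq> L \<or> C \<subseteq> R" using 1 2 3 cov by blast
  moreover have "\<gamma> ` {0..1} \<subseteq> S" if "C \<subseteq> S" "closed S" for S
    using image_closure_subset[of "{0<..<1::real}" \<gamma> S] that cont by (simp add: C_def)
  ultimately have "\<gamma> ` {0..1} \<subseteq> B \<or> \<gamma> ` {0..1} \<subseteq> T \<or> \<gamma> ` {0..1} \<subseteq> L \<or> \<gamma> ` {0..1} \<subseteq> R"
    using cl by blast
  then show ?thesis unfolding BTLR by auto
qed

text \<open>On a horizontal side \<open>b - a\<close> is real and only Im F enters; on a vertical
  side it is imaginary and only Re F enters. These are just the parts of F that are constant on the
  sides.\<close>

lemma Im_linepath_integral: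
  assumes "(F has_contour_integral I) (linepath a b)"
    and "\<And>t. t \<in> {0..1} \<Longrightarrow> Im (F (linepath a b t) * (b - a)) = k"
  shows "Im I = k"
proof -
  have "((\<lambda>t. Im (F (linepath a b t) * (b - a))) has_integral Im I) {0..1}"
    using has_integral_Im assms(1) unfolding has_contour_integral_linepath by blast
  then have "((\<lambda>t. k) has_integral Im I) {0..1::real}"
    by (subst (asm) has_integral_cong[OF assms(2)]) auto
  moreover have "((\<lambda>t. k) has_integral k) {0..1::real}"
    using has_integral_const_real[of k 0 1] by simp
  ultimately show ?thesis using has_integral_unique by blast
qed

text \<open>The imaginary part of the integral of the conformal map between the two rectangles along
  the boundary of the first one is the difference of the moduli.\<close>

lemma is_modulus_unique:
  assumes "is_quadruple Q" "is_modulus Q M1" "is_modulus Q M2"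
  shows "M1 = M2"
proof -
  obtain a b c d where Q: "Q = (a,b,c,d)" by (cases Q) auto
  have abcd: "a \<in> cball 0 1" "b \<in> cball 0 1" "c \<in> cball 0 1" "d \<in> cball 0 1"
    using assms(1) unfolding Q is_quadruple_def by auto
  obtain f1 g1 where M1: "0 < M1" and hol1: "f1 holomorphic_on ball 0 1"
    and im1: "f1 ` ball 0 1 = box 0 (Complex M1 1)"
    and ho1: "homeomorphism (cball 0 1) (cbox 0 (Complex M1 1)) f1 g1"
    and v1: "f1 a = 0" "f1 b = of_real M1" "f1 c = Complex M1 1" "f1 d = \<i>"
    using assms(2) unfolding Q is_modulus_def by auto
  obtain f2 g2 where M2: "0 < M2" and hol2: "f2 holomorphic_on ball 0 1"
    and im2: "f2 ` ball 0 1 = box 0 (Complex M2 1)"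
    and ho2: "homeomorphism (cball 0 1) (cbox 0 (Complex M2 1)) f2 g2"
    and v2: "f2 a = 0" "f2 b = of_real M2" "f2 c = Complex M2 1" "f2 d = \<i>"
    using assms(3) unfolding Q is_modulus_def by auto
  \<comment> \<open>The conformal map from the first rectangle to the second, extended to the
    closures; it takes corners to corners in order.\<close>
  define F where "F = f2 \<circ> g1"
  have cF: "continuous_on (cbox 0 (Complex M1 1)) F"
    unfolding F_def using ho1 ho2 unfolding homeomorphism_def
    by (intro continuous_on_compose) auto
  have g1f: "g1 (f1 z) = z" if "z \<in> cball 0 1" for z
    using ho1 that unfolding homeomorphism_def by auto
  have g2f: "g2 (f2 z) = z" if "z \<in> cball 0 1" for z
    using ho2 that unfolding homeomorphism_def by auto
  have inj1: "inj_on f1 (cball 0 1)" using g1f by (rule inj_on_inverseI)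
  have inj2: "inj_on f2 (cball 0 1)" using g2f by (rule inj_on_inverseI)
  have holF: "F holomorphic_on box 0 (Complex M1 1)"
  proof -
    have "inj_on f1 (ball 0 1)" using inj1 by (rule inj_on_subset) auto
    then obtain g where g: "g holomorphic_on (f1 ` ball 0 1)" "\<And>z. z \<in> ball 0 1 \<Longrightarrow> g (f1 z) = z"
      using holomorphic_has_inverse[OF hol1 open_ball] by metis
    have "g1 holomorphic_on (f1 ` ball 0 1)"
      by (rule holomorphic_transform[OF g(1)]) (use g(2) g1f in auto)
    then show ?thesis unfolding F_def im1
      by (rule holomorphic_on_compose_gen[OF _ hol2]) (use g1f in \<open>auto simp flip: im1\<close>)
  qed
  have edge: "F z \<in> rect_edges M2" if z: "z \<in> rect_edges M1" for z
  proof -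
    have zc: "z \<in> cbox 0 (Complex M1 1)" "z \<notin> box 0 (Complex M1 1)" "z \<notin> rect_corners M1"
      using z by (auto simp: rect_edges_def)
    define w where "w = g1 z"
    have w: "w \<in> cball 0 1" "f1 w = z" using zc ho1 unfolding homeomorphism_def w_def by auto
    have wb: "w \<notin> ball 0 1" using zc(2) im1 w by blast
    have wabcd: "w \<noteq> a" "w \<noteq> b" "w \<noteq> c" "w \<noteq> d" using zc(3) v1 w by (auto simp: rect_corners_def)
    have 1: "f2 w \<in> cbox 0 (Complex M2 1)" using ho2 w(1) unfolding homeomorphism_def by blast
    have 2: "f2 w \<notin> box 0 (Complex M2 1)"
    proof
      assume "f2 w \<in> box 0 (Complex M2 1)"
      then obtain w' where "w' \<in> ball 0 1" "f2 w' = f2 w" using im2 by (metis imageE)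
      then show False using wb inj_onD[OF inj2, of w' w] w(1) by (metis ball_subset_cball subsetD)
    qed
    have 3: "f2 w \<noteq> f2 a" "f2 w \<noteq> f2 b" "f2 w \<noteq> f2 c" "f2 w \<noteq> f2 d"
      using inj_onD[OF inj2 _ w(1)] abcd wabcd by blast+
    have "f2 w \<notin> rect_corners M2" using 3 v2 unfolding rect_corners_def by simp
    then show ?thesis using 1 2 unfolding rect_edges_def F_def w_def by simp
  qed
  have Fv: "F 0 = 0" "F M1 = M2" "F (Complex M1 1) = Complex M2 1" "F \<i> = \<i>"
    unfolding F_def using v1 v2 g1f abcd by (metis comp_apply)+
  have lp: "(\<forall>t\<in>{0..1}. Im (F (linepath p q t)) = 0) \<or> (\<forall>t\<in>{0..1}. Im (F (linepath p q t)) = 1) \<or>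
         (\<forall>t\<in>{0..1}. Re (F (linepath p q t)) = 0) \<or> (\<forall>t\<in>{0..1}. Re (F (linepath p q t)) = M2)"
    if "p \<in> cbox 0 (Complex M1 1)" "q \<in> cbox 0 (Complex M1 1)"
      "\<And>t. 0 < t \<Longrightarrow> t < 1 \<Longrightarrow> linepath p q t \<in> rect_edges M1" for p q
  proof (rule path_on_rect_edge[OF M2])
    have "linepath p q ` {0..1} \<subseteq> cbox 0 (Complex M1 1)"
      using that(1,2) by (metis convex_box(1) convex_contains_segment path_image_def path_image_linepath)
    then show "continuous_on {0..1} (\<lambda>t. F (linepath p q t))"
      by (intro continuous_on_compose2[OF cF]) (auto intro: continuous_intros)
    show "F (linepath p q t) \<in> rect_edges M2" if "0 < t" "t < 1" for t
      using edge that \<open>\<And>t. 0 < t \<Longrightarrow> t < 1 \<Longrightarrow> _\<close> by blast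
  qed
  have lpI: "linepath p q 0 = p" "linepath p q 1 = q" for p q :: complex by (auto simp: linepath_def)
  have ends: "(0::real) \<in> {0..1}" "(1::real) \<in> {0..1}" by auto
  have lpe: "(Im (F p) = 0 \<and> Im (F q) = 0 \<and> (\<forall>t\<in>{0..1}. Im (F (linepath p q t)) = 0)) \<or>
      (Im (F p) = 1 \<and> Im (F q) = 1 \<and> (\<forall>t\<in>{0..1}. Im (F (linepath p q t)) = 1)) \<or>
      (Re (F p) = 0 \<and> Re (F q) = 0 \<and> (\<forall>t\<in>{0..1}. Re (F (linepath p q t)) = 0)) \<or>
      (Re (F p) = M2 \<and> Re (F q) = M2 \<and> (\<forall>t\<in>{0..1}. Re (F (linepath p q t)) = M2))"
    if "p \<in> cbox 0 (Complex M1 1)" "q \<in> cbox 0 (Complex M1 1)"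
      "\<And>t. 0 < t \<Longrightarrow> t < 1 \<Longrightarrow> linepath p q t \<in> rect_edges M1" for p q
  proof -
    have e: "F (linepath p q 0) = F p" "F (linepath p q 1) = F q" by (simp_all only: lpI)
    show ?thesis using lp[OF that] ends unfolding e[symmetric] by blast
  qed
  have bot: "\<forall>t\<in>{0..1}. Im (F (linepath 0 (of_real M1) t)) = 0"
  proof -
    have "linepath 0 (of_real M1) t \<in> rect_edges M1" if "0 < t" "t < 1" for t
      using M1 that by (auto simp: mem_rect_edges linepath_def)
    from lpe[OF _ _ this] show ?thesis
      using M1 M2 by (auto simp: in_cbox_complex_iff Fv scaleR_conv_of_real)
  qed
  have right: "\<forall>t\<in>{0..1}. Re (F (linepath (of_real M1) (Complex M1 1) t)) = M2"
  proof -
    have "linepath (of_real M1) (Complex M1 1) t \<in> rect_edges M1" if "0 < t" "t < 1" for t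
      using M1 that by (auto simp: mem_rect_edges linepath_def algebra_simps)
    from lpe[OF _ _ this] show ?thesis
      using M1 M2 by (auto simp: in_cbox_complex_iff Fv)
  qed
  have top: "\<forall>t\<in>{0..1}. Im (F (linepath (Complex M1 1) \<i> t)) = 1"
  proof -
    have "linepath (Complex M1 1) \<i> t \<in> rect_edges M1" if "0 < t" "t < 1" for t
      using M1 that by (auto simp: mem_rect_edges linepath_def algebra_simps)
    from lpe[OF _ _ this] show ?thesis
      using M1 M2 by (auto simp: in_cbox_complex_iff Fv)
  qed
  have left: "\<forall>t\<in>{0..1}. Re (F (linepath \<i> 0 t)) = 0"
  proof -
    have "linepath \<i> 0 t \<in> rect_edges M1" if "0 < t" "t < 1" for t
      using M1 that by (auto simp: mem_rect_edges linepath_def algebra_simps)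
    from lpe[OF _ _ this] show ?thesis
      using M1 M2 by (auto simp: in_cbox_complex_iff Fv)
  qed
  define p where "p = linepath 0 (of_real M1) +++ (linepath (of_real M1) (Complex M1 1) +++
    (linepath (Complex M1 1) \<i> +++ linepath \<i> 0))"
  have sub: "closed_segment u v \<subseteq> cbox 0 (Complex M1 1)"
    if "u \<in> cbox 0 (Complex M1 1)" "v \<in> cbox 0 (Complex M1 1)" for u v
    using that convex_box(1)[of 0 "Complex M1 1"] unfolding convex_contains_segment by blast
  have corn: "0 \<in> cbox 0 (Complex M1 1)" "of_real M1 \<in> cbox 0 (Complex M1 1)"
     "Complex M1 1 \<in> cbox 0 (Complex M1 1)" "\<i> \<in> cbox 0 (Complex M1 1)"
    using M1 by (auto simp: in_cbox_complex_iff)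
  have int: "(F has_contour_integral contour_integral (linepath u v) F) (linepath u v)"
    if "u \<in> cbox 0 (Complex M1 1)" "v \<in> cbox 0 (Complex M1 1)" for u v
  proof -
    have "continuous_on (closed_segment u v) F"
      by (rule continuous_on_subset[OF cF]) (rule sub[OF that])
    then show ?thesis
      by (intro has_contour_integral_integral contour_integrable_continuous_linepath)
  qed
  define I1 I2 I3 I4 where "I1 = contour_integral (linepath 0 (of_real M1)) F"
    and "I2 = contour_integral (linepath (of_real M1) (Complex M1 1)) F"
    and "I3 = contour_integral (linepath (Complex M1 1) \<i>) F"
    and "I4 = contour_integral (linepath \<i> 0) F"
  have I: "(F has_contour_integral I1) (linepath 0 (of_real M1))"
    "(F has_contour_integral I2) (linepath (of_real M1) (Complex M1 1))"
    "(F has_contour_integral I3) (linepath (Complex M1 1) \<i>)"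
    "(F has_contour_integral I4) (linepath \<i> 0)"
    unfolding I1_def I2_def I3_def I4_def by (rule int corn)+
  have "(F has_contour_integral (I1 + (I2 + (I3 + I4)))) p"
    unfolding p_def by (intro has_contour_integral_join I valid_path_join valid_path_linepath) auto
  \<comment> \<open>Cauchy's theorem for a function holomorphic in the interior and continuous up to
    the boundary of the rectangle.\<close>
  moreover have "(F has_contour_integral 0) p"
  proof (rule Cauchy_theorem_convex[OF cF])
    show "F field_differentiable at x" if "x \<in> interior (cbox 0 (Complex M1 1)) - {}" for x
      using holF that by (simp add: holomorphic_on_imp_differentiable_at open_box interior_cbox)
    show "path_image p \<subseteq> cbox 0 (Complex M1 1)"
      unfolding p_def using sub corn by (simp add: path_image_join)
    show "valid_path p" unfolding p_def by (intro valid_path_join valid_path_linepath) auto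
  qed (auto simp: p_def)
  ultimately have "I1 + (I2 + (I3 + I4)) = 0" using contour_integral_unique by metis
  then have "Im I1 + (Im I2 + (Im I3 + Im I4)) = 0" by (metis plus_complex.sel(2) zero_complex.sel(2))
  \<comment> \<open>With \<open>b - a\<close> equal to M1, i, -M1, -i on bottom, right, top, left,
    the constant values of Im (F * (b - a)) are 0, Re F = M2, -M1 * Im F = -M1 and -Re F =
    0.\<close>
  moreover have "Im I1 = 0" by (rule Im_linepath_integral[OF I(1)]) (use bot in simp)
  moreover have "Im I2 = M2" by (rule Im_linepath_integral[OF I(2)]) (use right in simp)
  moreover have "Im I3 = - M1" by (rule Im_linepath_integral[OF I(3)]) (use top in simp)
  moreover have "Im I4 = 0" by (rule Im_linepath_integral[OF I(4)]) (use left in simp)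
  ultimately show ?thesis by simp
qed

section \<open>A Schwarz--Christoffel map onto a rectangle\<close>

text \<open>Half the complete elliptic integral K of the first kind with modulus sqrt (1 - s^2), as
  the substitution x = tan (u/2) shows for 0 < s \<le> 1. For s = sin \<theta> the integrand is 1 /
  |1 - x^2 e^(2i\<theta>)|.\<close>

definition ellip :: "real \<Rightarrow> real" where
  "ellip s = integral {0..1} (\<lambda>x. 1 / sqrt ((1 - x^2)^2 + 4 * x^2 * s^2))"

locale schwarz_christoffel =
  fixes \<theta> :: real
  assumes theta: "0 < \<theta>" "\<theta> < pi / 2"
begin

text \<open>The Schwarz-Christoffel integrand with exponent -1/2, that is with right angles, at the
  four points of \<open>corners\<close>. Each root is taken separately because each radicand stays
  in the right half plane over the disk, where the principal branch is holomorphic.\<close>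

definition q :: "complex \<Rightarrow> complex" where
  "q z = 1 / (csqrt (1 - z^2 * cis (2 * \<theta>)) * csqrt (1 - z^2 * cis (- 2 * \<theta>)))"

text \<open>The plane cut along the four outward radial rays that start at the points of
  \<open>corners\<close>.\<close>

definition slit :: "complex set" where
  "slit = {z. 1 - z^2 * cis (2 * \<theta>) \<notin> \<real>\<^sub>\<le>\<^sub>0 \<and> 1 - z^2 * cis (- 2 * \<theta>) \<notin> \<real>\<^sub>\<le>\<^sub>0}"

definition corners :: "complex set" where
  "corners = {cis \<theta>, cis (- \<theta>), - cis \<theta>, - cis (- \<theta>)}"

lemma sin2: "sin (2 * \<theta>) > 0"
  using theta by (intro sin_gt_zero) auto

lemma open_slit: "open slit"
proof -
  have "slit = (\<lambda>z. 1 - z^2 * cis (2 * \<theta>)) -` (- \<real>\<^sub>\<le>\<^sub>0) \<inter> (\<lambda>z. 1 - z^2 * cis (- 2 * \<theta>)) -` (- \<real>\<^sub>\<le>\<^sub>0)"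
    by (auto simp: slit_def)
  then show ?thesis
    by (auto intro!: open_Int continuous_open_vimage continuous_intros)
qed

lemma one_minus_nonpos:
  fixes u :: complex
  assumes "1 - u \<in> \<real>\<^sub>\<le>\<^sub>0" shows "Im u = 0" "Re u \<ge> 1"
  using assms by (auto simp: complex_nonpos_Reals_iff)

text \<open>The cuts run radially outwards, so a segment from 0 that ends off them never meets them.
  Starlikeness provides a primitive of \<open>q\<close>.\<close>

lemma starlike_slit: "starlike slit"
  unfolding starlike_def
proof (intro bexI ballI)
  show "0 \<in> slit" by (simp add: slit_def complex_nonpos_Reals_iff)
  fix x assume x: "x \<in> slit"
  have key: "1 - (of_real s * x)^2 * e \<notin> \<real>\<^sub>\<le>\<^sub>0" 
    if s: "0 \<le> s" "s \<le> 1" and e: "1 - x^2 * e \<notin> \<real>\<^sub>\<le>\<^sub>0" for s :: real and e :: complex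
  proof
    assume A: "1 - (of_real s * x)^2 * e \<in> \<real>\<^sub>\<le>\<^sub>0"
    have eq: "(of_real s * x)^2 * e = of_real (s^2) * (x^2 * e)" by (simp add: power_mult_distrib)
    have "s^2 * Im (x^2 * e) = 0" "s^2 * Re (x^2 * e) \<ge> 1"
      using one_minus_nonpos[OF A] unfolding eq by (simp_all only: Im_complex_of_real Re_complex_of_real times_complex.sel mult_zero_left diff_zero add_0_right)
    moreover have "s^2 \<le> 1" using s by (simp add: power_le_one)
    ultimately have "Im (x^2 * e) = 0" "Re (x^2 * e) \<ge> 1"
      by (auto simp del: times_complex.sel) (metis mult.commute mult_left_le mult_nonneg_nonpos2 not_one_le_zero order_trans linear zero_le_power2)
    then show False using e by (auto simp: complex_nonpos_Reals_iff)
  qed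
  show "closed_segment 0 x \<subseteq> slit"
  proof
    fix y assume "y \<in> closed_segment 0 x"
    then obtain s where "0 \<le> s" "s \<le> 1" "y = of_real s * x"
      by (auto simp: in_segment scaleR_conv_of_real)
    then show "y \<in> slit" using key x unfolding slit_def by auto
  qed
qed

lemma cball_slit:
  assumes "cmod z \<le> 1" "z \<notin> corners" shows "z \<in> slit"
proof -
  have key: "z = cis t \<or> z = - cis t"
    if "1 - z^2 * cis (- (2 * t)) \<in> \<real>\<^sub>\<le>\<^sub>0" for t
  proof -
    define u where "u = z^2 * cis (- (2 * t))"
    have "cmod u \<le> 1" using assms by (simp add: u_def norm_mult norm_power power_le_one)
    moreover have "Im u = 0" "Re u \<ge> 1" using one_minus_nonpos that unfolding u_def by blast+
    ultimately have "u = 1" using complex_Re_le_cmod[of u] by (auto simp: complex_eq_iff)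
    have "z^2 = u * cis (2 * t)" unfolding u_def by (simp add: mult.assoc cis_mult)
    also have "\<dots> = (cis t)^2" using \<open>u = 1\<close> by (simp add: power2_eq_square cis_mult)
    finally show ?thesis by (simp add: power2_eq_iff)
  qed
  show ?thesis
  proof (rule ccontr)
    assume "z \<notin> slit"
    then have "z = cis \<theta> \<or> z = - cis \<theta> \<or> z = cis (- \<theta>) \<or> z = - cis (- \<theta>)"
      using key[of \<theta>] key[of "- \<theta>"] unfolding slit_def by auto
    then show False using assms(2) by (auto simp: corners_def)
  qed
qed

lemma csqrt_ne0: "z \<in> slit \<Longrightarrow> csqrt (1 - z^2 * cis (2 * \<theta>)) * csqrt (1 - z^2 * cis (- 2 * \<theta>)) \<noteq> 0"
  by (auto simp: slit_def)

lemma holo_q: "q holomorphic_on slit"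
  unfolding q_def 
  by (intro holomorphic_intros) (use csqrt_ne0 in \<open>auto simp: slit_def\<close>)

lemma q_sq: "z \<in> slit \<Longrightarrow> (q z)^2 = 1 / ((1 - z^2 * cis (2 * \<theta>)) * (1 - z^2 * cis (- 2 * \<theta>)))"
  by (simp add: q_def power_divide power_mult_distrib)

text \<open>Each of the two square roots has argument in \<open>(-\<pi>/4, \<pi>/4)\<close>. This makes the primitive of \<^term>\<open>q\<close>
  injective on the disk.\<close>

lemma Re_q_pos:
  assumes "cmod z < 1" shows "Re (q z) > 0"
proof -
  have key: "\<bar>Im (csqrt (1 - u))\<bar> < Re (csqrt (1 - u))" if "cmod u < 1" for u
  proof -
    define w where "w = csqrt (1 - u)"
    have "Re (w^2) > 0" using that complex_Re_le_cmod[of u] by (simp add: w_def)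
    then have "\<bar>Im w\<bar>^2 < (Re w)^2" by (simp add: power2_eq_square)
    then show ?thesis using Re_csqrt[of "1 - u"] unfolding w_def by (rule power2_less_imp_less)
  qed
  have pos: "Re (1 / (w * w')) > 0" if "\<bar>Im w\<bar> < Re w" "\<bar>Im w'\<bar> < Re w'" for w w'
  proof -
    have "Im w * Im w' \<le> \<bar>Im w\<bar> * \<bar>Im w'\<bar>" by (metis abs_ge_self abs_mult)
    also have "\<dots> < Re w * Re w'" using that by (intro mult_strict_mono') auto
    finally have "Re (w * w') > 0" by simp
    then show ?thesis by (simp add: Re_divide sum_power2_gt_zero_iff)
  qed
  have "cmod (z\<^sup>2) < 1" using assms by (simp add: norm_power power_less_one_iff)
  then show ?thesis unfolding q_def by (intro pos key) (simp_all add: norm_mult)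
qed

section \<open>The primitive and its continuous extension to the closed disk\<close>

definition G :: "complex \<Rightarrow> complex" where
  "G = (SOME G. G 0 = 0 \<and> (\<forall>z\<in>slit. (G has_field_derivative q z) (at z)))"

lemma G_props: "G 0 = 0" "z \<in> slit \<Longrightarrow> (G has_field_derivative q z) (at z)"
proof -
  obtain g where g: "\<forall>x\<in>slit. (g has_field_derivative q x) (at x)"
    using holomorphic_starlike_primitive[of slit q "{}"] holo_q starlike_slit open_slit
    by (auto simp: holomorphic_on_imp_continuous_on holomorphic_on_open field_differentiable_def)
  have "\<exists>G. G 0 = 0 \<and> (\<forall>z\<in>slit. (G has_field_derivative q z) (at z))"
    by (rule exI[of _ "\<lambda>z. g z - g 0"]) (use g in \<open>auto intro!: derivative_eq_intros\<close>)
  from someI_ex[OF this] show "G 0 = 0" "z \<in> slit \<Longrightarrow> (G has_field_derivative q z) (at z)"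
    unfolding G_def by blast+
qed

lemma ball_slit: "cmod z < 1 \<Longrightarrow> z \<in> slit"
  by (rule cball_slit) (auto simp: corners_def)

text \<open>The radicands satisfy (1 - u') - (1 - u) cis (-4\<theta>) = 1 - cis (-4\<theta>), of
  modulus 2 sin (2\<theta>), so one of them has modulus at least sin (2\<theta>); the other has
  modulus at least 1 - r. The resulting singularity (1 - r)^(-1/2) is integrable along
  radii.\<close>

lemma q_bound:
  assumes "cmod w \<le> r" "r < 1"
  shows "cmod (q w) \<le> (1 / sqrt (sin (2 * \<theta>))) * (1 / sqrt (1 - r))"
proof -
  define u where "u = w^2 * cis (2 * \<theta>)"
  define u' where "u' = w^2 * cis (- 2 * \<theta>)"
  have r0: "0 \<le> r" using assms(1) norm_ge_zero order_trans by blast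
  have "cmod w ^ 2 \<le> r" using assms r0 
    by (metis dual_order.trans less_eq_real_def mult_left_le norm_ge_zero power2_eq_square)
  then have u: "cmod u \<le> r" "cmod u' \<le> r" by (simp_all add: u_def u'_def norm_mult norm_power)
  have g: "cmod (1 - u) \<ge> 1 - r" "cmod (1 - u') \<ge> 1 - r"
    using norm_triangle_ineq2[of 1 u] norm_triangle_ineq2[of 1 u'] u by auto
  have "u' = u * cis (- 4 * \<theta>)" unfolding u_def u'_def by (simp add: mult.assoc cis_mult)
  then have "(1 - u') - (1 - u) * cis (- 4 * \<theta>) = 1 - cis (- 4 * \<theta>)" by (simp add: algebra_simps)
  moreover have "cmod (1 - cis (- 4 * \<theta>)) = 2 * sin (2 * \<theta>)"
  proof -
    have "1 - cis (- 4 * \<theta>) = cis (- 2 * \<theta>) * (cis (2 * \<theta>) - cis (- 2 * \<theta>))"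
      by (simp add: right_diff_distrib cis_mult)
    also have "cis (2 * \<theta>) - cis (- 2 * \<theta>) = 2 * \<i> * of_real (sin (2 * \<theta>))"
      by (simp add: complex_eq_iff)
    finally show ?thesis using sin2 by (simp add: norm_mult)
  qed
  ultimately have "2 * sin (2 * \<theta>) = cmod ((1 - u') - (1 - u) * cis (- 4 * \<theta>))" by (simp only:)
  also have "\<dots> \<le> cmod (1 - u') + cmod (1 - u)"
    by (metis norm_cis norm_mult norm_triangle_ineq4 mult.right_neutral)
  finally have "sin (2 * \<theta>) \<le> cmod (1 - u) \<or> sin (2 * \<theta>) \<le> cmod (1 - u')" by linarith
  then have P: "(1 - r) * sin (2 * \<theta>) \<le> cmod (1 - u) * cmod (1 - u')"
  proof
    assume "sin (2 * \<theta>) \<le> cmod (1 - u)"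
    then have "sin (2 * \<theta>) * (1 - r) \<le> cmod (1 - u) * cmod (1 - u')"
      using g assms sin2 by (intro mult_mono) auto
    then show ?thesis by (simp add: mult.commute)
  next
    assume "sin (2 * \<theta>) \<le> cmod (1 - u')"
    then show ?thesis using g assms sin2 by (intro mult_mono) auto
  qed
  have "cmod (q w) = 1 / sqrt (cmod (1 - u) * cmod (1 - u'))"
    unfolding q_def u_def u'_def by (simp add: norm_divide norm_mult real_sqrt_mult)
  also have "\<dots> \<le> 1 / sqrt ((1 - r) * sin (2 * \<theta>))"
    using P assms sin2 by (intro divide_left_mono real_sqrt_le_mono mult_pos_pos) 
      (auto intro!: mult_pos_pos less_le_trans[OF _ P])
  also have "\<dots> = (1 / sqrt (sin (2 * \<theta>))) * (1 / sqrt (1 - r))" by (simp add: real_sqrt_mult)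
  finally show ?thesis .
qed

text \<open>Integration of \<open>q_bound\<close> along a radius. The estimate is uniform in z,
  corners included.\<close>

lemma G_radial:
  assumes "cmod z \<le> 1" "0 \<le> r" "r \<le> r'" "r' < 1"
  shows "cmod (G (of_real r' * z) - G (of_real r * z)) \<le> 2 / sqrt (sin (2 * \<theta>)) * sqrt (1 - r)"
proof (cases "r = r'")
  case False
  then have rr: "r < r'" using assms by simp
  define C where "C = 1 / sqrt (sin (2 * \<theta>))"
  have C: "C > 0" using sin2 by (simp add: C_def)
  have d: "((\<lambda>x. G (of_real x * z)) has_vector_derivative (z * q (of_real x * z))) (at x)"
    if "0 \<le> x" "x < 1" for x
  proof -
    have "cmod (of_real x * z) < 1" using that assms(1)
      by (simp add: norm_mult) (metis less_eq_real_def mult_left_le_one_le norm_ge_zero order_le_less_trans mult.commute)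
    then have D: "(G has_field_derivative q (of_real x * z)) (at (of_real x * z))"
      using G_props(2) ball_slit by blast
    have "((\<lambda>x. of_real x * z) has_vector_derivative z) (at x)"
      by (auto intro!: derivative_eq_intros simp: has_real_derivative_iff_has_vector_derivative)
    from field_vector_diff_chain_at[OF this D] show ?thesis by (simp add: o_def)
  qed
  have nz: "cmod (of_real x * z) \<le> x" if "0 \<le> x" for x
    using that assms(1) by (simp add: norm_mult mult_left_le)
  have "cmod (G (of_real r' * z) - G (of_real r * z)) \<le> (- 2 * C * sqrt (1 - r')) - (- 2 * C * sqrt (1 - r))"
  proof (rule differentiable_bound_general[OF rr, where f' = "\<lambda>x. z * q (of_real x * z)" and \<phi>' = "\<lambda>x. C * (1 / sqrt (1 - x))"])
    show "continuous_on {r..r'} (\<lambda>x. G (of_real x * z))"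
    proof (intro continuous_at_imp_continuous_on ballI)
      fix x assume "x \<in> {r..r'}"
      then show "isCont (\<lambda>x. G (of_real x * z)) x"
        using has_vector_derivative_continuous[OF d[of x]] assms by auto
    qed
    show "continuous_on {r..r'} (\<lambda>x. - 2 * C * sqrt (1 - x))" by (intro continuous_intros)
    show "((\<lambda>x. G (of_real x * z)) has_vector_derivative z * q (of_real x * z)) (at x)" if "r < x" "x < r'" for x
      using d that assms by auto
    show "((\<lambda>x. - 2 * C * sqrt (1 - x)) has_vector_derivative C * (1 / sqrt (1 - x))) (at x)" if "r < x" "x < r'" for x
      unfolding has_real_derivative_iff_has_vector_derivative[symmetric]
      using that assms by (auto intro!: derivative_eq_intros simp: field_simps)
    show "cmod (z * q (of_real x * z)) \<le> C * (1 / sqrt (1 - x))" if "r < x" "x < r'" for x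
    proof -
      have "cmod (q (of_real x * z)) \<le> C * (1 / sqrt (1 - x))"
        unfolding C_def using that assms by (intro q_bound nz) auto
      then show ?thesis using assms(1) by (simp add: norm_mult) (meson mult_left_le_one_le norm_ge_zero order_trans)
    qed
  qed
  also have "\<dots> \<le> 2 * C * sqrt (1 - r)" using C assms by simp
  finally show ?thesis by (simp add: C_def)
qed (use sin2 assms in simp)

text \<open>The radial limit extends \<open>G\<close> to the whole closed disk, also to the corners,
  which lie outside \<open>slit\<close>. The index shift by 2 keeps the radii in [1/2, 1).\<close>

definition f :: "complex \<Rightarrow> complex" where
  "f z = lim (\<lambda>n. G (of_real (1 - 1 / real (n + 2)) * z))"

lemma f_G:
  assumes "z \<in> slit" shows "f z = G z"
proof -
  have "(\<lambda>n. of_real (1 - 1 / real (n + 2)) * z) \<longlonglongrightarrow> of_real (1 - 0) * z"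
    by (intro tendsto_intros) (use LIMSEQ_ignore_initial_segment[OF lim_1_over_n, of 2] in \<open>simp add: add.commute\<close>)
  moreover have "isCont G z" using G_props(2)[OF assms] by (rule DERIV_isCont)
  ultimately have "(\<lambda>n. G (of_real (1 - 1 / real (n + 2)) * z)) \<longlonglongrightarrow> G z"
    using isCont_tendsto_compose by fastforce
  then show ?thesis unfolding f_def by (rule limI)
qed

text \<open>By \<open>G_radial\<close> the dilations of \<open>G\<close> are uniformly Cauchy on the
  closed disk, so the limit inherits their continuity.\<close>

lemma cont_f: "continuous_on (cball 0 1) f"
proof -
  define s where "s n z = G (of_real (1 - 1 / real (n + 2)) * z)" for n z
  define C where "C = 2 / sqrt (sin (2 * \<theta>))"
  have C: "C > 0" using sin2 by (simp add: C_def)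
  have bnd: "dist (s m z) (s n z) \<le> C * sqrt (1 / real (N + 2))" if "N \<le> m" "N \<le> n" "cmod z \<le> 1" for m n N z
  proof -
    have *: "dist (s m z) (s n z) \<le> C * sqrt (1 / real (N + 2))" if "N \<le> m" "m \<le> n" for m n
    proof -
      have "1 / real (n + 2) \<le> 1 / real (m + 2)" "1 / real (m + 2) \<le> 1 / real (N + 2)" using that by (auto simp: field_simps)
      moreover have "1 / real (m + 2) \<le> 1" by simp
      ultimately have "cmod (s n z - s m z) \<le> C * sqrt (1 - (1 - 1 / real (m + 2)))"
        unfolding s_def C_def using \<open>cmod z \<le> 1\<close> by (intro G_radial) auto
      also have "\<dots> \<le> C * sqrt (1 / real (N + 2))"
        using C \<open>1 / real (m + 2) \<le> 1 / real (N + 2)\<close> by (simp del: of_nat_add)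
      finally show ?thesis by (simp add: dist_norm norm_minus_commute)
    qed
    show ?thesis using *[of m n] *[of n m] that by (cases "m \<le> n") (auto simp: dist_commute)
  qed
  have "(\<lambda>N. C * sqrt (1 / real (N + 2))) \<longlonglongrightarrow> C * sqrt 0"
    by (intro tendsto_intros) (use LIMSEQ_ignore_initial_segment[OF lim_1_over_n, of 2] in \<open>simp add: add.commute\<close>)
  then have "\<exists>N. C * sqrt (1 / real (N + 2)) < e" if "e > 0" for e
    using that order_tendstoD(2)[of _ "C * sqrt 0" sequentially e] by (auto simp: eventually_sequentially)
  then have "\<forall>e>0. \<exists>N. \<forall>m n z. N \<le> m \<and> N \<le> n \<and> cmod z \<le> 1 \<longrightarrow> dist (s m z) (s n z) < e"
    by (meson bnd le_less_trans)
  then obtain l where l: "\<forall>e>0. \<exists>N. \<forall>n z. N \<le> n \<and> cmod z \<le> 1 \<longrightarrow> dist (s n z) (l z) < e"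
    using uniformly_convergent_eq_cauchy[of "\<lambda>z. cmod z \<le> 1" s] by blast
  have ul: "uniform_limit (cball 0 1) s l sequentially"
    unfolding uniform_limit_iff eventually_sequentially
  proof (intro allI impI)
    fix e :: real assume "e > 0"
    then obtain N where "\<forall>n z. N \<le> n \<and> cmod z \<le> 1 \<longrightarrow> dist (s n z) (l z) < e" using l by blast
    then show "\<exists>N. \<forall>n\<ge>N. \<forall>x\<in>cball 0 1. dist (s n x) (l x) < e" by (intro exI[of _ N]) auto
  qed
  have cs: "continuous_on (cball 0 1) (s n)" for n
  proof -
    have "cmod (of_real (1 - 1 / real (n + 2)) * z) < 1" if "cmod z \<le> 1" for z
    proof -
      have "\<bar>1 - 1 / real (n + 2)\<bar> < 1" by (simp add: field_simps)
      then show ?thesis using that unfolding norm_mult norm_of_real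
        by (metis abs_ge_zero le_less_trans mult_left_le)
    qed
    then have im: "(\<lambda>z::complex. of_real (1 - 1 / real (n + 2)) * z) ` cball 0 1 \<subseteq> ball 0 1" 
      by (auto simp del: of_real_diff of_real_divide)
    have "continuous_on (ball 0 1) G"
      by (rule continuous_at_imp_continuous_on) (use G_props(2) ball_slit DERIV_isCont in \<open>auto, blast\<close>)
    moreover have "continuous_on (cball 0 1) (\<lambda>z. of_real (1 - 1 / real (n + 2)) * z :: complex)"
      by (rule continuous_on_mult_left) (rule continuous_on_id)
    ultimately show ?thesis unfolding s_def using im by (rule continuous_on_compose2)
  qed
  have "continuous_on (cball 0 1) l"
    by (rule uniform_limit_theorem[OF _ ul]) (use cs in auto)
  moreover have "f z = l z" if "z \<in> cball 0 1" for z
  proof -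
    have "(\<lambda>n. s n z) \<longlonglongrightarrow> l z" by (rule tendsto_uniform_limitI[OF ul that])
    then show ?thesis unfolding f_def s_def by (rule limI)
  qed
  then have "continuous_on (cball 0 1) f \<longleftrightarrow> continuous_on (cball 0 1) l" by (intro continuous_on_cong) auto
  ultimately show ?thesis by simp
qed

end

lemma ellip_integrand_pos:
  fixes s x :: real
  assumes "s \<noteq> 0" shows "(1 - x^2)^2 + 4 * x^2 * s^2 > 0"
proof (cases "x = 0")
  case False
  then have "4 * x^2 * s^2 > 0" using assms by simp
  then show ?thesis by (simp add: add_nonneg_pos)
qed simp

lemma ellip_integrand_cont:
  assumes "s \<noteq> 0"
  shows "continuous_on UNIV (\<lambda>x. 1 / sqrt ((1 - x^2)^2 + 4 * x^2 * s^2))"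
proof -
  have "(1 - x^2)^2 + 4 * x^2 * s^2 > 0" for x :: real
    by (rule ellip_integrand_pos[OF assms])
  then show ?thesis by (intro continuous_intros) (metis less_irrefl real_sqrt_eq_zero_cancel_iff)+
qed

lemma ellip_has_integral:
  assumes "s \<noteq> 0"
  shows "((\<lambda>x. 1 / sqrt ((1 - x^2)^2 + 4 * x^2 * s^2)) has_integral ellip s) {0..1}"
  unfolding ellip_def using ellip_integrand_cont[OF assms]
  by (intro integrable_integral integrable_continuous_real) (auto intro: continuous_on_subset)

lemma ellip_pos:
  assumes "s \<noteq> 0" shows "ellip s > 0"
proof -
  have "(1 - x^2)^2 + 4 * x^2 * s^2 > 0" for x :: real
    by (rule ellip_integrand_pos[OF assms])
  moreover have "continuous_on {0..1} (\<lambda>x. 1 / sqrt ((1 - x^2)^2 + 4 * x^2 * s^2))"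
    using ellip_integrand_cont[OF assms] by (rule continuous_on_subset) simp
  ultimately have "integral {0..1} (\<lambda>x. 0) < ellip s"
    unfolding ellip_def
    using integral_less_real[of 0 1 "\<lambda>x. 0" "\<lambda>x. 1 / sqrt ((1 - x^2)^2 + 4 * x^2 * s^2)"] by auto
  then show ?thesis by simp
qed

section \<open>Values on the axes and along the circle\<close>

context schwarz_christoffel
begin

abbreviation "A \<equiv> ellip (sin \<theta>)"
abbreviation "B \<equiv> ellip (cos \<theta>)"

lemma sin_cos_pos: "sin \<theta> > 0" "cos \<theta> > 0"
  using theta by (auto intro: sin_gt_zero2 cos_gt_zero)

lemma AB_pos: "A > 0" "B > 0"
  using sin_cos_pos by (auto intro!: ellip_pos)

text \<open>For real z^2 the two radicands are complex conjugates, hence so are their roots, and the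
  product of the roots is the modulus of one radicand.\<close>

lemma q_real:
  assumes "z^2 = of_real s" "z \<in> slit"
  shows "q z = of_real (1 / sqrt (1 - 2 * s * cos (2 * \<theta>) + s^2))"
proof -
  define w where "w = csqrt (1 - z^2 * cis (2 * \<theta>))"
  have "csqrt (1 - z^2 * cis (- 2 * \<theta>)) = cnj w"
    unfolding w_def using assms by (subst cnj_csqrt) (auto simp: slit_def cis_cnj)
  then have "q z = 1 / (w * cnj w)" by (simp add: q_def w_def)
  also have "w * cnj w = of_real ((cmod w)^2)" by (simp add: complex_norm_square[symmetric] complex_mult_cnj cmod_def)
  also have "(cmod w)^2 = cmod (1 - of_real s * cis (2 * \<theta>))"
    using assms unfolding w_def by simp
  also have "\<dots> = sqrt (1 - 2 * s * cos (2 * \<theta>) + s^2)"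
  proof -
    have "(1 - s * cos (2 * \<theta>))^2 + (s * sin (2 * \<theta>))^2 
        = 1 - 2 * s * cos (2 * \<theta>) + s^2 * ((sin (2 * \<theta>))^2 + (cos (2 * \<theta>))^2)"
      by algebra
    then show ?thesis by (simp add: cmod_def)
  qed
  finally show ?thesis by simp
qed

lemma q_axes:
  assumes "0 \<le> x" "x \<le> 1"
  shows "\<omega> = 1 \<or> \<omega> = -1 \<Longrightarrow> q (of_real x * \<omega>) = of_real (1 / sqrt ((1 - x^2)^2 + 4 * x^2 * (sin \<theta>)^2))"
    and "\<omega> = \<i> \<or> \<omega> = -\<i> \<Longrightarrow> q (of_real x * \<omega>) = of_real (1 / sqrt ((1 - x^2)^2 + 4 * x^2 * (cos \<theta>)^2))"
    and "\<omega> = 1 \<or> \<omega> = -1 \<or> \<omega> = \<i> \<or> \<omega> = -\<i> \<Longrightarrow> of_real x * \<omega> \<in> slit"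
proof -
  show s: "of_real x * \<omega> \<in> slit" if "\<omega> = 1 \<or> \<omega> = -1 \<or> \<omega> = \<i> \<or> \<omega> = -\<i>" for \<omega> :: complex
  proof (rule cball_slit)
    show "cmod (of_real x * \<omega>) \<le> 1" using that assms by (auto simp: norm_mult)
    show "of_real x * \<omega> \<notin> corners" using that sin_cos_pos by (auto simp: corners_def complex_eq_iff)
  qed
  show "q (of_real x * \<omega>) = of_real (1 / sqrt ((1 - x^2)^2 + 4 * x^2 * (sin \<theta>)^2))" if "\<omega> = 1 \<or> \<omega> = -1"
  proof -
    have "1 - 2 * x^2 * cos (2 * \<theta>) + (x^2)^2 = (1 - x^2)^2 + 4 * x^2 * (sin \<theta>)^2"
      unfolding cos_double_sin by algebra
    then show ?thesis
      using q_real[of "of_real x * \<omega>" "x^2"] s[of \<omega>] that by (auto simp: power_mult_distrib)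
  qed
  show "q (of_real x * \<omega>) = of_real (1 / sqrt ((1 - x^2)^2 + 4 * x^2 * (cos \<theta>)^2))" if "\<omega> = \<i> \<or> \<omega> = -\<i>"
  proof -
    have "1 - 2 * (-(x^2)) * cos (2 * \<theta>) + (-(x^2))^2 = (1 - x^2)^2 + 4 * x^2 * (cos \<theta>)^2"
      unfolding cos_double_cos by algebra
    then show ?thesis
      using q_real[of "of_real x * \<omega>" "-(x^2)"] s[of \<omega>] that by (auto simp: power_mult_distrib)
  qed
qed

lemma G_ray:
  assumes "\<And>x. 0 \<le> x \<Longrightarrow> x \<le> 1 \<Longrightarrow> of_real x * \<omega> \<in> slit"
    and "\<And>x. 0 \<le> x \<Longrightarrow> x \<le> 1 \<Longrightarrow> q (of_real x * \<omega>) = of_real (k x)"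
    and "(k has_integral I) {0..1}"
  shows "G \<omega> = \<omega> * of_real I"
proof -
  have "((\<lambda>x. \<omega> * q (of_real x * \<omega>)) has_integral (G (of_real 1 * \<omega>) - G (of_real 0 * \<omega>))) {0..1}"
  proof (rule fundamental_theorem_of_calculus)
    fix x :: real assume x: "x \<in> {0..1}"
    have D: "(G has_field_derivative q (of_real x * \<omega>)) (at (of_real x * \<omega>))"
      using G_props(2) assms(1) x by auto
    have "((\<lambda>x. of_real x * \<omega>) has_vector_derivative \<omega>) (at x)"
      by (auto intro!: derivative_eq_intros simp: has_real_derivative_iff_has_vector_derivative)
    from field_vector_diff_chain_at[OF this D]
    show "((\<lambda>x. G (of_real x * \<omega>)) has_vector_derivative \<omega> * q (of_real x * \<omega>)) (at x within {0..1})"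
      by (simp add: o_def has_vector_derivative_at_within)
  qed simp
  then have 1: "((\<lambda>x. \<omega> * of_real (k x)) has_integral G \<omega>) {0..1}"
    using assms(2) G_props(1) by (subst has_integral_cong[where g = "\<lambda>x. \<omega> * q (of_real x * \<omega>)"]) auto
  have "((\<lambda>x. \<omega> * of_real (k x)) has_integral \<omega> * of_real I) {0..1}"
    using assms(3) by (intro has_integral_mult_right has_integral_of_real)
  from has_integral_unique[OF 1 this] show ?thesis .
qed

lemma f_axes: "f 1 = of_real A" "f (-1) = - of_real A" "f \<i> = \<i> * of_real B" "f (-\<i>) = - \<i> * of_real B"
proof -
  have s: "1 \<in> slit" "-1 \<in> slit" "\<i> \<in> slit" "-\<i> \<in> slit"
    using q_axes(3)[of 1 1] q_axes(3)[of 1 "-1"] q_axes(3)[of 1 \<i>] q_axes(3)[of 1 "-\<i>"] by auto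
  have "G \<omega> = \<omega> * of_real A" if "\<omega> = 1 \<or> \<omega> = -1" for \<omega>
    by (rule G_ray[OF q_axes(3) q_axes(1) ellip_has_integral]) (use that sin_cos_pos in auto)
  then show "f 1 = of_real A" "f (-1) = - of_real A" using f_G s by auto
  have "G \<omega> = \<omega> * of_real B" if "\<omega> = \<i> \<or> \<omega> = -\<i>" for \<omega>
    by (rule G_ray[OF q_axes(3) q_axes(2) ellip_has_integral]) (use that sin_cos_pos in auto)
  then show "f \<i> = \<i> * of_real B" "f (-\<i>) = - \<i> * of_real B" using f_G s by auto
qed

lemma f_deriv: "z \<in> slit \<Longrightarrow> (f has_field_derivative q z) (at z)"
  using G_props(2) f_G open_slit
  by (auto intro: has_field_derivative_transform_within_open[where f = G])

text \<open>The square of the derivative along the circle is real, so that on each of the four arcs the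
  derivative itself is real or purely imaginary.\<close>

lemma f_cis_deriv:
  assumes "cos (2 * t) \<noteq> cos (2 * \<theta>)"
  obtains D where "((\<lambda>t. Re (f (cis t))) has_real_derivative Re D) (at t)"
    and "((\<lambda>t. Im (f (cis t))) has_real_derivative Im D) (at t)"
    and "D^2 = of_real (- 1 / (2 * cos (2 * t) - 2 * cos (2 * \<theta>)))"
proof -
  have s: "cis t \<in> slit"
  proof (rule cball_slit)
    have "(cis t)^2 \<noteq> (cis \<theta>)^2" "(cis t)^2 \<noteq> (cis (- \<theta>))^2"
      using assms by (auto simp: power2_eq_square cis_mult complex_eq_iff)
    then show "cis t \<notin> corners" by (auto simp: corners_def)
  qed simp
  have "(cis has_vector_derivative \<i> * cis t) (at t)"
  proof -
    have "((\<lambda>z. exp (\<i> * z)) has_field_derivative \<i> * cis t) (at (of_real t))"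
      by (auto simp: cis_conv_exp intro!: derivative_eq_intros)
    from has_vector_derivative_real_field[OF this, of UNIV] show ?thesis
      by (simp add: cis_conv_exp[abs_def])
  qed
  from field_vector_diff_chain_at[OF this f_deriv[OF s]]
  have D: "((\<lambda>t. f (cis t)) has_vector_derivative (\<i> * cis t) * q (cis t)) (at t)"
    by (simp add: o_def)
  define E where "E = (\<i> * cis t) * q (cis t)"
  have c2: "(cis t)^2 = cis (2 * t)" by (simp add: power2_eq_square cis_mult)
  \<comment> \<open>The factor cis (2t) cancels against the square of the tangent vector i cis t,
    which leaves a real number with the sign of cos (2\<theta>) - cos (2t).\<close>
  have "(1 - cis (2 * t) * cis (2 * \<theta>)) * (1 - cis (2 * t) * cis (- 2 * \<theta>))
     = cis (2 * t) * (of_real (2 * cos (2 * t) - 2 * cos (2 * \<theta>)))"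
  proof -
    have 1: "cis (2 * t) * cis (2 * t) = cis (2 * t) * of_real (2 * cos (2 * t)) - 1"
      using sin_cos_squared_add[of "2 * t"] 
      by (simp add: complex_eq_iff power2_eq_square algebra_simps)
    have 2: "cis (2 * \<theta>) + cis (- 2 * \<theta>) = of_real (2 * cos (2 * \<theta>))" by (simp add: complex_eq_iff)
    have 3: "cis (2 * \<theta>) * cis (- 2 * \<theta>) = 1" by (simp add: cis_mult)
    have "(1 - cis (2 * t) * cis (2 * \<theta>)) * (1 - cis (2 * t) * cis (- 2 * \<theta>))
       = 1 - cis (2 * t) * (cis (2 * \<theta>) + cis (- 2 * \<theta>)) + cis (2 * t) * cis (2 * t) * (cis (2 * \<theta>) * cis (- 2 * \<theta>))"
      by (simp add: algebra_simps)
    also have "\<dots> = cis (2 * t) * (of_real (2 * cos (2 * t) - 2 * cos (2 * \<theta>)))"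
      unfolding 2 3 1 by (simp add: algebra_simps)
    finally show ?thesis .
  qed
  note P = this
  have "E^2 = - cis (2 * t) * (1 / (cis (2 * t) * (of_real (2 * cos (2 * t) - 2 * cos (2 * \<theta>)))))"
    unfolding E_def power_mult_distrib q_sq[OF s] c2 P power2_i by (simp only: mult_minus1)
  also have "\<dots> = - (1 / of_real (2 * cos (2 * t) - 2 * cos (2 * \<theta>)))"
    by (simp del: of_real_diff of_real_mult)
  also have "\<dots> = of_real (- 1 / (2 * cos (2 * t) - 2 * cos (2 * \<theta>)))"
    by (simp del: of_real_diff of_real_mult)
  finally have "E^2 = of_real (- 1 / (2 * cos (2 * t) - 2 * cos (2 * \<theta>)))" .
  moreover have "((\<lambda>t. Re (f (cis t))) has_real_derivative Re E) (at t)"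
      "((\<lambda>t. Im (f (cis t))) has_real_derivative Im E) (at t)"
    using bounded_linear.has_vector_derivative[OF bounded_linear_Re D]
      bounded_linear.has_vector_derivative[OF bounded_linear_Im D]
    unfolding E_def[symmetric] has_real_derivative_iff_has_vector_derivative by blast+
  ultimately show ?thesis using that by blast
qed

lemma cont_f_cis: "continuous_on S (\<lambda>t. f (cis t))"
  by (intro continuous_on_compose2[OF cont_f] continuous_intros) auto

text \<open>By Rolle a nowhere vanishing derivative gives injectivity whatever its sign, so one
  lemma serves all four arcs.\<close>

lemma arc_const_inj:
  fixes u v :: "real \<Rightarrow> real"
  assumes ab: "\<alpha> < \<beta>" and cont: "continuous_on {\<alpha>..\<beta>} u" "continuous_on {\<alpha>..\<beta>} v"
    and d: "\<And>t. \<alpha> < t \<Longrightarrow> t < \<beta> \<Longrightarrow> \<exists>D. (u has_real_derivative 0) (at t) \<and> (v has_real_derivative D) (at t) \<and> D \<noteq> 0"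
  shows "t \<in> {\<alpha>..\<beta>} \<Longrightarrow> u t = u \<alpha>" and "inj_on v {\<alpha>..\<beta>}"
proof -
  show "t \<in> {\<alpha>..\<beta>} \<Longrightarrow> u t = u \<alpha>"
    using DERIV_isconst2[OF ab cont(1), of t] d by auto
  have "v s \<noteq> v t" if "\<alpha> \<le> s" "s < t" "t \<le> \<beta>" for s t
  proof
    assume "v s = v t"
    moreover have "continuous_on {s..t} v" using cont(2) by (rule continuous_on_subset) (use that in auto)
    moreover have "v differentiable (at x)" if "s < x" "x < t" for x
      using d[of x] that \<open>\<alpha> \<le> s\<close> \<open>t \<le> \<beta>\<close> real_differentiable_def by fastforce
    ultimately obtain x where "s < x" "x < t" "(v has_real_derivative 0) (at x)"
      using Rolle[OF \<open>s < t\<close>] by blast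
    then show False using d[of x] that DERIV_unique by fastforce
  qed
  then show "inj_on v {\<alpha>..\<beta>}"
    by (intro inj_onI) (metis atLeastAtMost_iff linorder_neqE_linordered_idom)
qed

lemma arc_vertical:
  assumes "\<alpha> < \<beta>" "\<And>t. \<alpha> < t \<Longrightarrow> t < \<beta> \<Longrightarrow> cos (2 * t) > cos (2 * \<theta>)"
  shows "t \<in> {\<alpha>..\<beta>} \<Longrightarrow> Re (f (cis t)) = Re (f (cis \<alpha>))" and "inj_on (\<lambda>t. Im (f (cis t))) {\<alpha>..\<beta>}"
proof -
  have "\<exists>D. ((\<lambda>t. Re (f (cis t))) has_real_derivative 0) (at t) \<and> ((\<lambda>t. Im (f (cis t))) has_real_derivative D) (at t) \<and> D \<noteq> 0"
    if "\<alpha> < t" "t < \<beta>" for t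
  proof -
    have c: "cos (2 * t) > cos (2 * \<theta>)" using assms that by auto
    then obtain D where D: "((\<lambda>t. Re (f (cis t))) has_real_derivative Re D) (at t)"
      "((\<lambda>t. Im (f (cis t))) has_real_derivative Im D) (at t)"
      "D^2 = of_real (- 1 / (2 * cos (2 * t) - 2 * cos (2 * \<theta>)))"
      using f_cis_deriv[of t] by (metis less_irrefl)
    have "Re (D^2) < 0" "Im (D^2) = 0" unfolding D(3) using c by (simp_all add: divide_pos_pos del: of_real_divide)
    then have "Re D = 0" "Im D \<noteq> 0" 
      by (auto simp: power2_eq_square)
    then show ?thesis using D(1,2) by (intro exI[of _ "Im D"]) simp
  qed
  note * = arc_const_inj[OF assms(1) _ _ this]
  have c: "continuous_on {\<alpha>..\<beta>} (\<lambda>t. Re (f (cis t)))" "continuous_on {\<alpha>..\<beta>} (\<lambda>t. Im (f (cis t)))"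
    by (intro continuous_intros cont_f_cis)+
  show "t \<in> {\<alpha>..\<beta>} \<Longrightarrow> Re (f (cis t)) = Re (f (cis \<alpha>))" using *(1)[OF c] .
  show "inj_on (\<lambda>t. Im (f (cis t))) {\<alpha>..\<beta>}" using *(2)[OF c] .
qed

lemma arc_horizontal:
  assumes "\<alpha> < \<beta>" "\<And>t. \<alpha> < t \<Longrightarrow> t < \<beta> \<Longrightarrow> cos (2 * t) < cos (2 * \<theta>)"
  shows "t \<in> {\<alpha>..\<beta>} \<Longrightarrow> Im (f (cis t)) = Im (f (cis \<alpha>))" and "inj_on (\<lambda>t. Re (f (cis t))) {\<alpha>..\<beta>}"
proof -
  have "\<exists>D. ((\<lambda>t. Im (f (cis t))) has_real_derivative 0) (at t) \<and> ((\<lambda>t. Re (f (cis t))) has_real_derivative D) (at t) \<and> D \<noteq> 0"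
    if "\<alpha> < t" "t < \<beta>" for t
  proof -
    have c: "cos (2 * t) < cos (2 * \<theta>)" using assms that by auto
    then obtain D where D: "((\<lambda>t. Re (f (cis t))) has_real_derivative Re D) (at t)"
      "((\<lambda>t. Im (f (cis t))) has_real_derivative Im D) (at t)"
      "D^2 = of_real (- 1 / (2 * cos (2 * t) - 2 * cos (2 * \<theta>)))"
      using f_cis_deriv[of t] by (metis less_irrefl)
    have "Re (D^2) > 0" "Im (D^2) = 0" unfolding D(3) using c by (simp_all add: divide_neg_neg del: of_real_divide)
    then have "Im D = 0" "Re D \<noteq> 0" 
      by (auto simp: power2_eq_square)
    then show ?thesis using D(1,2) by (intro exI[of _ "Re D"]) simp
  qed
  note * = arc_const_inj[OF assms(1) _ _ this]
  have c: "continuous_on {\<alpha>..\<beta>} (\<lambda>t. Re (f (cis t)))" "continuous_on {\<alpha>..\<beta>} (\<lambda>t. Im (f (cis t)))"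
    by (intro continuous_intros cont_f_cis)+
  show "t \<in> {\<alpha>..\<beta>} \<Longrightarrow> Im (f (cis t)) = Im (f (cis \<alpha>))" using *(1)[OF c(2,1)] .
  show "inj_on (\<lambda>t. Re (f (cis t))) {\<alpha>..\<beta>}" using *(2)[OF c(2,1)] .
qed

end

context schwarz_christoffel
begin

lemma cos_2_gt: "\<bar>t\<bar> < \<theta> \<Longrightarrow> cos (2 * t) > cos (2 * \<theta>)"
  using cos_monotone_0_pi[of "2 * \<bar>t\<bar>" "2 * \<theta>"] theta by (cases "t \<ge> 0") auto

lemma cos_2_lt:
  assumes "\<theta> < t" "t < pi - \<theta>" shows "cos (2 * t) < cos (2 * \<theta>)"
proof (cases "2 * t \<le> pi")
  case True
  then show ?thesis using cos_monotone_0_pi[of "2 * \<theta>" "2 * t"] theta assms by auto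
next
  case False
  have "cos (2 * pi - 2 * t) < cos (2 * \<theta>)"
    using False assms theta by (intro cos_monotone_0_pi) auto
  then show ?thesis by (simp add: cos_diff)
qed

lemma cos_2_shift: "cos (2 * (t - pi)) = cos (2 * t)" for t :: real
  by (simp add: right_diff_distrib cos_diff)

lemma cis_special: "cis (- \<theta>) = cnj (cis \<theta>)" "cis (pi - \<theta>) = - cis (- \<theta>)" "cis (pi + \<theta>) = - cis \<theta>"
   "cis (2 * pi - \<theta>) = cis (- \<theta>)" "cis pi = -1" "cis (3 * pi / 2) = - \<i>"
proof -
  have "3 * pi / 2 = pi + pi / 2" by simp
  then have "cis (3 * pi / 2) = cis pi * cis (pi / 2)" by (simp only: cis_mult)
  then show "cis (3 * pi / 2) = - \<i>" by simp
qed (simp_all add: complex_eq_iff cos_diff sin_diff)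

lemma f_right: "t \<in> {-\<theta>..\<theta>} \<Longrightarrow> Re (f (cis t)) = A" "inj_on (\<lambda>t. Im (f (cis t))) {-\<theta>..\<theta>}"
proof -
  have c: "- \<theta> < t \<Longrightarrow> t < \<theta> \<Longrightarrow> cos (2 * t) > cos (2 * \<theta>)" for t using cos_2_gt[of t] by auto
  note * = arc_vertical[of "-\<theta>" \<theta>, OF _ c]
  have "Re (f (cis 0)) = Re (f (cis (- \<theta>)))" using *(1)[of 0] theta by auto
  then show "t \<in> {-\<theta>..\<theta>} \<Longrightarrow> Re (f (cis t)) = A" using *(1)[of t] theta f_axes by auto
  show "inj_on (\<lambda>t. Im (f (cis t))) {-\<theta>..\<theta>}" using *(2) theta by auto
qed

lemma f_top: "t \<in> {\<theta>..pi - \<theta>} \<Longrightarrow> Im (f (cis t)) = B" "inj_on (\<lambda>t. Re (f (cis t))) {\<theta>..pi - \<theta>}"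
proof -
  note * = arc_horizontal[of \<theta> "pi - \<theta>", OF _ cos_2_lt]
  have "Im (f (cis (pi / 2))) = Im (f (cis \<theta>))" using *(1)[of "pi / 2"] theta by auto
  then show "t \<in> {\<theta>..pi - \<theta>} \<Longrightarrow> Im (f (cis t)) = B" using *(1)[of t] theta f_axes by auto
  show "inj_on (\<lambda>t. Re (f (cis t))) {\<theta>..pi - \<theta>}" using *(2) theta by auto
qed

lemma f_left: "t \<in> {pi - \<theta>..pi + \<theta>} \<Longrightarrow> Re (f (cis t)) = - A" "inj_on (\<lambda>t. Im (f (cis t))) {pi - \<theta>..pi + \<theta>}"
proof -
  have c: "pi - \<theta> < t \<Longrightarrow> t < pi + \<theta> \<Longrightarrow> cos (2 * t) > cos (2 * \<theta>)" for t
    using cos_2_gt[of "t - pi"] unfolding cos_2_shift by (simp add: abs_less_iff)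
  note * = arc_vertical[of "pi - \<theta>" "pi + \<theta>", OF _ c]
  have "Re (f (cis pi)) = Re (f (cis (pi - \<theta>)))" using *(1)[of pi] theta by auto
  then show "t \<in> {pi - \<theta>..pi + \<theta>} \<Longrightarrow> Re (f (cis t)) = - A"
    using *(1)[of t] theta f_axes by (auto simp: cis_special)
  show "inj_on (\<lambda>t. Im (f (cis t))) {pi - \<theta>..pi + \<theta>}" using *(2) theta by auto
qed

lemma f_bot: "t \<in> {pi + \<theta>..2 * pi - \<theta>} \<Longrightarrow> Im (f (cis t)) = - B" "inj_on (\<lambda>t. Re (f (cis t))) {pi + \<theta>..2 * pi - \<theta>}"
proof -
  have c: "pi + \<theta> < t \<Longrightarrow> t < 2 * pi - \<theta> \<Longrightarrow> cos (2 * t) < cos (2 * \<theta>)" for t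
    using cos_2_lt[of "t - pi"] unfolding cos_2_shift by simp
  note * = arc_horizontal[of "pi + \<theta>" "2 * pi - \<theta>", OF _ c]
  have "Im (f (cis (3 * pi / 2))) = Im (f (cis (pi + \<theta>)))" using *(1)[of "3 * pi / 2"] theta by auto
  then show "t \<in> {pi + \<theta>..2 * pi - \<theta>} \<Longrightarrow> Im (f (cis t)) = - B"
    using *(1)[of t] theta f_axes unfolding cis_special by auto
  show "inj_on (\<lambda>t. Re (f (cis t))) {pi + \<theta>..2 * pi - \<theta>}" using *(2) theta by auto
qed

lemma f_corners: "f (cis \<theta>) = Complex A B" "f (- cis (- \<theta>)) = Complex (- A) B"
  "f (- cis \<theta>) = Complex (- A) (- B)" "f (cis (- \<theta>)) = Complex A (- B)"
  using f_right(1)[of \<theta>] f_top(1)[of \<theta>] f_top(1)[of "pi - \<theta>"] f_left(1)[of "pi - \<theta>"] f_left(1)[of "pi + \<theta>"]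
    f_bot(1)[of "pi + \<theta>"] f_bot(1)[of "2 * pi - \<theta>"] f_right(1)[of "- \<theta>"] theta
  unfolding cis_special(2,3,4) by (auto simp: complex_eq_iff)

lemma strict_between:
  fixes v :: "real \<Rightarrow> real"
  assumes "continuous_on {a..b} v" "inj_on v {a..b}" "a < t" "t < b"
  shows "min (v a) (v b) < v t" "v t < max (v a) (v b)"
  using continuous_inj_imp_mono[OF assms(3,4,1,2)] by auto

text \<open>Each corner is counted with the arc that it opens, in the angles as well as in the
  image. The four half-open sides are then disjoint, and injectivity on the circle becomes a
  comparison of cases.\<close>

lemma f_arcs:
  assumes "t \<in> {-\<theta>..<2 * pi - \<theta>}"
  shows "(t \<in> {-\<theta>..<\<theta>} \<and> Re (f (cis t)) = A \<and> - B \<le> Im (f (cis t)) \<and> Im (f (cis t)) < B) \<or>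
    (t \<in> {\<theta>..<pi - \<theta>} \<and> Im (f (cis t)) = B \<and> - A < Re (f (cis t)) \<and> Re (f (cis t)) \<le> A) \<or>
    (t \<in> {pi - \<theta>..<pi + \<theta>} \<and> Re (f (cis t)) = - A \<and> - B < Im (f (cis t)) \<and> Im (f (cis t)) \<le> B) \<or>
    (t \<in> {pi + \<theta>..<2 * pi - \<theta>} \<and> Im (f (cis t)) = - B \<and> - A \<le> Re (f (cis t)) \<and> Re (f (cis t)) < A)"
proof -
  have cRe: "continuous_on S (\<lambda>t. Re (f (cis t)))" and cIm: "continuous_on S (\<lambda>t. Im (f (cis t)))" for S
    by (intro continuous_intros cont_f_cis)+
  note C = f_corners AB_pos theta
  consider "t \<in> {-\<theta>..<\<theta>}" | "t \<in> {\<theta>..<pi - \<theta>}" | "t \<in> {pi - \<theta>..<pi + \<theta>}" | "t \<in> {pi + \<theta>..<2 * pi - \<theta>}"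
    using assms by fastforce
  then show ?thesis
  proof cases
    case 1
    then have "Re (f (cis t)) = A" using f_right(1) by simp
    moreover have "- B \<le> Im (f (cis t)) \<and> Im (f (cis t)) < B"
      using strict_between[OF cIm f_right(2), of t] 1 C by (cases "t = - \<theta>") auto
    ultimately show ?thesis using 1 by blast
  next
    case 2
    then have "Im (f (cis t)) = B" using f_top(1) by simp
    moreover have "- A < Re (f (cis t)) \<and> Re (f (cis t)) \<le> A"
      using strict_between[OF cRe f_top(2), of t] 2 C by (cases "t = \<theta>") (auto simp: cis_special(2))
    ultimately show ?thesis using 2 by blast
  next
    case 3
    then have "Re (f (cis t)) = - A" using f_left(1) by simp
    moreover have "- B < Im (f (cis t)) \<and> Im (f (cis t)) \<le> B"
      using strict_between[OF cIm f_left(2), of t] 3 C by (cases "t = pi - \<theta>") (auto simp: cis_special(2,3))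
    ultimately show ?thesis using 3 by blast
  next
    case 4
    then have "Im (f (cis t)) = - B" using f_bot(1) by simp
    moreover have "- A \<le> Re (f (cis t)) \<and> Re (f (cis t)) < A"
      using strict_between[OF cRe f_bot(2), of t] 4 C unfolding cis_special(3,4)
      by (cases "t = pi + \<theta>") (auto simp: cis_special(3))
    ultimately show ?thesis using 4 by blast
  qed
qed

lemma f_cis_inj: "inj_on (\<lambda>t. f (cis t)) {-\<theta>..<2 * pi - \<theta>}"
proof (rule inj_onI)
  fix s t assume s: "s \<in> {-\<theta>..<2 * pi - \<theta>}" and t: "t \<in> {-\<theta>..<2 * pi - \<theta>}" and e: "f (cis s) = f (cis t)"
  have inj: "inj_on (\<lambda>t. f (cis t)) {a..<b}" if "inj_on (\<lambda>t. P (f (cis t))) {a..b}" for a b :: real and P :: "complex \<Rightarrow> real"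
  proof (rule inj_onI)
    fix x y assume "x \<in> {a..<b}" "y \<in> {a..<b}" "f (cis x) = f (cis y)"
    then show "x = y" using inj_onD[OF that, of x y] by simp
  qed
  have i: "inj_on (\<lambda>t. f (cis t)) {-\<theta>..<\<theta>}" "inj_on (\<lambda>t. f (cis t)) {\<theta>..<pi - \<theta>}"
    "inj_on (\<lambda>t. f (cis t)) {pi - \<theta>..<pi + \<theta>}" "inj_on (\<lambda>t. f (cis t)) {pi + \<theta>..<2 * pi - \<theta>}"
    by (rule inj; rule f_right f_top f_left f_bot)+
  note j = inj_onD[OF i(1) e] inj_onD[OF i(2) e] inj_onD[OF i(3) e] inj_onD[OF i(4) e]
  have AB: "A > 0" "B > 0" using AB_pos by auto
  from f_arcs[OF s] show "s = t"
  proof (elim disjE conjE)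
    assume "s \<in> {-\<theta>..<\<theta>}" "Re (f (cis s)) = A" "Im (f (cis s)) < B"
    then show ?thesis using f_arcs[OF t] j(1) AB unfolding e by (elim disjE conjE) auto
  next
    assume "s \<in> {\<theta>..<pi - \<theta>}" "Im (f (cis s)) = B" "- A < Re (f (cis s))"
    then show ?thesis using f_arcs[OF t] j(2) AB unfolding e by (elim disjE conjE) auto
  next
    assume "s \<in> {pi - \<theta>..<pi + \<theta>}" "Re (f (cis s)) = - A" "- B < Im (f (cis s))"
    then show ?thesis using f_arcs[OF t] j(3) AB unfolding e by (elim disjE conjE) auto
  next
    assume "s \<in> {pi + \<theta>..<2 * pi - \<theta>}" "Im (f (cis s)) = - B" "Re (f (cis s)) < A"
    then show ?thesis using f_arcs[OF t] j(4) AB unfolding e by (elim disjE conjE) auto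
  qed
qed

section \<open>Bijectivity onto the closed rectangle\<close>

lemma circle_param: "cmod z = 1 \<Longrightarrow> \<exists>t\<in>{-\<theta>..<2 * pi - \<theta>}. z = cis t"
proof -
  assume z: "cmod z = 1"
  obtain s where s: "0 \<le> s" "s < 2 * pi" "z = cis s"
    using Arg2pi_ge_0[of z] Arg2pi_lt_2pi[of z] complex_norm_eq_1_exp[of z] z by (auto simp: cis_conv_exp)
  show ?thesis
  proof (cases "s < 2 * pi - \<theta>")
    case True
    then show ?thesis using s theta by (intro bexI[of _ s]) auto
  next
    case False
    then show ?thesis using s theta by (intro bexI[of _ "s - 2 * pi"]) (auto simp: complex_eq_iff cos_diff sin_diff)
  qed
qed

abbreviation "bx \<equiv> box (Complex (- A) (- B)) (Complex A B)"
abbreviation "cbx \<equiv> cbox (Complex (- A) (- B)) (Complex A B)"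

lemma f_sphere: "cmod z = 1 \<Longrightarrow> f z \<in> cbx - bx"
proof -
  assume "cmod z = 1"
  then obtain t where t: "t \<in> {-\<theta>..<2 * pi - \<theta>}" "z = cis t" using circle_param by blast
  show ?thesis unfolding t(2) using f_arcs[OF t(1)] AB_pos
    by (elim disjE conjE) (simp_all add: in_cbox_complex_iff in_box_complex_iff)
qed

lemma holo_f: "f holomorphic_on ball 0 1"
  unfolding holomorphic_on_open[OF open_ball] using f_deriv ball_slit by (metis mem_ball_0)

text \<open>The Noshiro-Warschawski argument: (f z - f w) / (z - w) is the mean of \<open>q\<close>
  over the segment from w to z, which lies in the disk, and Re q > 0 there.\<close>

lemma f_inj_ball: "inj_on f (ball 0 1)"
proof (rule inj_onI, rule ccontr)
  fix w z assume wz: "w \<in> ball 0 1" "z \<in> ball 0 1" "f w = f z" "w \<noteq> z"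
  define g where "g s = Re (f (w + of_real s * (z - w)) / (z - w))" for s :: real
  have "\<exists>d. (g has_real_derivative d) (at s) \<and> 0 < d" if s: "0 \<le> s" "s \<le> 1" for s
  proof -
    define y where "y = w + of_real s * (z - w)"
    have "y \<in> closed_segment w z" unfolding y_def in_segment using s
      by (intro exI[of _ s]) (simp add: scaleR_conv_of_real algebra_simps)
    then have y: "cmod y < 1" using convex_ball[of 0 1] wz(1,2) unfolding convex_contains_segment
      by (metis mem_ball_0 subsetD)
    have "((\<lambda>s. w + of_real s * (z - w)) has_vector_derivative (z - w)) (at s)"
      by (auto intro!: derivative_eq_intros simp: has_real_derivative_iff_has_vector_derivative)
    from field_vector_diff_chain_at[OF this, of f "q y"]
    have "((\<lambda>s. f (w + of_real s * (z - w))) has_vector_derivative (z - w) * q y) (at s)"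
      using f_deriv[OF ball_slit[OF y]] by (simp add: o_def y_def)
    then have "((\<lambda>s. f (w + of_real s * (z - w)) / (z - w)) has_vector_derivative (z - w) * q y / (z - w)) (at s)"
      by (rule has_vector_derivative_divide)
    then have "(g has_vector_derivative Re (q y)) (at s)"
      unfolding g_def using wz(4) bounded_linear.has_vector_derivative[OF bounded_linear_Re] by fastforce
    then show "\<exists>d. (g has_real_derivative d) (at s) \<and> 0 < d"
      using Re_q_pos[OF y] has_real_derivative_iff_has_vector_derivative by blast
  qed
  then have "g 0 < g 1" by (intro DERIV_pos_imp_increasing[of 0 1 g]) auto
  then show False using wz(3) by (simp add: g_def)
qed

text \<open>The maximum principle for the real part of c f with c = 1, -1, i, -i, one choice for
  each side of the rectangle.\<close>

lemma Re_Im_bound: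
  assumes "cmod z \<le> 1" shows "f z \<in> cbx"
proof -
  have b: "Re (c * f z) \<le> M" if "\<And>w. cmod w = 1 \<Longrightarrow> Re (c * f w) \<le> M" for c M
    by (rule maximum_real_frontier[where S = "cball 0 1"])
      (use that assms holo_f cont_f in \<open>auto intro!: holomorphic_intros continuous_intros\<close>)
  have bd: "- A \<le> Re (f w) \<and> Re (f w) \<le> A \<and> - B \<le> Im (f w) \<and> Im (f w) \<le> B" if "cmod w = 1" for w
    using f_sphere[OF that] by (auto simp: in_cbox_complex_iff)
  have "Re (1 * f z) \<le> A" "Re (-1 * f z) \<le> A" "Re (\<i> * f z) \<le> B" "Re (- \<i> * f z) \<le> B"
    by (rule b; use bd in force)+
  then show ?thesis by (simp add: in_cbox_complex_iff)
qed

text \<open>The image of the open disk is open, and inside the open rectangle it is also relatively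
  closed, because the compact image of the closed disk adds only boundary points of the rectangle.
  The open rectangle is connected.\<close>

lemma f_ball: "f ` ball 0 1 = bx"
proof -
  have op: "open (f ` ball 0 1)" by (intro open_mapping_thm3 holo_f f_inj_ball open_ball)
  then have sub: "f ` ball 0 1 \<subseteq> bx"
    using interior_maximal[of "f ` ball 0 1" cbx] Re_Im_bound
    by (simp add: image_subset_iff)
  have cl: "closed (f ` cball 0 1)"
    by (intro compact_imp_closed compact_continuous_image cont_f compact_cball)
  have split: "f ` cball 0 1 \<inter> bx \<subseteq> f ` ball 0 1"
  proof
    fix y assume "y \<in> f ` cball 0 1 \<inter> bx"
    then obtain z where z: "cmod z \<le> 1" "y = f z" "y \<in> bx" by auto
    then have "cmod z \<noteq> 1" using f_sphere[of z] by auto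
    then show "y \<in> f ` ball 0 1" using z by auto
  qed
  have "connected bx" by (simp add: convex_box(2) convex_connected)
  from connectedD[OF this op open_Compl[OF cl]]
  moreover have "f ` ball 0 1 \<subseteq> f ` cball 0 1" by (intro image_mono) auto
  ultimately have "f ` ball 0 1 \<inter> bx = {} \<or> - f ` cball 0 1 \<inter> bx = {}" using split by blast
  moreover have "f 0 \<in> f ` ball 0 1" by (rule imageI) simp
  then have "f ` ball 0 1 \<inter> bx \<noteq> {}" using sub by blast
  ultimately have "bx \<subseteq> f ` cball 0 1" by blast
  then show ?thesis using sub split by blast
qed

lemma f_homeo: "\<exists>g. homeomorphism (cball 0 1) cbx f g"
proof (rule homeomorphism_compact[OF compact_cball cont_f])
  have "bx \<noteq> {}" using AB_pos by (auto simp: box_ne_empty Basis_complex_def)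
  have "closure bx \<subseteq> f ` cball 0 1"
    unfolding f_ball[symmetric]
    by (intro closure_minimal compact_imp_closed compact_continuous_image cont_f compact_cball image_mono) auto
  then show "f ` cball 0 1 = cbx" using Re_Im_bound \<open>bx \<noteq> {}\<close> by auto
  show "inj_on f (cball 0 1)"
  proof (rule inj_onI)
    fix w z assume wz: "w \<in> cball 0 1" "z \<in> cball 0 1" "f w = f z"
    have b: "f y \<in> bx \<longleftrightarrow> cmod y < 1" if "cmod y \<le> 1" for y
    proof (cases "cmod y < 1")
      case True
      then have "f y \<in> f ` ball 0 1" by auto
      then show ?thesis using True f_ball by simp
    next
      case False
      then show ?thesis using that f_sphere[of y] by auto
    qed
    show "w = z"
    proof (cases "cmod w < 1")
      case True
      then have "cmod z < 1" using b[of w] b[of z] wz by auto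
      then show ?thesis using True wz(3) inj_onD[OF f_inj_ball] by auto
    next
      case False
      then have "cmod w = 1" "cmod z = 1" using b[of w] b[of z] wz by auto
      then obtain s t where "s \<in> {-\<theta>..<2 * pi - \<theta>}" "w = cis s" "t \<in> {-\<theta>..<2 * pi - \<theta>}" "z = cis t"
        using circle_param by metis
      then show ?thesis using inj_onD[OF f_cis_inj, of s t] wz(3) by auto
    qed
  qed
qed

text \<open>The lower left corner is the image of -cis \<theta>, so the marked points start there
  and run counterclockwise.\<close>

lemma normal_quad_modulus: "is_modulus (- cis \<theta>, cis (- \<theta>), cis \<theta>, - cis (- \<theta>)) (A / B)"
proof -
  \<comment> \<open>Moves the lower left corner to 0 and scales the height 2B to 1, so that the
    width 2A becomes A/B.\<close>
  define \<phi> where "\<phi> w = (w + Complex A B) / of_real (2 * B)" for w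
  define \<psi> where "\<psi> w = of_real (2 * B) * w - Complex A B" for w
  have B: "B > 0" and A: "A > 0" using AB_pos by auto
  have inv: "\<phi> (\<psi> w) = w" "\<psi> (\<phi> w) = w" for w using B by (auto simp: \<phi>_def \<psi>_def)
  have parts: "Re (\<phi> w) = (Re w + A) / (2 * B)" "Im (\<phi> w) = (Im w + B) / (2 * B)" for w
    unfolding \<phi>_def by (simp_all only: Re_divide_of_real Im_divide_of_real plus_complex.sel complex.sel)
  have box: "\<phi> w \<in> box 0 (Complex (A / B) 1) \<longleftrightarrow> w \<in> bx"
    and cbox: "\<phi> w \<in> cbox 0 (Complex (A / B) 1) \<longleftrightarrow> w \<in> cbx" for w
  proof -
    have iff: "0 < (Re w + A) / (2 * B) \<longleftrightarrow> - A < Re w" "(Re w + A) / (2 * B) < A / B \<longleftrightarrow> Re w < A"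
      "0 < (Im w + B) / (2 * B) \<longleftrightarrow> - B < Im w" "(Im w + B) / (2 * B) < 1 \<longleftrightarrow> Im w < B"
      "0 \<le> (Re w + A) / (2 * B) \<longleftrightarrow> - A \<le> Re w" "(Re w + A) / (2 * B) \<le> A / B \<longleftrightarrow> Re w \<le> A"
      "0 \<le> (Im w + B) / (2 * B) \<longleftrightarrow> - B \<le> Im w" "(Im w + B) / (2 * B) \<le> 1 \<longleftrightarrow> Im w \<le> B" for w
      using B by (auto simp: field_simps)
    show "\<phi> w \<in> box 0 (Complex (A / B) 1) \<longleftrightarrow> w \<in> bx" "\<phi> w \<in> cbox 0 (Complex (A / B) 1) \<longleftrightarrow> w \<in> cbx" for w
      unfolding in_box_complex_iff in_cbox_complex_iff parts by (simp_all add: iff)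
  qed
  have h\<phi>: "homeomorphism cbx (cbox 0 (Complex (A / B) 1)) \<phi> \<psi>"
  proof (rule homeomorphismI)
    show "continuous_on cbx \<phi>" "continuous_on (cbox 0 (Complex (A / B) 1)) \<psi>"
      unfolding \<phi>_def \<psi>_def using B by (auto intro!: continuous_intros)
    show "\<phi> ` cbx \<subseteq> cbox 0 (Complex (A / B) 1)" using cbox by auto
    show "\<psi> ` cbox 0 (Complex (A / B) 1) \<subseteq> cbx" using cbox inv by (metis image_subsetI)
  qed (use inv in auto)
  obtain g where g: "homeomorphism (cball 0 1) cbx f g" using f_homeo by blast
  have "homeomorphism (cball 0 1) (cbox 0 (Complex (A / B) 1)) (\<phi> \<circ> f) (g \<circ> \<psi>)"
    by (rule homeomorphism_compose[OF g h\<phi>])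
  moreover have "(\<phi> \<circ> f) holomorphic_on ball 0 1"
    unfolding \<phi>_def o_def using B by (intro holomorphic_intros holo_f) auto
  moreover have "(\<phi> \<circ> f) ` ball 0 1 = box 0 (Complex (A / B) 1)"
  proof -
    have "\<phi> ` bx = box 0 (Complex (A / B) 1)"
    proof
      show "\<phi> ` bx \<subseteq> box 0 (Complex (A / B) 1)" using box by blast
      show "box 0 (Complex (A / B) 1) \<subseteq> \<phi> ` bx"
      proof
        fix w assume "w \<in> box 0 (Complex (A / B) 1)"
        then have "\<psi> w \<in> bx" using box[of "\<psi> w"] unfolding inv by simp
        then show "w \<in> \<phi> ` bx" using inv(1)[of w] by (metis imageI)
      qed
    qed
    then show ?thesis unfolding image_comp[symmetric] f_ball .
  qed
  moreover have "(\<phi> \<circ> f) (- cis \<theta>) = 0" "(\<phi> \<circ> f) (cis (- \<theta>)) = of_real (A / B)"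
    "(\<phi> \<circ> f) (cis \<theta>) = Complex (A / B) 1" "(\<phi> \<circ> f) (- cis (- \<theta>)) = \<i>"
  proof -
    have h: "(A + A) / (2 * B) = A / B" "(B + B) / (2 * B) = 1" using B by (simp_all add: field_simps)
    have v: "\<phi> (Complex x y) = Complex ((x + A) / (2 * B)) ((y + B) / (2 * B))" for x y
      by (rule complex_eqI) (simp_all only: parts complex.sel)
    show "(\<phi> \<circ> f) (- cis \<theta>) = 0" unfolding comp_def f_corners v by (simp add: zero_complex.code)
    show "(\<phi> \<circ> f) (cis (- \<theta>)) = of_real (A / B)" unfolding comp_def f_corners v h
      by (simp add: complex_of_real_def)
    show "(\<phi> \<circ> f) (cis \<theta>) = Complex (A / B) 1" unfolding comp_def f_corners v h ..
    show "(\<phi> \<circ> f) (- cis (- \<theta>)) = \<i>" unfolding comp_def f_corners v h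
      by (simp add: imaginary_unit.code)
  qed
  moreover have "0 < A / B" using A B by simp
  ultimately show ?thesis unfolding is_modulus_def prod.case
    by (intro conjI exI[of _ "\<phi> \<circ> f"] exI[of _ "g \<circ> \<psi>"])
qed

end

section \<open>The modulus as a function of the cross ratio\<close>

definition disk_aut :: "complex \<Rightarrow> complex \<Rightarrow> complex" where
  "disk_aut w z = (z - w) / (1 - cnj w * z)"

lemma disk_aut_denom: "cmod w < 1 \<Longrightarrow> cmod z \<le> 1 \<Longrightarrow> 1 - cnj w * z \<noteq> 0"
proof
  assume a: "cmod w < 1" "cmod z \<le> 1" "1 - cnj w * z = 0"
  then have "cnj w * z = 1" by simp
  then have "cmod w * cmod z = 1" by (metis complex_mod_cnj norm_mult norm_one)
  moreover have "cmod w * cmod z \<le> cmod w" using a by (simp add: mult_left_le)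
  ultimately show False using a by simp
qed

lemma disk_aut_norm:
  assumes "cmod w < 1" "cmod z \<le> 1"
  shows "1 - (cmod (disk_aut w z))^2 = (1 - (cmod w)^2) * (1 - (cmod z)^2) / (cmod (1 - cnj w * z))^2"
proof -
  have "of_real ((cmod (1 - cnj w * z))^2 - (cmod (z - w))^2)
      = (of_real ((1 - (cmod w)^2) * (1 - (cmod z)^2)) :: complex)"
    unfolding of_real_diff of_real_mult of_real_1 complex_norm_square by (simp add: algebra_simps)
  then have "(cmod (1 - cnj w * z))^2 - (cmod (z - w))^2 = (1 - (cmod w)^2) * (1 - (cmod z)^2)"
    using of_real_eq_iff by blast
  moreover have "cmod (1 - cnj w * z) \<noteq> 0" using disk_aut_denom[OF assms] by simp
  ultimately show ?thesis by (simp add: disk_aut_def norm_divide power_divide field_simps)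
qed

lemma disk_aut_ball: "cmod w < 1 \<Longrightarrow> cmod z \<le> 1 \<Longrightarrow> cmod (disk_aut w z) < 1 \<longleftrightarrow> cmod z < 1"
  and disk_aut_cball: "cmod w < 1 \<Longrightarrow> cmod z \<le> 1 \<Longrightarrow> cmod (disk_aut w z) \<le> 1"
proof -
  assume a: "cmod w < 1" "cmod z \<le> 1"
  define k where "k = (1 - (cmod w)^2) / (cmod (1 - cnj w * z))^2"
  have "(cmod w)^2 < 1" using a(1) by (simp add: power_less_one_iff)
  then have k: "k > 0" unfolding k_def using disk_aut_denom[OF a] by simp
  have e: "1 - (cmod (disk_aut w z))^2 = k * (1 - (cmod z)^2)"
    using disk_aut_norm[OF a] by (simp add: k_def)
  have "0 \<le> 1 - (cmod z)^2" using a(2) by (simp add: power_le_one)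
  then have "0 \<le> 1 - (cmod (disk_aut w z))^2" unfolding e using k by simp
  then show "cmod (disk_aut w z) \<le> 1" by (simp add: power2_le_imp_le abs_square_le_1)
  have "0 < 1 - (cmod (disk_aut w z))^2 \<longleftrightarrow> 0 < 1 - (cmod z)^2" unfolding e using k by (simp add: zero_less_mult_iff)
  then show "cmod (disk_aut w z) < 1 \<longleftrightarrow> cmod z < 1" by (simp add: abs_square_less_1)
qed

lemma disk_aut_inverse:
  assumes "cmod w < 1" "cmod z \<le> 1"
  shows "disk_aut (- w) (disk_aut w z) = z"
proof -
  have d: "1 - cnj w * z \<noteq> 0" using disk_aut_denom[OF assms] .
  have "cmod w ^ 2 < 1" using assms(1) by (simp add: power_less_one_iff)
  then have c: "1 - cnj w * w \<noteq> 0"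
    by (metis complex_norm_square eq_iff_diff_eq_0 less_irrefl mult.commute of_real_eq_1_iff)
  have e1: "(z - w) / (1 - cnj w * z) + w = z * (1 - cnj w * w) / (1 - cnj w * z)"
    using d by (simp add: field_simps)
  have e2: "1 + cnj w * ((z - w) / (1 - cnj w * z)) = (1 - cnj w * w) / (1 - cnj w * z)"
    using d by (simp add: field_simps)
  have "disk_aut (- w) (disk_aut w z) = ((z - w) / (1 - cnj w * z) + w) / (1 + cnj w * ((z - w) / (1 - cnj w * z)))"
    by (simp add: disk_aut_def)
  also have "\<dots> = z" unfolding e1 e2 using c d by simp
  finally show ?thesis .
qed

lemma disk_aut_holo: "cmod w < 1 \<Longrightarrow> disk_aut w holomorphic_on ball 0 1"
  and disk_aut_cont: "cmod w < 1 \<Longrightarrow> continuous_on (cball 0 1) (disk_aut w)"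
  unfolding disk_aut_def using disk_aut_denom[of w] 
  by (auto intro!: holomorphic_intros continuous_intros)

lemma is_modulus_rotated_disk_aut:
  assumes w: "cmod w < 1" and r: "cmod r = 1"
    and abcd: "cmod a = 1" "cmod b = 1" "cmod c = 1" "cmod d = 1"
    and M: "is_modulus (r * disk_aut w a, r * disk_aut w b, r * disk_aut w c, r * disk_aut w d) M"
  shows "is_modulus (a, b, c, d) M"
proof -
  define T where "T z = r * disk_aut w z" for z
  define S where "S z = disk_aut (- w) (z / r)" for z
  have r0: "r \<noteq> 0" using r by auto
  have w': "cmod (- w) < 1" using w by simp
  have T: "cmod (T z) \<le> 1" "cmod (T z) < 1 \<longleftrightarrow> cmod z < 1" "S (T z) = z" if "cmod z \<le> 1" for z
    using disk_aut_cball[OF w that] disk_aut_ball[OF w that] disk_aut_inverse[OF w that] r r0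
    by (auto simp: T_def S_def norm_mult)
  have S: "cmod (S z) \<le> 1" "T (S z) = z" if "cmod z \<le> 1" for z
  proof -
    have z: "cmod (z / r) \<le> 1" using that r by (simp add: norm_divide)
    show "cmod (S z) \<le> 1" "T (S z) = z"
      using disk_aut_cball[OF w' z] disk_aut_inverse[OF w' z] r0 by (auto simp: T_def S_def)
  qed
  have hT: "homeomorphism (cball 0 1) (cball 0 1) T S"
  proof (rule homeomorphismI)
    show "continuous_on (cball 0 1) T" unfolding T_def
      by (intro continuous_intros disk_aut_cont w)
    show "continuous_on (cball 0 1) S" unfolding S_def
      by (rule continuous_on_compose2[OF disk_aut_cont[OF w']])
        (use r r0 in \<open>auto intro!: continuous_intros simp: norm_divide\<close>)
  qed (use T S in auto)
  obtain f g where f: "0 < M" "f holomorphic_on ball 0 1" "f ` ball 0 1 = box 0 (Complex M 1)"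
    "homeomorphism (cball 0 1) (cbox 0 (Complex M 1)) f g"
    "f (T a) = 0" "f (T b) = of_real M" "f (T c) = Complex M 1" "f (T d) = \<i>"
    using M unfolding is_modulus_def T_def by auto
  have "T ` ball 0 1 = ball 0 1"
  proof
    show "T ` ball 0 1 \<subseteq> ball 0 1" using T by auto
    show "ball 0 1 \<subseteq> T ` ball 0 1"
    proof
      fix z assume "z \<in> ball (0::complex) 1"
      then have z: "cmod z < 1" by simp
      have "cmod (S z) < 1" using S[of z] T(2)[of "S z"] z by simp
      then show "z \<in> T ` ball 0 1" using S(2)[of z] z by (intro image_eqI[of _ _ "S z"]) auto
    qed
  qed
  then have "(f \<circ> T) ` ball 0 1 = box 0 (Complex M 1)" using f(3) by (metis image_comp)
  moreover have "(f \<circ> T) holomorphic_on ball 0 1"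
  proof (rule holomorphic_on_compose_gen[OF _ f(2)])
    show "T holomorphic_on ball 0 1"
      unfolding T_def by (intro holomorphic_intros disk_aut_holo w)
  qed (use T in auto)
  moreover have "homeomorphism (cball 0 1) (cbox 0 (Complex M 1)) (f \<circ> T) (S \<circ> g)"
    by (rule homeomorphism_compose[OF hT f(4)])
  moreover have "(f \<circ> T) a = 0" "(f \<circ> T) b = of_real M" "(f \<circ> T) c = Complex M 1" "(f \<circ> T) d = \<i>"
    using f by simp_all
  ultimately show ?thesis using f(1) unfolding is_modulus_def prod.case
    by (intro conjI exI[of _ "f \<circ> T"] exI[of _ "S \<circ> g"])
qed

section \<open>The common point of the diagonals and the cross ratio\<close>

lemma cis_diff_eq: "cis u - cis v = 2 * \<i> * of_real (sin ((u - v) / 2)) * cis ((u + v) / 2)"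
proof -
  have "u = (u + v) / 2 + (u - v) / 2" "v = (u + v) / 2 - (u - v) / 2" by (simp_all add: field_simps)
  then have "cis u - cis v = cis ((u + v) / 2 + (u - v) / 2) - cis ((u + v) / 2 - (u - v) / 2)" by metis
  also have "\<dots> = 2 * \<i> * of_real (sin ((u - v) / 2)) * cis ((u + v) / 2)"
    by (simp add: complex_eq_iff cos_add cos_diff sin_add sin_diff)
  finally show ?thesis .
qed

lemma cmod_cis_diff: "cmod (cis u - cis v) = 2 * \<bar>sin ((u - v) / 2)\<bar>"
  unfolding cis_diff_eq by (simp add: norm_mult)

text \<open>The point \<open>w\<close> is where the hyperbolic geodesics from \<open>a\<close> to \<open>c\<close> and from \<open>b\<close> to \<open>d\<close> meet. It is
  obtained from the intersection \<open>k\<close> of the chords with the same end points by \<open>k = 2 w / (1 + |w|\<^sup>2)\<close>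
  (Klein and Poincare model).\<close>

lemma geodesics_meet:
  assumes "t1 < t2" "t2 < t3" "t3 < t4" "t4 < t1 + 2 * pi"
  defines "a \<equiv> cis t1" and "b \<equiv> cis t2" and "c \<equiv> cis t3" and "d \<equiv> cis t4"
  obtains w where "cmod w < 1" "disk_aut w c = - disk_aut w a" "disk_aut w d = - disk_aut w b"
proof -
  \<comment> \<open>Vanishes on the line through b and d. Its opposite signs at a and c put these on
    different sides of that line.\<close>
  define \<psi> where "\<psi> z = Im ((z - b) * cnj (d - b))" for z
  have prod: "\<psi> (cis t) = 4 * sin ((t - t2) / 2) * sin ((t4 - t2) / 2) * sin ((t - t4) / 2)" for t
  proof -
    have h: "(t + t2) / 2 = (t - t4) / 2 + (t2 + t4) / 2" by (simp add: field_simps)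
    have "(cis t - b) * cnj (d - b) 
      = 4 * of_real (sin ((t - t2) / 2) * sin ((t4 - t2) / 2)) * (cis ((t + t2) / 2) * cis (- ((t2 + t4) / 2)))"
      unfolding b_def d_def cis_diff_eq by (simp add: cis_cnj algebra_simps)
    also have "cis ((t + t2) / 2) * cis (- ((t2 + t4) / 2)) = cis ((t - t4) / 2)"
      unfolding h by (simp only: cis_mult) simp
    finally show ?thesis unfolding \<psi>_def by simp
  qed
  have s: "sin ((t2 - t1) / 2) > 0" "sin ((t4 - t2) / 2) > 0" "sin ((t4 - t1) / 2) > 0"
      "sin ((t3 - t2) / 2) > 0" "sin ((t4 - t3) / 2) > 0"
    using assms by (auto intro!: sin_gt_zero)
  have neg: "sin ((x - y) / 2) = - sin ((y - x) / 2)" for x y :: real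
    by (metis minus_diff_eq minus_divide_left sin_minus)
  have pa: "\<psi> a > 0" unfolding a_def prod neg[of t1 t2] neg[of t1 t4] using s by simp
  have pc: "\<psi> c < 0" unfolding c_def prod neg[of t3 t4] using s by (simp add: mult_pos_pos)
  define k where "k s = a + of_real s * (c - a)" for s :: real
  have "continuous_on {0..1} (\<lambda>s. \<psi> (k s))" unfolding \<psi>_def k_def by (intro continuous_intros)
  then obtain s0 where s0: "0 \<le> s0" "s0 \<le> 1" "\<psi> (k s0) = 0"
    using IVT2'[of "\<lambda>s. \<psi> (k s)" 1 0 0] pa pc by (auto simp: k_def)
  define K where "K = k s0"
  have s01: "0 < s0" "s0 < 1" using s0 pa pc by (auto simp: k_def order_less_le)
  have ab: "cmod a = 1" "cmod b = 1" "cmod c = 1" "cmod d = 1" by (auto simp: a_def b_def c_def d_def)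
  have u: "cnj a * a = 1" "cnj b * b = 1" "cnj c * c = 1" "cnj d * d = 1"
    by (simp_all add: a_def b_def c_def d_def cis_cnj cis_mult)
  \<comment> \<open>For unimodular a and c the line through them has the equation z + a c cnj z = a
    + c.\<close>
  have line1: "K + cnj K * (a * c) = a + c"
  proof -
    have "K + cnj K * (a * c) = a + of_real s0 * (c - a) + (cnj a + of_real s0 * (cnj c - cnj a)) * (a * c)"
      by (simp add: K_def k_def)
    also have "\<dots> = a + of_real s0 * (c - a) + (cnj a * a) * c + of_real s0 * ((cnj c * c) * a - (cnj a * a) * c)"
      by (simp add: algebra_simps)
    finally show ?thesis unfolding u by (simp add: algebra_simps)
  qed
  have bd: "d - b \<noteq> 0" using pa by (auto simp: \<psi>_def)
  define r where "r = (K - b) / (d - b)"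
  have "Im r = 0"
  proof -
    have "r = (K - b) * cnj (d - b) / of_real ((cmod (d - b))^2)"
      unfolding r_def complex_norm_square using bd by simp
    then show ?thesis using s0(3) unfolding K_def \<psi>_def by (simp only: Im_divide_of_real div_0)
  qed
  then have rr: "cnj r = r" by (simp add: complex_eq_iff)
  have Kr: "K = b + r * (d - b)" unfolding r_def using bd by simp
  have line2: "K + cnj K * (b * d) = b + d"
  proof -
    have "K + cnj K * (b * d) = b + r * (d - b) + (cnj b + r * (cnj d - cnj b)) * (b * d)"
      unfolding Kr using rr by simp
    also have "\<dots> = b + r * (d - b) + (cnj b * b) * d + r * ((cnj d * d) * b - (cnj b * b) * d)"
      by (simp add: algebra_simps)
    finally show ?thesis unfolding u by (simp add: algebra_simps)
  qed
  have "cmod K < 1"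
  proof -
    have "a \<noteq> c" using pa pc by auto
    then have "K \<in> open_segment a c"
      unfolding in_segment K_def k_def using s01
      by (intro conjI exI[of _ s0]) (auto simp: scaleR_conv_of_real algebra_simps)
    then show ?thesis using dist_decreases_open_segment[of K a c 0] ab by (auto simp: dist_norm)
  qed
  define m where "m = sqrt (1 - (cmod K)^2)"
  have K1: "(cmod K)^2 < 1" using \<open>cmod K < 1\<close> by (simp add: power_less_one_iff)
  have m: "0 < m" "m \<le> 1" "m^2 = 1 - (cmod K)^2" using K1 by (auto simp: m_def)
  \<comment> \<open>Solves 2 w = K (1 + |w|^2): since |K|^2 = (1 - m)(1 + m), this w has 1 + |w|^2 =
    2 / (1 + m).\<close>
  define w where "w = K / of_real (1 + m)"
  have w1: "cmod w < 1"
  proof -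
    have "cmod w = cmod K / (1 + m)" unfolding w_def norm_divide norm_of_real using m by simp
    then show ?thesis using \<open>cmod K < 1\<close> m by (simp add: divide_less_eq)
  qed
  have ww: "1 + w * cnj w = of_real (2 / (1 + m))"
  proof -
    have "w * cnj w = of_real ((cmod K)^2 / (1 + m)^2)"
      unfolding w_def of_real_divide complex_norm_square by (simp add: power2_eq_square)
    also have "(cmod K)^2 = (1 - m) * (1 + m)" using m(3) by (simp add: power2_eq_square algebra_simps)
    also have "(1 - m) * (1 + m) / (1 + m)^2 = (1 - m) / (1 + m)" using m by (simp add: power2_eq_square)
    finally have "1 + w * cnj w = of_real (1 + (1 - m) / (1 + m))" by simp
    also have "1 + (1 - m) / (1 + m) = 2 / (1 + m)" using m by (simp add: field_simps)
    finally show ?thesis .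
  qed
  \<comment> \<open>The sum of both images has the numerator (x + y)(1 + |w|^2) - 2 (w + x y cnj w),
    which is 2 / (1 + m) times x + y - (K + x y cnj K).\<close>
  have anti: "disk_aut w y = - disk_aut w x"
    if x: "cmod x = 1" and y: "cmod y = 1" and l: "K + cnj K * (x * y) = x + y" for x y
  proof -
    have d: "1 - cnj w * x \<noteq> 0" "1 - cnj w * y \<noteq> 0" using disk_aut_denom[OF w1] x y by auto
    have wK: "w = K * (of_real (1 / (1 + m)))" by (simp add: w_def)
    have "(y - w) * (1 - cnj w * x) + (x - w) * (1 - cnj w * y)
        = (x + y) * (1 + w * cnj w) - 2 * (w + cnj w * (x * y))"
      by (simp add: algebra_simps)
    also have "\<dots> = (K + cnj K * (x * y)) * (2 * of_real (1 / (1 + m))) - 2 * of_real (1 / (1 + m)) * (K + cnj K * (x * y))"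
    proof -
      have cw: "cnj w = cnj K * of_real (1 / (1 + m))" by (simp add: w_def)
      have "of_real (2 / (1 + m)) = 2 * (of_real (1 / (1 + m)) :: complex)" by simp
      then show ?thesis unfolding ww l[symmetric] unfolding cw by (subst (1) wK) (simp add: algebra_simps add_divide_distrib)
    qed
    also have "\<dots> = 0" by simp
    finally have e: "(y - w) * (1 - cnj w * x) = - ((x - w) * (1 - cnj w * y))"
      by (simp add: eq_neg_iff_add_eq_0)
    have "(y - w) / (1 - cnj w * y) = ((y - w) * (1 - cnj w * x)) / ((1 - cnj w * y) * (1 - cnj w * x))"
      using d by simp
    also have "\<dots> = - ((x - w) / (1 - cnj w * x))" unfolding e using d by simp
    finally show ?thesis by (simp add: disk_aut_def)
  qed
  show thesis
    by (rule that[OF w1 anti[OF ab(1,3) line1] anti[OF ab(2,4) line2]])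
qed

definition cr :: "quad \<Rightarrow> real" where
  "cr Q = Re (cross_ratio Q)"

text \<open>In numerator and denominator the half sums of the angles add up to the same total, so
  the unimodular factors of the chords cancel and only sines of half gaps remain.\<close>

lemma cross_ratio_cis:
  assumes "t1 < t2" "t2 < t3" "t3 < t4" "t4 < t1 + 2 * pi"
  shows "cross_ratio (cis t1, cis t2, cis t3, cis t4) =
    of_real (sin ((t2 - t1) / 2) * sin ((t4 - t3) / 2) / (sin ((t3 - t2) / 2) * sin ((t4 - t1) / 2)))"
proof -
  have s: "sin ((t3 - t2) / 2) > 0" "sin ((t4 - t1) / 2) > 0"
    using assms by (auto intro!: sin_gt_zero)
  have e: "cis ((t2 + t1) / 2) * cis ((t4 + t3) / 2) = cis ((t3 + t2) / 2) * cis ((t4 + t1) / 2)"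
    by (simp add: cis_mult add_divide_distrib algebra_simps)
  have "cross_ratio (cis t1, cis t2, cis t3, cis t4) =
     (-4 * of_real (sin ((t2 - t1) / 2) * sin ((t4 - t3) / 2)) * (cis ((t2 + t1) / 2) * cis ((t4 + t3) / 2))) /
     (-4 * of_real (sin ((t3 - t2) / 2) * sin ((t4 - t1) / 2)) * (cis ((t3 + t2) / 2) * cis ((t4 + t1) / 2)))"
    unfolding cross_ratio_def prod.case cis_diff_eq by (simp add: mult_ac)
  also have "\<dots> = of_real (sin ((t2 - t1) / 2) * sin ((t4 - t3) / 2)) / of_real (sin ((t3 - t2) / 2) * sin ((t4 - t1) / 2))"
    unfolding e using s by (simp add: divide_simps)
  finally show ?thesis by simp
qed

lemma cr_cis:
  assumes "t1 < t2" "t2 < t3" "t3 < t4" "t4 < t1 + 2 * pi"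
  shows "cr (cis t1, cis t2, cis t3, cis t4) =
    sin ((t2 - t1) / 2) * sin ((t4 - t3) / 2) / (sin ((t3 - t2) / 2) * sin ((t4 - t1) / 2))"
  unfolding cr_def cross_ratio_cis[OF assms] by simp

lemma cross_ratio_real: "is_quadruple Q \<Longrightarrow> cross_ratio Q = of_real (cr Q)"
  unfolding is_quadruple_def cr_def using cross_ratio_cis by (auto split: prod.splits)

lemma disk_aut_diff:
  assumes "cmod w < 1" "cmod x \<le> 1" "cmod y \<le> 1"
  shows "disk_aut w x - disk_aut w y = (x - y) * (1 - w * cnj w) / ((1 - cnj w * x) * (1 - cnj w * y))"
  using disk_aut_denom[OF assms(1,2)] disk_aut_denom[OF assms(1,3)]
  unfolding disk_aut_def by (simp add: diff_frac_eq algebra_simps)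

text \<open>For x = cot^2 \<theta>, the cross ratio of the symmetric quadruple, this is ellip (sin
  \<theta>) / ellip (cos \<theta>), the quotient of the sides of the rectangle. In classical
  notation it is K(k) / K(k') with k^2 = x / (1 + x) and k'^2 = 1 / (1 + x).\<close>

definition mu :: "real \<Rightarrow> real" where
  "mu x = ellip (1 / sqrt (1 + x)) / ellip (sqrt (x / (1 + x)))"

text \<open>After the automorphism the quadruple reads a', b', -a', -b', and a rotation takes it to
  the marked points of \<open>normal_quad_modulus\<close> once b' is known to follow a'
  counterclockwise by an angle below pi. The cross ratio, invariant under both maps, then identifies
  \<theta>.\<close>

lemma is_modulus_mu:
  assumes "is_quadruple Q" shows "is_modulus Q (mu (cr Q))"
proof -
  obtain t1 t2 t3 t4 where t: "t1 < t2" "t2 < t3" "t3 < t4" "t4 < t1 + 2 * pi"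
    "Q = (cis t1, cis t2, cis t3, cis t4)"
    using assms unfolding is_quadruple_def by (auto split: prod.splits)
  define a b c d where "a = cis t1" and "b = cis t2" and "c = cis t3" and "d = cis t4"
  have Q: "Q = (a, b, c, d)" using t(5) by (simp add: a_def b_def c_def d_def)
  have ab: "cmod a = 1" "cmod b = 1" "cmod c = 1" "cmod d = 1" by (auto simp: a_def b_def c_def d_def)
  obtain w where w: "cmod w < 1" "disk_aut w c = - disk_aut w a" "disk_aut w d = - disk_aut w b"
    using geodesics_meet[OF t(1-4)] unfolding a_def b_def c_def d_def by blast
  define a' b' where "a' = disk_aut w a" and "b' = disk_aut w b"
  have unit: "cmod (disk_aut w x) = 1" if "cmod x = 1" for x
    using disk_aut_cball[OF w(1), of x] disk_aut_ball[OF w(1), of x] that by simp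
  have a'b': "cmod a' = 1" "cmod b' = 1" unfolding a'_def b'_def using unit ab by auto
  define D where "D x = 1 - cnj w * x" for x
  have Dne: "D x \<noteq> 0" if "cmod x = 1" for x using disk_aut_denom[OF w(1)] that by (simp add: D_def)
  have da: "disk_aut w x = x * cnj (D x) / D x" if "cmod x = 1" for x
  proof -
    have "x * cnj x = 1" using that by (simp add: complex_norm_square[symmetric])
    then have "x * cnj (D x) = x - w" by (simp add: D_def algebra_simps)
    then show ?thesis by (simp add: disk_aut_def D_def)
  qed
  define K where "K = 1 - (cmod w)^2"
  have K: "K > 0" using w(1) by (simp add: K_def power_less_one_iff)
  have K': "1 - w * cnj w = of_real K" unfolding K_def of_real_diff of_real_1 complex_norm_square ..
  have dd: "disk_aut w x - disk_aut w y = (x - y) * of_real K / (D x * D y)" if "cmod x = 1" "cmod y = 1" for x y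
    using disk_aut_diff[OF w(1), of x y] that by (simp add: K' D_def)
  \<comment> \<open>For points on the circle this is i times a real number whose sign tells their
    cyclic order; \<open>o1\<close> shows that the automorphism multiplies it by a positive
    factor.\<close>
  define orient where "orient x y z = (y - x) * (z - y) * (x - z) / (x * y * z)" for x y z :: complex
  define \<beta> where "\<beta> = b' * cnj a'"
  have o1: "orient (disk_aut w a) (disk_aut w b) (disk_aut w c)
      = orient a b c * of_real (K^3 / ((cmod (D a))^2 * (cmod (D b))^2 * (cmod (D c))^2))"
  proof -
    have ne: "a \<noteq> 0" "b \<noteq> 0" "c \<noteq> 0" "D a \<noteq> 0" "D b \<noteq> 0" "D c \<noteq> 0" using ab Dne by auto
    have "disk_aut w a * disk_aut w b * disk_aut w c 
      = a * b * c * (cnj (D a) * cnj (D b) * cnj (D c)) / (D a * D b * D c)"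
      using ab by (simp add: da)
    moreover have "(disk_aut w b - disk_aut w a) * (disk_aut w c - disk_aut w b) * (disk_aut w a - disk_aut w c)
      = (b - a) * (c - b) * (a - c) * of_real (K^3) / (D a * D b * D c)^2"
      using ab ne by (simp add: dd power2_eq_square power3_eq_cube mult_ac)
    ultimately have "orient (disk_aut w a) (disk_aut w b) (disk_aut w c)
      = ((b - a) * (c - b) * (a - c) * of_real (K^3) / (D a * D b * D c)^2) / 
        (a * b * c * (cnj (D a) * cnj (D b) * cnj (D c)) / (D a * D b * D c))"
      unfolding orient_def by (simp only:)
    also have "\<dots> = orient a b c * of_real (K^3) / ((D a * cnj (D a)) * (D b * cnj (D b)) * (D c * cnj (D c)))"
      unfolding orient_def using ne by (simp add: power2_eq_square field_simps)
    finally show ?thesis unfolding complex_norm_square[symmetric] by simp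
  qed
  have o2: "orient a b c = \<i> * of_real (8 * sin ((t2 - t1) / 2) * sin ((t3 - t2) / 2) * sin ((t3 - t1) / 2))"
  proof -
    have e: "cis ((t2 + t1) / 2) * cis ((t3 + t2) / 2) * cis ((t1 + t3) / 2) = a * b * c"
    proof -
      have "(t2 + t1) / 2 + (t3 + t2) / 2 + (t1 + t3) / 2 = t1 + t2 + t3" by (simp add: field_simps)
      then show ?thesis unfolding a_def b_def c_def cis_mult by simp
    qed
    have neg: "sin ((t1 - t3) / 2) = - sin ((t3 - t1) / 2)" by (metis minus_diff_eq minus_divide_left sin_minus)
    have "(b - a) * (c - b) * (a - c) = (\<i> * of_real (8 * sin ((t2 - t1) / 2) * sin ((t3 - t2) / 2) * sin ((t3 - t1) / 2)))
      * (cis ((t2 + t1) / 2) * cis ((t3 + t2) / 2) * cis ((t1 + t3) / 2))"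
      unfolding a_def b_def c_def cis_diff_eq neg by (simp add: mult_ac)
    then show ?thesis unfolding orient_def e using ab by auto
  qed
  have o3: "orient (disk_aut w a) (disk_aut w b) (disk_aut w c) = \<i> * of_real (4 * Im \<beta>)"
  proof -
    have u: "a' * cnj a' = 1" "b' * cnj b' = 1" using a'b' by (simp_all add: complex_norm_square[symmetric])
    have ne: "a' \<noteq> 0" "b' \<noteq> 0" using a'b' by auto
    have "orient a' b' (- a') = 2 * (b' / a' - a' / b')"
      unfolding orient_def using ne by (simp add: field_simps)
    also have "b' / a' = \<beta>" unfolding \<beta>_def using u ne by (simp add: field_simps)
    also have "a' / b' = cnj \<beta>" unfolding \<beta>_def using u ne by (simp add: field_simps)
    also have "2 * (\<beta> - cnj \<beta>) = \<i> * of_real (4 * Im \<beta>)" by (simp add: complex_eq_iff)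
    finally show ?thesis using w(2) by (simp add: a'_def b'_def)
  qed
  define P where "P = 8 * sin ((t2 - t1) / 2) * sin ((t3 - t2) / 2) * sin ((t3 - t1) / 2)"
  define R where "R = K^3 / ((cmod (D a))^2 * (cmod (D b))^2 * (cmod (D c))^2)"
  have "\<i> * of_real (4 * Im \<beta>) = \<i> * of_real (P * R)"
    using o1 unfolding o3 o2 P_def[symmetric] R_def[symmetric] by (simp only: of_real_mult mult.assoc)
  then have "4 * Im \<beta> = P * R" by (metis complex_i_not_zero mult_left_cancel of_real_eq_iff)
  also have "\<dots> > 0" unfolding P_def R_def
    using t K Dne ab by (intro mult_pos_pos divide_pos_pos sin_gt_zero) auto
  finally have Im\<beta>: "Im \<beta> > 0" by simp
  have cm\<beta>: "cmod \<beta> = 1" using a'b' by (simp add: \<beta>_def norm_mult)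
  define \<psi> where "\<psi> = Arg \<beta>"
  have \<beta>0: "\<beta> \<noteq> 0" using cm\<beta> by auto
  have \<psi>: "0 < \<psi>" "\<psi> < pi" unfolding \<psi>_def using Arg_lt_pi[of \<beta>] Im\<beta> by auto
  have \<beta>\<psi>: "\<beta> = cis \<psi>" unfolding \<psi>_def using \<beta>0 cm\<beta> by (simp add: cis_Arg sgn_eq)
  \<comment> \<open>The target points -cis \<theta> and cis (-\<theta>) have angles pi + \<theta>
    and 2 pi - \<theta>, which differ by pi - 2 \<theta>; this must be \<psi>.\<close>
  define \<theta> where "\<theta> = (pi - \<psi>) / 2"
  interpret schwarz_christoffel \<theta> by unfold_locales (use \<psi> in \<open>auto simp: \<theta>_def\<close>)
  define r where "r = - cis \<theta> * cnj a'"
  have ua: "cnj a' * a' = 1" using a'b' by (simp add: complex_norm_square[symmetric] mult.commute)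
  have r1: "cmod r = 1" using a'b' by (simp add: r_def norm_mult)
  have ra: "r * a' = - cis \<theta>" using ua by (simp add: r_def mult.assoc)
  have rb: "r * b' = cis (- \<theta>)"
  proof -
    have "r * b' = - (cis \<theta> * cis \<psi>)" using \<beta>\<psi> by (simp add: r_def \<beta>_def mult_ac)
    also have "\<dots> = - cis (pi - \<theta>)" unfolding cis_mult by (simp add: \<theta>_def field_simps)
    also have "\<dots> = cis (- \<theta>)" by (simp add: complex_eq_iff cos_diff sin_diff)
    finally show ?thesis .
  qed
  have quad: "(r * disk_aut w a, r * disk_aut w b, r * disk_aut w c, r * disk_aut w d)
      = (- cis \<theta>, cis (- \<theta>), cis \<theta>, - cis (- \<theta>))"
    using ra rb w by (simp add: a'_def b'_def)
  have M: "is_modulus Q (A / B)" unfolding Q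
    by (rule is_modulus_rotated_disk_aut[OF w(1) r1 ab]) (unfold quad, rule normal_quad_modulus)
  have s: "sin \<theta> > 0" "cos \<theta> > 0" by (rule sin_cos_pos)+
  have "cr Q = (cos \<theta> / sin \<theta>)^2"
  proof -
    have ne: "D a \<noteq> 0" "D b \<noteq> 0" "D c \<noteq> 0" "D d \<noteq> 0" "r \<noteq> 0" using ab Dne r1 by auto
    have rd: "r * disk_aut w x - r * disk_aut w y = r * ((x - y) * of_real K / (D x * D y))" if "cmod x = 1" "cmod y = 1" for x y
      using dd[OF that] by (simp add: right_diff_distrib[symmetric])
    have "cross_ratio (r * disk_aut w a, r * disk_aut w b, r * disk_aut w c, r * disk_aut w d) = cross_ratio (a, b, c, d)"
    proof -
      define k where "k = r^2 * of_real K^2 / (D a * D b * D c * D d)"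
      have k: "k \<noteq> 0" using ne K by (simp add: k_def)
      have "cross_ratio (r * disk_aut w a, r * disk_aut w b, r * disk_aut w c, r * disk_aut w d)
        = (k * ((b - a) * (d - c))) / (k * ((c - b) * (d - a)))"
        unfolding cross_ratio_def prod.case by (simp add: rd ab k_def power2_eq_square mult_ac)
      also have "\<dots> = cross_ratio (a, b, c, d)" unfolding cross_ratio_def prod.case using k by simp
      finally show ?thesis .
    qed
    then have "cross_ratio Q = cross_ratio (- cis \<theta>, cis (- \<theta>), cis \<theta>, - cis (- \<theta>))"
      unfolding quad Q by simp
    also have "\<dots> = of_real ((cos \<theta> / sin \<theta>)^2)"
    proof -
      have 1: "cis (- \<theta>) - - cis \<theta> = of_real (2 * cos \<theta>)" "- cis (- \<theta>) - cis \<theta> = - of_real (2 * cos \<theta>)"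
        "cis \<theta> - cis (- \<theta>) = \<i> * of_real (2 * sin \<theta>)" "- cis (- \<theta>) - - cis \<theta> = \<i> * of_real (2 * sin \<theta>)"
        by (simp_all add: complex_eq_iff)
      have "(of_real (2 * cos \<theta>) * - of_real (2 * cos \<theta>)) / (\<i> * of_real (2 * sin \<theta>) * (\<i> * of_real (2 * sin \<theta>)))
         = (of_real (cos \<theta>) / of_real (sin \<theta>) :: complex)^2" using s
        by (simp add: power2_eq_square field_simps)
      then show ?thesis unfolding cross_ratio_def prod.case 1 by simp
    qed
    finally show ?thesis unfolding cr_def by simp
  qed
  then have e: "1 + cr Q = 1 / (sin \<theta>)^2" "cr Q / (1 + cr Q) = (cos \<theta>)^2"
  proof -
    assume c: "cr Q = (cos \<theta> / sin \<theta>)^2"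
    have "1 + cr Q = ((sin \<theta>)^2 + (cos \<theta>)^2) / (sin \<theta>)^2"
      unfolding c using s by (simp add: power_divide add_divide_distrib del: sin_cos_squared_add)
    then show 1: "1 + cr Q = 1 / (sin \<theta>)^2" by (simp only: sin_cos_squared_add)
    show "cr Q / (1 + cr Q) = (cos \<theta>)^2" unfolding 1 unfolding c using s by (simp add: power_divide)
  qed
  have "1 / sqrt (1 / (sin \<theta>)^2) = sin \<theta>" "sqrt ((cos \<theta>)^2) = cos \<theta>"
    using s by (simp_all add: real_sqrt_divide)
  then have "mu (cr Q) = A / B" unfolding mu_def e(2) unfolding e(1) by simp
  then show ?thesis using M by simp
qed

theorem quad_modulus_eq: "is_quadruple Q \<Longrightarrow> quad_modulus Q = mu (cr Q)"
  unfolding quad_modulus_eq_THE using is_modulus_mu is_modulus_unique by blast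

section \<open>Asymptotics of the modulus\<close>

lemma ellip_strict_decreasing:
  assumes "0 < s" "s < s'" shows "ellip s' < ellip s"
  unfolding ellip_def
proof (rule integral_less_real)
  show "continuous_on {0..1} (\<lambda>x. 1 / sqrt ((1 - x\<^sup>2)\<^sup>2 + 4 * x\<^sup>2 * s'\<^sup>2))"
    "continuous_on {0..1} (\<lambda>x. 1 / sqrt ((1 - x\<^sup>2)\<^sup>2 + 4 * x\<^sup>2 * s\<^sup>2))"
    by (rule continuous_on_subset[OF ellip_integrand_cont]; use assms in simp)+
  fix x :: real assume x: "x \<in> {0<..<1}"
  have "s^2 < s'^2" using assms by (simp add: power_strict_mono)
  then have "(1 - x\<^sup>2)\<^sup>2 + 4 * x\<^sup>2 * s\<^sup>2 < (1 - x\<^sup>2)\<^sup>2 + 4 * x\<^sup>2 * s'\<^sup>2" using x by simp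
  then show "1 / sqrt ((1 - x\<^sup>2)\<^sup>2 + 4 * x\<^sup>2 * s'\<^sup>2) < 1 / sqrt ((1 - x\<^sup>2)\<^sup>2 + 4 * x\<^sup>2 * s\<^sup>2)"
    using ellip_integrand_pos[of s x] assms by (intro divide_strict_left_mono mult_pos_pos real_sqrt_less_mono) auto
qed auto

lemma ellip_cont: "continuous_on {0<..} ellip"
proof -
  have "continuous_on {0<..} (\<lambda>s. integral (cbox 0 1) ((\<lambda>s x. 1 / sqrt ((1 - x\<^sup>2)\<^sup>2 + 4 * x\<^sup>2 * s\<^sup>2)) s))"
  proof (rule integral_continuous_on_param)
    show "continuous_on ({0<..} \<times> cbox 0 1) (\<lambda>(s::real, x::real). 1 / sqrt ((1 - x\<^sup>2)\<^sup>2 + 4 * x\<^sup>2 * s\<^sup>2))"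
      unfolding case_prod_beta
    proof (intro continuous_intros ballI)
      fix z :: "real \<times> real" assume "z \<in> {0<..} \<times> cbox 0 1"
      then have "(1 - (snd z)\<^sup>2)\<^sup>2 + 4 * (snd z)\<^sup>2 * (fst z)\<^sup>2 > 0"
        by (intro ellip_integrand_pos) auto
      then show "sqrt ((1 - (snd z)\<^sup>2)\<^sup>2 + 4 * (snd z)\<^sup>2 * (fst z)\<^sup>2) \<noteq> 0" by simp
    qed
  qed
  then show ?thesis by (simp add: ellip_def[abs_def])
qed

text \<open>Near x = 1 the integrand behaves like 1 / (2 sqrt ((1 - x)^2 + s^2)); replacing the root
  by (1 - x) + s gives a lower bound with the elementary integral (ln (1 + s) - ln s) / 2.\<close>

lemma ellip_lower:
  assumes "0 < s" "s \<le> 1" shows "ln (1 / s) / 2 \<le> ellip s"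
proof -
  have i: "((\<lambda>x. 1 / (2 * (1 - x + s))) has_integral ((- ln (1 - 1 + s) / 2) - (- ln (1 - 0 + s) / 2))) {0..1}"
  proof (rule fundamental_theorem_of_calculus)
    fix x :: real assume x: "x \<in> {0..1}"
    then have "1 - x + s > 0" using assms by simp
    then show "((\<lambda>x. - ln (1 - x + s) / 2) has_vector_derivative 1 / (2 * (1 - x + s))) (at x within {0..1})"
      unfolding has_real_derivative_iff_has_vector_derivative[symmetric]
      by (auto intro!: derivative_eq_intros simp: field_simps)
  qed simp
  have "- ln s / 2 - (- ln (1 + s) / 2) \<le> ellip s"
  proof (rule has_integral_le[OF _ ellip_has_integral])
    show "((\<lambda>x. 1 / (2 * (1 - x + s))) has_integral (- ln s / 2 - (- ln (1 + s) / 2))) {0..1}"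
      using i by simp
    show "s \<noteq> 0" using assms by simp
    fix x :: real assume x: "x \<in> {0..1}"
    have "(1 - x^2)^2 + 4 * x^2 * s^2 \<le> (2 * (1 - x + s))^2"
    proof -
      have "1 - x^2 = (1 - x) * (1 + x)" by (simp add: power2_eq_square algebra_simps)
      also have "\<dots> \<le> (1 - x) * 2" using x by (intro mult_left_mono) auto
      finally have "(1 - x^2)^2 \<le> (2 * (1 - x))^2" using x by (intro power_mono) (auto simp: power_le_one)
      moreover have "(x * s)^2 \<le> s^2" using x assms by (simp add: power_mult_distrib mult_left_le_one_le power_le_one)
      ultimately have "(1 - x^2)^2 + 4 * x^2 * s^2 \<le> (2 * (1 - x))^2 + 4 * s^2"
        by (simp add: power_mult_distrib)
      also have "\<dots> \<le> (2 * (1 - x + s))^2" using x assms by (simp add: power2_eq_square algebra_simps)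
      finally show ?thesis .
    qed
    then have "sqrt ((1 - x^2)^2 + 4 * x^2 * s^2) \<le> 2 * (1 - x + s)"
      using x assms by (intro real_le_lsqrt) auto
    then show "1 / (2 * (1 - x + s)) \<le> 1 / sqrt ((1 - x^2)^2 + 4 * x^2 * s^2)"
      using ellip_integrand_pos[of s x] assms x by (intro divide_left_mono mult_pos_pos) auto
  qed
  moreover have "ln (1 / s) = - ln s" using assms by (simp add: ln_div)
  moreover have "ln (1 + s) \<ge> 0" using assms by simp
  ultimately show ?thesis by simp
qed

text \<open>Split at 1 - s. Before it the integrand is at most 1 / (1 - x^2), with integral (ln (2 -
  s) - ln s) / 2; on the last interval, of length s, it is at most 1 / s, because 4 x^2 \<ge> 1
  there.\<close>

lemma ellip_upper:
  assumes "0 < s" "s \<le> 1/2" shows "ellip s \<le> ln (1 / s) / 2 + 2"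
proof -
  define k where "k x = 1 / sqrt ((1 - x^2)^2 + 4 * x^2 * s^2)" for x :: real
  have kc: "continuous_on S k" for S
    unfolding k_def using ellip_integrand_cont[of s] assms continuous_on_subset[of UNIV _ S] by auto
  have ki: "(k has_integral integral {a..b} k) {a..b}" for a b
    using kc by (intro integrable_integral integrable_continuous_real)
  have split: "ellip s = integral {0..1-s} k + integral {1-s..1} k"
    unfolding ellip_def k_def[symmetric] using assms kc
    by (intro Henstock_Kurzweil_Integration.integral_combine[symmetric] integrable_continuous_real) auto
  have b1: "integral {0..1-s} k \<le> ((ln (1 + (1 - s)) - ln (1 - (1 - s))) / 2) - ((ln (1 + 0) - ln (1 - 0)) / 2)"
  proof (rule has_integral_le[OF ki])
    show "((\<lambda>x. 1 / (1 - x^2)) has_integral ((ln (1 + (1 - s)) - ln (1 - (1 - s))) / 2) - ((ln (1 + 0) - ln (1 - 0)) / 2)) {0..1-s}"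
    proof (rule fundamental_theorem_of_calculus)
      show "0 \<le> 1 - s" using assms by simp
      fix x :: real assume x: "x \<in> {0..1-s}"
      then have "1 - x > 0" "1 + x > 0" using assms by auto
      moreover have "1 - x^2 = (1 - x) * (1 + x)" by (simp add: power2_eq_square algebra_simps)
      ultimately have e: "1 / (1 - x^2) = (1 / (1 + x) + 1 / (1 - x)) / 2"
        by (simp add: divide_simps)
      show "((\<lambda>x. (ln (1 + x) - ln (1 - x)) / 2) has_vector_derivative 1 / (1 - x\<^sup>2)) (at x within {0..1 - s})"
        unfolding has_real_derivative_iff_has_vector_derivative[symmetric] e
        using \<open>1 - x > 0\<close> \<open>1 + x > 0\<close> by (auto intro!: derivative_eq_intros)
    qed
    fix x assume x: "x \<in> {0..1-s}"
    have p: "1 - x^2 > 0" using x assms by (simp add: power_less_one_iff abs_square_less_1)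
    have "1 - x^2 \<le> sqrt ((1 - x^2)^2 + 4 * x^2 * s^2)" by (rule real_le_rsqrt) simp
    then show "k x \<le> 1 / (1 - x^2)" unfolding k_def using p ellip_integrand_pos[of s x] assms
      by (intro divide_left_mono mult_pos_pos) auto
  qed
  have b2: "integral {1-s..1} k \<le> 1"
  proof -
    have "integral {1-s..1} k \<le> integral {1-s..1} (\<lambda>x. 1 / s)"
    proof (rule integral_le)
      fix x assume x: "x \<in> {1-s..1}"
      then have "1/2 \<le> x" using assms by auto
      then have "1 / 4 \<le> x^2" using power_mono[of "1/2" x 2] by (simp add: power2_eq_square)
      then have "1 * s^2 \<le> (4 * x^2) * s^2" by (intro mult_right_mono) auto
      then have "s^2 \<le> (1 - x^2)^2 + 4 * x^2 * s^2" by (simp add: add_increasing)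
      then have "s \<le> sqrt ((1 - x^2)^2 + 4 * x^2 * s^2)" by (rule real_le_rsqrt)
      then show "k x \<le> 1 / s" unfolding k_def using assms ellip_integrand_pos[of s x]
        by (intro divide_left_mono mult_pos_pos) auto
    qed (use kc in \<open>auto intro!: integrable_continuous_real\<close>)
    also have "\<dots> = 1" using assms by simp
    finally show ?thesis .
  qed
  have "ln (2 - s) \<le> ln 2" using assms by simp
  also have "\<dots> \<le> 2" using ln_le_minus_one[of "2::real"] by simp
  finally have "ln (2 - s) \<le> 2" .
  moreover have "ln (1 / s) = - ln s" using assms by (simp add: ln_div)
  ultimately show ?thesis using split b1 b2 by simp
qed

section \<open>The modulus in logarithmic coordinates\<close>

definition nu :: "real \<Rightarrow> real" where "nu x = ln (mu (exp x))"

text \<open>The value of sin \<theta> when the cross ratio cot^2 \<theta> is exp x. Passing to -x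
  exchanges sine and cosine, which makes \<open>nu\<close> odd.\<close>

definition ellip_arg :: "real \<Rightarrow> real" where "ellip_arg x = 1 / sqrt (1 + exp x)"

lemma ellip_arg_pos: "ellip_arg x > 0" by (simp add: ellip_arg_def add_pos_pos)

lemma ellip_arg_le_1: "ellip_arg x < 1"
  unfolding ellip_arg_def using exp_gt_zero[of x] by (simp add: divide_less_eq add_pos_pos)

lemma ellip_arg_strict_decreasing: "x < y \<Longrightarrow> ellip_arg y < ellip_arg x"
  unfolding ellip_arg_def by (intro divide_strict_left_mono mult_pos_pos real_sqrt_less_mono) (auto simp: add_pos_pos)

lemma mu_exp: "mu (exp x) = ellip (ellip_arg x) / ellip (ellip_arg (- x))"
proof -
  have "exp x / (1 + exp x) = 1 / (1 + exp (- x))"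
    by (simp add: exp_minus field_simps)
  then show ?thesis unfolding mu_def ellip_arg_def by (simp add: real_sqrt_divide)
qed

lemma nu_eq: "nu x = ln (ellip (ellip_arg x)) - ln (ellip (ellip_arg (- x)))"
  unfolding nu_def mu_exp using ellip_pos ellip_arg_pos by (metis less_irrefl ln_div)

lemma mu_pos: "x > 0 \<Longrightarrow> mu x > 0"
  using mu_exp[of "ln x"] ellip_pos ellip_arg_pos by (metis exp_ln less_irrefl zero_less_divide_iff)

lemma nu_odd: "nu (- x) = - nu x"
  by (simp add: nu_eq)

lemma nu_0: "nu 0 = 0" using nu_odd[of 0] by simp

lemma nu_strict_mono: "x < y \<Longrightarrow> nu x < nu y"
proof -
  assume "x < y"
  then have "ellip (ellip_arg x) < ellip (ellip_arg y)" "ellip (ellip_arg (- y)) < ellip (ellip_arg (- x))"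
    by (auto intro!: ellip_strict_decreasing ellip_arg_strict_decreasing ellip_arg_pos)
  then show ?thesis unfolding nu_eq using ellip_pos[of "ellip_arg x"] ellip_pos[of "ellip_arg (- y)"] ellip_arg_pos
    by (smt (verit) ln_less_cancel_iff)
qed

lemma nu_mono: "x \<le> y \<Longrightarrow> nu x \<le> nu y"
  using nu_strict_mono[of x y] by (cases "x = y") auto

lemma nu_cont: "continuous_on UNIV nu"
proof -
  have m: "continuous_on UNIV ellip_arg" unfolding ellip_arg_def
    by (intro continuous_intros) (smt (verit) exp_gt_zero real_sqrt_eq_zero_cancel_iff)
  have "continuous_on UNIV (\<lambda>x. ellip (ellip_arg x))" "continuous_on UNIV (\<lambda>x. ellip (ellip_arg (- x)))"
    by (rule continuous_on_compose2[OF ellip_cont]; use m ellip_arg_pos in \<open>auto intro!: continuous_on_compose2[OF m] continuous_intros\<close>)+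
  moreover have "ellip (ellip_arg x) \<noteq> 0" for x using ellip_pos ellip_arg_pos by (metis less_irrefl)
  ultimately show ?thesis unfolding nu_eq[abs_def] by (intro continuous_intros) auto
qed

text \<open>\<open>ellip_lower\<close> and \<open>ellip_upper\<close> enclose
  \<open>ellip (ellip_arg x)\<close> between x/4 and x/4 + 3 for large x, since ln (1 / ellip_arg x)
  is about x/2; the denominator of \<open>mu\<close> tends to \<open>ellip 1\<close>.\<close>

lemma nu_asymp: "((\<lambda>x. nu x - ln x) \<longlongrightarrow> ln (1 / 4) - ln (ellip 1)) at_top"
proof -
  have lns: "ln (1 / ellip_arg x) = ln (1 + exp x) / 2" for x
    by (simp add: ellip_arg_def ln_sqrt add_pos_pos)
  have q: "((\<lambda>x. ellip (ellip_arg x) / x) \<longlongrightarrow> 1 / 4) at_top"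
  proof (rule tendsto_sandwich)
    have le: "x \<le> ln (1 + exp x)" for x :: real
      using ln_mono[of "exp x" "1 + exp x"] by simp
    show "\<forall>\<^sub>F x in at_top. 1 / 4 \<le> ellip (ellip_arg x) / x"
      using eventually_gt_at_top[of 0]
    proof eventually_elim
      case (elim x)
      have "x / 4 \<le> ln (1 / ellip_arg x) / 2" unfolding lns using le[of x] by simp
      also have "\<dots> \<le> ellip (ellip_arg x)" using ellip_lower[OF ellip_arg_pos] ellip_arg_le_1[of x] by simp
      finally show ?case using elim by (simp add: field_simps)
    qed
    show "\<forall>\<^sub>F x in at_top. ellip (ellip_arg x) / x \<le> 1 / 4 + 3 / x"
      using eventually_ge_at_top[of 2]
    proof eventually_elim
      case (elim x)
      have "exp x \<ge> 1 + x" by (rule exp_ge_add_one_self)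
      moreover have "(2::real)^2 = 4" by simp
      ultimately have "2^2 \<le> 1 + exp x" using elim by linarith
      then have "2 \<le> sqrt (1 + exp x)" by (rule real_le_rsqrt)
      then have "ellip_arg x \<le> 1 / 2" unfolding ellip_arg_def by (intro divide_left_mono mult_pos_pos) (auto simp: add_pos_pos)
      from ellip_upper[OF ellip_arg_pos this] have "ellip (ellip_arg x) \<le> ln (1 + exp x) / 4 + 2" unfolding lns by simp
      moreover have "ln (1 + exp x) \<le> x + 1"
      proof -
        have "exp x * 2 \<le> exp x * exp 1" using exp_ge_add_one_self[of 1] by (intro mult_left_mono) auto
        moreover have "1 \<le> exp x" using elim by simp
        ultimately have "1 + exp x \<le> exp x * exp 1" by linarith
        then have "ln (1 + exp x) \<le> ln (exp (x + 1))"
          by (intro ln_mono) (auto simp: exp_add add_pos_pos)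
        then show ?thesis by simp
      qed
      ultimately have "ellip (ellip_arg x) \<le> x / 4 + 3" by simp
      then show ?case using elim by (simp add: field_simps)
    qed
    show "((\<lambda>x::real. 1 / 4 + 3 / x) \<longlongrightarrow> 1 / 4) at_top" by real_asymp
  qed simp
  then have 1: "((\<lambda>x. ln (ellip (ellip_arg x) / x)) \<longlongrightarrow> ln (1 / 4)) at_top"
    by (intro tendsto_ln) auto
  have "((\<lambda>x. ellip_arg (- x)) \<longlongrightarrow> 1) at_top" unfolding ellip_arg_def by real_asymp
  moreover have "isCont ellip 1" using ellip_cont continuous_on_interior[of "{0<..}" ellip 1] by (simp add: interior_open)
  ultimately have "((\<lambda>x. ellip (ellip_arg (- x))) \<longlongrightarrow> ellip 1) at_top" using isCont_tendsto_compose by blast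
  then have 2: "((\<lambda>x. ln (ellip (ellip_arg (- x)))) \<longlongrightarrow> ln (ellip 1)) at_top"
    using ellip_pos[of 1] by (intro tendsto_ln) auto
  have "\<forall>\<^sub>F x in at_top. ln (ellip (ellip_arg x) / x) - ln (ellip (ellip_arg (- x))) = nu x - ln x"
    using eventually_gt_at_top[of 0]
  proof eventually_elim
    case (elim x)
    have "ellip (ellip_arg x) > 0" using ellip_pos[of "ellip_arg x"] ellip_arg_pos[of x] by simp
    then show ?case unfolding nu_eq using elim by (simp add: ln_div)
  qed
  from Lim_transform_eventually[OF tendsto_diff[OF 1 2] this] show ?thesis .
qed

text \<open>The slopes change places for negative x, so that \<alpha> bounds the growth of |y| from
  below and \<beta> from above. The relation is invariant under a simultaneous change of sign, which
  is what rotating a quadruple does to logarithmic cross ratios.\<close>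

definition quasi_linear :: "real \<Rightarrow> real \<Rightarrow> real \<Rightarrow> real \<Rightarrow> real \<Rightarrow> bool" where
  "quasi_linear \<alpha> \<beta> C x y \<longleftrightarrow>
     (0 \<le> x \<longrightarrow> \<alpha> * x - C \<le> y \<and> y \<le> \<beta> * x + C) \<and> (x \<le> 0 \<longrightarrow> \<beta> * x - C \<le> y \<and> y \<le> \<alpha> * x + C)"

lemma quasi_linear_uminus: "quasi_linear \<alpha> \<beta> C (- x) (- y) \<longleftrightarrow> quasi_linear \<alpha> \<beta> C x y"
  by (auto simp: quasi_linear_def)

lemma quasi_linear_nonpos: "x \<le> 0 \<Longrightarrow> \<beta> * x - C \<le> y \<Longrightarrow> y \<le> \<alpha> * x + C \<Longrightarrow> quasi_linear \<alpha> \<beta> C x y"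
  and quasi_linear_nonneg: "x \<ge> 0 \<Longrightarrow> \<alpha> * x - C \<le> y \<Longrightarrow> y \<le> \<beta> * x + C \<Longrightarrow> quasi_linear \<alpha> \<beta> C x y"
  unfolding quasi_linear_def by (cases "x = 0"; simp)+

lemma nu_asymp_real:
  assumes "e > 0"
  obtains X where "X \<ge> 1" "\<And>x. x \<ge> X \<Longrightarrow> \<bar>nu x - ln x - (ln (1 / 4) - ln (ellip 1))\<bar> < e"
proof -
  obtain N where N: "\<And>x. x \<ge> N \<Longrightarrow> \<bar>nu x - ln x - (ln (1 / 4) - ln (ellip 1))\<bar> < e"
    using tendstoD[OF nu_asymp assms] unfolding eventually_at_top_linorder dist_real_def by blast
  show ?thesis by (rule that[of "max N 1"]) (use N in auto)
qed

text \<open>For large x a small relative change of x alters ln x by little, and \<open>nu\<close>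
  differs from ln by nearly a constant; negative x follow by oddness, and on the remaining compact
  range uniform continuity applies.\<close>

lemma nu_close:
  assumes "\<epsilon> > 0"
  obtains \<delta> where "\<delta> > 0" "\<And>x y. \<bar>y - x\<bar> \<le> \<delta> * (1 + \<bar>x\<bar>) \<Longrightarrow> \<bar>nu y - nu x\<bar> \<le> \<epsilon>"
proof -
  obtain X where X: "X \<ge> 1" "\<And>x. x \<ge> X \<Longrightarrow> \<bar>nu x - ln x - (ln (1 / 4) - ln (ellip 1))\<bar> < \<epsilon> / 3"
    using nu_asymp_real[of "\<epsilon> / 3"] assms by auto
  have "uniformly_continuous_on {- (2 * X) - 1..2 * X + 1} nu"
    by (intro compact_uniformly_continuous continuous_on_subset[OF nu_cont]) auto
  then obtain d where d: "d > 0" "\<And>x y. x \<in> {- (2 * X) - 1..2 * X + 1} \<Longrightarrow> y \<in> {- (2 * X) - 1..2 * X + 1} \<Longrightarrow> dist y x < d \<Longrightarrow> dist (nu y) (nu x) < \<epsilon>"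
    using assms unfolding uniformly_continuous_on_def by meson
  \<comment> \<open>1/4 keeps y above x/2; then |ln y - ln x| \<le> 4 \<delta>, which by
    \<epsilon>/12 is at most \<epsilon>/3, the other two thirds being the deviations of
    \<open>nu\<close> from its asymptotics at x and y. The last two terms serve |x| \<le>
    2X.\<close>
  define \<delta> where "\<delta> = min (min (1 / 4) (\<epsilon> / 12)) (min (d / (2 * (1 + 2 * X))) (1 / (1 + 2 * X)))"
  have \<delta>: "\<delta> > 0" "\<delta> \<le> 1 / 4" "\<delta> \<le> \<epsilon> / 12" "\<delta> \<le> d / (2 * (1 + 2 * X))" "\<delta> \<le> 1 / (1 + 2 * X)"
  proof -
    show "\<delta> > 0" using assms d X by (simp add: \<delta>_def)
    show "\<delta> \<le> 1 / 4" "\<delta> \<le> \<epsilon> / 12" "\<delta> \<le> d / (2 * (1 + 2 * X))" "\<delta> \<le> 1 / (1 + 2 * X)"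
      unfolding \<delta>_def by linarith+
  qed
  have \<delta>': "\<delta> * (1 + 2 * X) \<le> d / 2" "\<delta> * (1 + 2 * X) \<le> 1"
    using \<delta>(4,5) X by (simp_all add: field_simps)
  have big: "\<bar>nu y - nu x\<bar> \<le> \<epsilon>" if x: "x > 2 * X" and xy: "\<bar>y - x\<bar> \<le> \<delta> * (1 + x)" for x y
  proof -
    have "\<delta> * (1 + x) \<le> \<delta> * (2 * x)" using \<delta> x X by (intro mult_left_mono) auto
    then have b: "\<bar>y - x\<bar> \<le> 2 * \<delta> * x" using xy by simp
    have "2 * \<delta> * x \<le> x / 2" using \<delta> x X by simp
    then have y: "y \<ge> x / 2" "y > 0" "x > 0" "y \<ge> X" using b x X unfolding abs_le_iff by linarith+
    have "ln y - ln x \<le> 4 * \<delta>"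
    proof -
      have "ln y - ln x \<le> y / x - 1" using y ln_le_minus_one[of "y / x"] by (simp add: ln_div)
      also have "\<dots> = (y - x) / x" using y by (simp add: field_simps)
      also have "\<dots> \<le> 4 * \<delta>" using y b mult_pos_pos[OF \<delta>(1) y(3)] by (simp add: divide_le_eq)
      finally show ?thesis .
    qed
    moreover have "ln x - ln y \<le> 4 * \<delta>"
    proof -
      have "ln x - ln y \<le> x / y - 1" using y ln_le_minus_one[of "x / y"] by (simp add: ln_div)
      also have "\<dots> = (x - y) / y" using y by (simp add: field_simps)
      also have "\<dots> \<le> 4 * \<delta>"
      proof -
        have "x - y \<le> 4 * \<delta> * (x / 2)" using b by simp
        also have "\<dots> \<le> 4 * \<delta> * y" using y \<delta> by (intro mult_left_mono) auto
        finally show ?thesis using y by (simp add: divide_le_eq)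
      qed
      finally show ?thesis .
    qed
    moreover have "x \<ge> X" using x X by simp
    ultimately show ?thesis using X(2)[of x] X(2)[OF y(4)] \<delta>(3) by linarith
  qed
  have "\<bar>nu y - nu x\<bar> \<le> \<epsilon>" if xy: "\<bar>y - x\<bar> \<le> \<delta> * (1 + \<bar>x\<bar>)" for x y
  proof -
    consider "x > 2 * X" | "- x > 2 * X" | "\<bar>x\<bar> \<le> 2 * X" by linarith
    then show ?thesis
    proof cases
      case 1
      then show ?thesis using big[of x y] xy X by simp
    next
      case 2
      then show ?thesis using big[of "- x" "- y"] xy X by (simp add: nu_odd abs_minus_commute)
    next
      case 3
      have "\<delta> * (1 + \<bar>x\<bar>) \<le> \<delta> * (1 + 2 * X)" using 3 \<delta> by (intro mult_left_mono) auto
      then have "\<bar>y - x\<bar> \<le> d / 2" "\<bar>y - x\<bar> \<le> 1" using xy \<delta>' by auto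
      moreover from this have "x \<in> {- (2 * X) - 1..2 * X + 1}" "y \<in> {- (2 * X) - 1..2 * X + 1}"
        using 3 unfolding atLeastAtMost_iff by linarith+
      ultimately have "dist (nu y) (nu x) < \<epsilon>" using d by (intro d(2)) (auto simp: dist_real_def)
      then show ?thesis by (simp add: dist_real_def)
    qed
  qed
  then show ?thesis using that \<delta>(1) by blast
qed

text \<open>Beyond a threshold the additive constant is absorbed and y lies between two positive
  multiples of x, so ln y - ln x is bounded; before it, x and y lie in a bounded range.\<close>

lemma nu_quasi_linear:
  assumes "0 < \<alpha>" "\<alpha> \<le> \<beta>" "0 \<le> C"
  obtains K where "\<And>x y. quasi_linear \<alpha> \<beta> C x y \<Longrightarrow> \<bar>nu y - nu x\<bar> \<le> K"
proof -
  obtain X where X: "X \<ge> 1" "\<And>x. x \<ge> X \<Longrightarrow> \<bar>nu x - ln x - (ln (1 / 4) - ln (ellip 1))\<bar> < 1"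
    using nu_asymp_real[of 1] by auto
  \<comment> \<open>Chosen so that \<alpha> x - C is at least \<alpha> x / 2 and at least X for x
    \<ge> Y.\<close>
  define Y where "Y = max X (2 * (C + X) / \<alpha>)"
  have Y: "Y \<ge> X" "\<alpha> * Y \<ge> 2 * (C + X)" using assms by (auto simp: Y_def field_simps max_def)
  define K where "K = (nu Y + nu (\<beta> * Y + C)) + (2 + \<bar>ln (\<alpha> / 2)\<bar> + \<bar>ln (\<beta> + C)\<bar>)"
  have bY: "\<beta> * Y \<ge> 0" using assms Y X by simp
  have K0: "nu Y \<ge> 0" "nu (\<beta> * Y + C) \<ge> 0" using nu_mono[of 0] nu_0 assms Y X bY by auto
  have pos: "\<bar>nu y - nu x\<bar> \<le> K" if x: "0 \<le> x" and y: "\<alpha> * x - C \<le> y" "y \<le> \<beta> * x + C" for x y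
  proof (cases "x \<le> Y")
    case True
    have "0 \<le> \<alpha> * x" "\<beta> * x \<le> \<beta> * Y" using True x assms by (auto intro: mult_left_mono)
    then have "- (\<beta> * Y + C) \<le> y" "y \<le> \<beta> * Y + C" using y bY assms by linarith+
    then have "\<bar>nu y\<bar> \<le> nu (\<beta> * Y + C)" using nu_mono nu_odd by (metis abs_le_iff minus_le_iff)
    moreover have "\<bar>nu x\<bar> \<le> nu Y" using nu_mono[OF True] nu_mono[OF x] nu_0 by simp
    ultimately show ?thesis unfolding K_def by linarith
  next
    case False
    have ax: "\<alpha> * x \<ge> \<alpha> * Y" using False assms by (intro mult_left_mono) auto
    have y1: "y \<ge> (\<alpha> / 2) * x" "y \<ge> X" 
  proof -
    have "2 * (C + X) \<le> \<alpha> * x" using ax Y by linarith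
    then show "y \<ge> (\<alpha> / 2) * x" "y \<ge> X" using y(1) X(1) assms(3) by (simp_all add: field_simps)
  qed
    have x1: "x \<ge> 1" "x \<ge> X" "x > 0" using False Y X by auto
    have "C * 1 \<le> C * x" using x1 assms by (intro mult_left_mono) auto
    then have y2: "y \<le> (\<beta> + C) * x" using y by (simp add: algebra_simps)
    have y0: "y > 0" using y1 X by simp
    have bC: "\<beta> + C > 0" "\<alpha> / 2 > 0" using assms by auto
    have "ln ((\<alpha> / 2) * x) \<le> ln y" using y1 x1 bC y0 by (intro ln_mono mult_pos_pos)
    then have l1: "ln (\<alpha> / 2) \<le> ln y - ln x" using ln_mult_pos[OF bC(2) x1(3)] by simp
    have "ln y \<le> ln ((\<beta> + C) * x)" using y2 y0 x1 bC by (intro ln_mono mult_pos_pos)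
    then have l2: "ln y - ln x \<le> ln (\<beta> + C)" using ln_mult_pos[OF bC(1) x1(3)] by simp
    show ?thesis using X(2)[OF x1(2)] X(2)[OF y1(2)] l1 l2 K0 unfolding K_def by linarith
  qed
  have "\<bar>nu y - nu x\<bar> \<le> K" if "quasi_linear \<alpha> \<beta> C x y" for x y
  proof (cases "x \<ge> 0")
    case True
    then show ?thesis using that pos unfolding quasi_linear_def by blast
  next
    case False
    then show ?thesis using that pos[of "- x" "- y"] by (auto simp: quasi_linear_def nu_odd abs_minus_commute)
  qed
  then show ?thesis using that by blast
qed

section \<open>Lifts of circle homeomorphisms\<close>

definition circle_lift :: "(real \<Rightarrow> real) \<Rightarrow> bool" where
  "circle_lift f \<longleftrightarrow> continuous_on UNIV f \<and> strict_mono f \<and> (\<forall>x. f (x + 2 * pi) = f x + 2 * pi)"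

lemma lift_less: "circle_lift f \<Longrightarrow> f x < f y \<longleftrightarrow> x < y"
  and lift_le: "circle_lift f \<Longrightarrow> f x \<le> f y \<longleftrightarrow> x \<le> y"
  and lift_2pi: "circle_lift f \<Longrightarrow> f (x + 2 * pi) = f x + 2 * pi"
  by (simp_all add: circle_lift_def strict_mono_less strict_mono_less_eq)

lemma lift_2pi_int: "circle_lift f \<Longrightarrow> f (x + 2 * pi * of_int n) = f x + 2 * pi * of_int n"
proof (induction n rule: int_induct[of _ 0])
  case base then show ?case by simp
next
  case (step1 n) then show ?case using lift_2pi[of f "x + 2 * pi * of_int n"] by (simp add: algebra_simps)
next
  case (step2 n) then show ?case using lift_2pi[of f "x + 2 * pi * of_int (n - 1)"] by (simp add: algebra_simps)
qed

lemma circle_lift_id: "circle_lift (\<lambda>x. x)"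
  by (auto simp: circle_lift_def strict_mono_def)

lemma circle_lift_compose: "circle_lift f \<Longrightarrow> circle_lift g \<Longrightarrow> circle_lift (\<lambda>x. f (g x))"
  unfolding circle_lift_def strict_mono_def
  by (auto intro: continuous_on_compose2)

lemma circle_lift_reflect: "circle_lift f \<Longrightarrow> circle_lift (\<lambda>x. - f (- x))"
proof -
  assume f: "circle_lift f"
  have "- f (- (x + 2 * pi)) = - f (- x) + 2 * pi" for x
    using lift_2pi[OF f, of "- (x + 2 * pi)"] by simp
  then show ?thesis using f unfolding circle_lift_def strict_mono_def
    by (auto intro!: continuous_intros continuous_on_compose2[of UNIV f])
qed

lemma lift_surj: assumes "circle_lift f" shows "surj f"
proof -
  have "\<exists>x. f x = y" for y
  proof -
    define n where "n = \<lfloor>(y - f 0) / (2 * pi)\<rfloor>"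
    have "of_int n \<le> (y - f 0) / (2 * pi)" "(y - f 0) / (2 * pi) \<le> of_int (n + 1)"
      unfolding n_def by linarith+
    then have "f 0 + 2 * pi * of_int n \<le> y" "y \<le> f 0 + 2 * pi * of_int (n + 1)"
      by (simp_all add: field_simps)
    then have a: "f (0 + 2 * pi * of_int n) \<le> y" "y \<le> f (0 + 2 * pi * of_int (n + 1))"
      using lift_2pi_int[OF assms, of 0 n] lift_2pi_int[OF assms, of 0 "n + 1"] by simp_all
    have "continuous_on {0 + 2 * pi * of_int n..0 + 2 * pi * of_int (n + 1)} f"
      using assms unfolding circle_lift_def by (blast intro: continuous_on_subset)
    then show ?thesis using IVT'[of f _ y, OF a(1) a(2)] by (auto simp: mult_left_mono)
  qed
  then show ?thesis by (metis surjI)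
qed

lemma lift_inv:
  assumes "circle_lift f"
  shows "f (inv f y) = y" "inv f (f x) = x" "circle_lift (inv f)"
proof -
  show 1: "f (inv f y) = y" for y using lift_surj[OF assms] by (rule surj_f_inv_f)
  have "inj f" using assms strict_mono_imp_inj_on by (auto simp: circle_lift_def)
  then show 2: "inv f (f x) = x" for x by (rule inv_f_f)
  have lt: "inv f x < inv f y" if "x < y" for x y
    using that lift_less[OF assms, of "inv f x" "inv f y"] by (simp add: 1)
  have "range (inv f) = UNIV" using 2 by (metis surjI)
  then have "continuous_on UNIV (inv f)"
    using lt by (intro continuous_onI_mono) (auto simp: less_eq_real_def)
  moreover have "inv f (x + 2 * pi) = inv f x + 2 * pi" for x
    using lift_2pi[OF assms, of "inv f x"] by (metis 1 2)
  ultimately show "circle_lift (inv f)" using lt by (auto simp: circle_lift_def strict_mono_def)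
qed

lemma lift_gap:
  assumes f: "circle_lift f" and s: "s > 0"
  obtains c where "c > 0" "\<And>x y. x + s \<le> y \<Longrightarrow> c \<le> f y - f x"
proof -
  have cf: "continuous_on UNIV f" using f by (simp add: circle_lift_def)
  have "continuous_on {0..2 * pi} (\<lambda>x. f (x + s) - f x)"
  proof (rule continuous_on_diff)
    have "continuous_on {0..2 * pi} (\<lambda>x. x + s)" by (intro continuous_intros)
    then show "continuous_on {0..2 * pi} (\<lambda>x. f (x + s))" by (rule continuous_on_compose2[OF cf]) simp
    show "continuous_on {0..2 * pi} f" using cf by (rule continuous_on_subset) simp
  qed
  then obtain x0 where x0: "\<And>x. x \<in> {0..2 * pi} \<Longrightarrow> f (x0 + s) - f x0 \<le> f (x + s) - f x"
    using continuous_attains_inf[of "{0..2 * pi}" "\<lambda>x. f (x + s) - f x"] by force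
  define c where "c = f (x0 + s) - f x0"
  have "c \<le> f y - f x" if "x + s \<le> y" for x y
  proof -
    define n where "n = \<lfloor>x / (2 * pi)\<rfloor>"
    define z where "z = x + 2 * pi * of_int (- n)"
    have "of_int n \<le> x / (2 * pi)" "x / (2 * pi) \<le> of_int n + 1" unfolding n_def by linarith+
    then have "z \<in> {0..2 * pi}" unfolding z_def by (simp add: field_simps)
    then have "c \<le> f (z + s) - f z" unfolding c_def by (rule x0)
    also have "f (z + s) = f (x + s) + 2 * pi * of_int (- n)"
      using lift_2pi_int[OF f, of "x + s" "- n"] unfolding z_def by (simp only: add_ac)
    also have "f z = f x + 2 * pi * of_int (- n)" unfolding z_def by (rule lift_2pi_int[OF f])
    finally have "c \<le> f (x + s) - f x" by simp
    also have "f (x + s) \<le> f y" using that lift_le[OF f] by simp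
    finally show ?thesis by simp
  qed
  moreover have "c > 0" unfolding c_def using s lift_less[OF f, of x0 "x0 + s"] by simp
  ultimately show ?thesis using that by blast
qed

text \<open>Uniform continuity, obtained from \<open>lift_gap\<close> for the inverse lift. The
  one-sided form covers y < x as well.\<close>

lemma lift_small:
  assumes f: "circle_lift f" and e: "e > 0"
  obtains d where "d > 0" "\<And>x y. y - x < d \<Longrightarrow> f y - f x < e"
proof -
  obtain c where c: "c > 0" "\<And>x y. x + e \<le> y \<Longrightarrow> c \<le> inv f y - inv f x"
    using lift_gap[OF lift_inv(3)[OF f] e] by blast
  have "f y - f x < e" if "y - x < c" for x y
    using c(2)[of "f x" "f y"] that lift_inv(2)[OF f] by fastforce
  then show ?thesis using that c(1) by blast
qed

text \<open>The Beurling-Ahlfors condition for a lift, restricted to scales up to \<open>t0\<close>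
  so that C can be taken close to 1 for symmetric maps.\<close>

definition doubling :: "(real \<Rightarrow> real) \<Rightarrow> real \<Rightarrow> real \<Rightarrow> bool" where
  "doubling f C t0 \<longleftrightarrow> (\<forall>x t. 0 < t \<and> t \<le> t0 \<longrightarrow>
     f (x + t) - f x \<le> C * (f x - f (x - t)) \<and> f x - f (x - t) \<le> C * (f (x + t) - f x))"

lemma doubling_step:
  assumes "doubling f C t0" "C \<ge> 1" "0 < t" "t \<le> t0"
  shows "(1 + 1 / C) * (f (x + t) - f x) \<le> f (x + 2 * t) - f x" "f (x + 2 * t) - f x \<le> (1 + C) * (f (x + t) - f x)"
proof -
  have "f (x + t + t) - f (x + t) \<le> C * (f (x + t) - f (x + t - t))" "f (x + t) - f (x + t - t) \<le> C * (f (x + t + t) - f (x + t))"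
    using assms unfolding doubling_def by blast+
  then have a: "f (x + 2 * t) - f (x + t) \<le> C * (f (x + t) - f x)" "f (x + t) - f x \<le> C * (f (x + 2 * t) - f (x + t))"
    by (simp_all add: algebra_simps)
  then show "f (x + 2 * t) - f x \<le> (1 + C) * (f (x + t) - f x)" by (simp add: algebra_simps)
  have "(f (x + t) - f x) / C \<le> f (x + 2 * t) - f (x + t)" using a(2) assms(2) by (simp add: divide_le_eq mult.commute)
  moreover have "(1 + 1 / C) * (f (x + t) - f x) = (f (x + t) - f x) + (f (x + t) - f x) / C"
    by (simp add: distrib_right)
  ultimately show "(1 + 1 / C) * (f (x + t) - f x) \<le> f (x + 2 * t) - f x" by linarith
qed

text \<open>The bound 2 t0 rather than t0 lets the last doubling start at scale t0 itself.\<close>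

lemma doubling_pow:
  assumes "circle_lift f" "doubling f C t0" "C \<ge> 1" "0 < s" "2 ^ n * s \<le> 2 * t0"
  shows "(1 + 1 / C) ^ n * (f (x + s) - f x) \<le> f (x + 2 ^ n * s) - f x \<and>
    f (x + 2 ^ n * s) - f x \<le> (1 + C) ^ n * (f (x + s) - f x)"
  using assms(5)
proof (induction n)
  case (Suc n)
  have h: "0 < 2 ^ n * s" "2 ^ n * s \<le> t0" using assms Suc.prems by auto
  have IH: "(1 + 1 / C) ^ n * (f (x + s) - f x) \<le> f (x + 2 ^ n * s) - f x"
    "f (x + 2 ^ n * s) - f x \<le> (1 + C) ^ n * (f (x + s) - f x)" using Suc h by auto
  note st = doubling_step[OF assms(2,3) h, of x]
  have e: "2 ^ Suc n * s = 2 * (2 ^ n * s)" by simp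
  have "(1 + 1 / C) * ((1 + 1 / C) ^ n * (f (x + s) - f x)) \<le> (1 + 1 / C) * (f (x + 2 ^ n * s) - f x)"
    using assms by (intro mult_left_mono IH) auto
  moreover have "(1 + C) * (f (x + 2 ^ n * s) - f x) \<le> (1 + C) * ((1 + C) ^ n * (f (x + s) - f x))"
    using assms by (intro mult_left_mono IH) auto
  ultimately show ?case using st unfolding e by (simp add: mult.assoc)
qed simp

text \<open>With n the integer part of log 2 (t/s), the increment grows at least by (1 + 1/C)^n and
  at most by (1 + C)^(n+1). Taking logarithms produces the slopes log 2 (1 + 1/C) and log 2 (1 + C);
  rounding n costs ln (1 + C).\<close>

lemma doubling_growth:
  assumes f: "circle_lift f" and dbl: "doubling f C t0" and C: "C \<ge> 1" and st: "0 < s" "s \<le> t" "t \<le> t0"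
  shows "log 2 (1 + 1 / C) * ln (t / s) - ln (1 + C) \<le> ln ((f (x + t) - f x) / (f (x + s) - f x))"
    and "ln ((f (x + t) - f x) / (f (x + s) - f x)) \<le> log 2 (1 + C) * ln (t / s) + ln (1 + C)"
proof -
  define n where "n = nat \<lfloor>log 2 (t / s)\<rfloor>"
  have ts: "t / s \<ge> 1" using st by simp
  then have l0: "log 2 (t / s) \<ge> 0" by simp
  have n: "real n \<le> log 2 (t / s)" "log 2 (t / s) \<le> real n + 1" unfolding n_def using l0 by linarith+
  have "2 powr real n \<le> 2 powr log 2 (t / s)" "2 powr log 2 (t / s) \<le> 2 powr (real n + 1)" 
    using n by simp_all
  then have p2: "2 ^ n \<le> t / s" "t / s \<le> 2 ^ Suc n" using ts
    by (simp_all add: powr_realpow powr_add)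
  then have b: "2 ^ n * s \<le> t" "t \<le> 2 ^ Suc n * s" using st by (simp_all add: field_simps)
  have Fs: "f (x + s) - f x > 0" and Ft: "f (x + t) - f x > 0" using lift_less[OF f] st by simp_all
  have q1: "1 + 1 / C > 1" "1 + C > 1" using C by auto
  have "(1 + 1 / C) ^ n * (f (x + s) - f x) \<le> f (x + 2 ^ n * s) - f x"
    using doubling_pow[OF f dbl C st(1), of n x] b st by auto
  also have "\<dots> \<le> f (x + t) - f x" using lift_le[OF f] b by simp
  finally have lo: "(1 + 1 / C) ^ n \<le> (f (x + t) - f x) / (f (x + s) - f x)" using Fs by (simp add: le_divide_eq)
  have "f (x + t) - f x \<le> f (x + 2 ^ Suc n * s) - f x" using lift_le[OF f] b by simp
  also have "\<dots> \<le> (1 + C) ^ Suc n * (f (x + s) - f x)"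
    using doubling_pow[OF f dbl C st(1), of "Suc n" x] b st by auto
  finally have up: "(f (x + t) - f x) / (f (x + s) - f x) \<le> (1 + C) ^ Suc n" using Fs by (simp add: divide_le_eq)
  have lq: "ln (1 + 1 / C) > 0" "ln (1 + C) > 0" using q1 by (auto intro: ln_gt_zero)
  have "1 / C \<le> 1" using C by simp
  then have "1 / C \<le> C" using C by linarith
  then have lpq: "ln (1 + 1 / C) \<le> ln (1 + C)" using C by (intro ln_mono) (auto simp: add_pos_pos)
  have "log 2 (1 + 1 / C) * ln (t / s) - ln (1 + C) \<le> (log 2 (t / s) - 1) * ln (1 + 1 / C)"
    using lpq by (simp add: log_def algebra_simps)
  also have "\<dots> \<le> real n * ln (1 + 1 / C)" using n lq by (intro mult_right_mono) auto
  also have "\<dots> = ln ((1 + 1 / C) ^ n)" using q1 by (simp add: ln_realpow)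
  also have "\<dots> \<le> ln ((f (x + t) - f x) / (f (x + s) - f x))" using lo q1 Fs Ft by (intro ln_mono zero_less_power divide_pos_pos) linarith+
  finally show "log 2 (1 + 1 / C) * ln (t / s) - ln (1 + C) \<le> ln ((f (x + t) - f x) / (f (x + s) - f x))" .
  have "ln ((f (x + t) - f x) / (f (x + s) - f x)) \<le> ln ((1 + C) ^ Suc n)"
    using up q1 Fs Ft by (intro ln_mono) auto
  also have "\<dots> = (real n + 1) * ln (1 + C)" using q1 by (subst ln_realpow) auto
  also have "\<dots> \<le> (log 2 (t / s) + 1) * ln (1 + C)" using n lq by (intro mult_right_mono) auto
  also have "\<dots> = log 2 (1 + C) * ln (t / s) + ln (1 + C)" by (simp add: log_def algebra_simps)
  finally show "ln ((f (x + t) - f x) / (f (x + s) - f x)) \<le> log 2 (1 + C) * ln (t / s) + ln (1 + C)" .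
qed

text \<open>Increments to the right and to the left of v at the same scale are comparable, so the
  ratio reduces to increments on one side at two scales, where \<open>doubling_growth\<close>
  applies. Scales beyond \<open>t0\<close> are cut off at \<open>t0\<close>, which changes
  logarithms by bounded amounts only.\<close>

lemma doubling_quasi_linear:
  assumes f: "circle_lift f" and dbl: "doubling f C t0" and C: "C \<ge> 1" and t0: "0 < t0" "t0 < pi"
  obtains C0 where "C0 \<ge> 0" "\<And>u v w. u < v \<Longrightarrow> v < w \<Longrightarrow> w \<le> u + 2 * pi \<Longrightarrow>
    quasi_linear (log 2 (1 + 1 / C)) (log 2 (1 + C)) C0 (ln ((v - u) / (w - v))) (ln ((f v - f u) / (f w - f v)))"
proof -
  define \<alpha> \<beta> where "\<alpha> = log 2 (1 + 1 / C)" and "\<beta> = log 2 (1 + C)"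
  have "1 / C \<le> 1" using C by simp
  then have "1 / C \<le> C" using C by linarith
  then have ab: "0 \<le> \<alpha>" "\<alpha> \<le> \<beta>" unfolding \<alpha>_def \<beta>_def using C by (auto simp: add_pos_pos)
  obtain c where c: "c > 0" "\<And>x y. x + t0 \<le> y \<Longrightarrow> c \<le> f y - f x" using lift_gap[OF f t0(1)] by blast
  have "c \<le> 2 * pi" using c(2)[of 0 "0 + 2 * pi"] lift_2pi[OF f, of 0] t0 by auto
  \<comment> \<open>Bounds the loss of the cut-off: an increment is at most a full turn 2 pi, and at
    scale \<open>t0\<close> it is at least c.\<close>
  define K where "K = 2 * pi / c"
  have K: "K \<ge> 1" using c \<open>c \<le> 2 * pi\<close> by (simp add: K_def)
  define T where "T = ln (2 * pi / t0)"
  have T: "T \<ge> 0" unfolding T_def using t0 by (intro ln_ge_zero) (simp add: field_simps)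
  define P where "P v t = f (v + t) - f v" for v t
  define N where "N v t = f v - f (v - t)" for v t
  have Pp: "P v t > 0" "N v t > 0" if "t > 0" for v t using lift_less[OF f] that by (auto simp: P_def N_def)
  have Pm: "P v s \<le> P v t" "N v s \<le> N v t" if "s \<le> t" for v s t using lift_le[OF f] that by (auto simp: P_def N_def)
  have PK: "P v t \<le> K * P v (min t t0)" "N v t \<le> K * N v (min t t0)" if t: "0 < t" "t \<le> 2 * pi" for v t
  proof -
    have p: "P v (2 * pi) = 2 * pi" "N v (2 * pi) = 2 * pi"
      using lift_2pi[OF f, of v] lift_2pi[OF f, of "v - 2 * pi"] by (auto simp: P_def N_def)
    show "P v t \<le> K * P v (min t t0)"
    proof (cases "t \<le> t0")
      case True
      then show ?thesis using K Pp[OF t(1)] by simp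
    next
      case False
      have "P v t \<le> 2 * pi" using Pm(1)[OF t(2), of v] p by simp
      also have "\<dots> = K * c" using c by (simp add: K_def)
      also have "\<dots> \<le> K * P v t0" using c(2)[of v "v + t0"] K by (intro mult_left_mono) (auto simp: P_def)
      finally show ?thesis using False by (simp add: min_def)
    qed
    show "N v t \<le> K * N v (min t t0)"
    proof (cases "t \<le> t0")
      case True
      then show ?thesis using K Pp[OF t(1)] by simp
    next
      case False
      have "N v t \<le> 2 * pi" using Pm(2)[OF t(2), of v] p by simp
      also have "\<dots> = K * c" using c by (simp add: K_def)
      also have "\<dots> \<le> K * N v t0" using c(2)[of "v - t0" v] K by (intro mult_left_mono) (auto simp: N_def)
      finally show ?thesis using False by (simp add: min_def)
    qed
  qed
  have lnK: "ln (P v t) - ln (P v (min t t0)) \<in> {0..ln K}" if t: "0 < t" "t \<le> 2 * pi" for v t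
  proof -
    have m: "0 < min t t0" using t t0 by simp
    have "ln (P v (min t t0)) \<le> ln (P v t)" using Pm Pp m t by (intro ln_mono) auto
    moreover have "ln (P v t) \<le> ln (K * P v (min t t0))" using PK[OF t] Pp m t K by (intro ln_mono mult_pos_pos) auto
    moreover have "ln (K * P v (min t t0)) = ln K + ln (P v (min t t0))" using Pp m K by (intro ln_mult_pos) auto
    ultimately show ?thesis by simp
  qed
  have lnT: "ln t - ln (min t t0) \<in> {0..T}" if t: "0 < t" "t \<le> 2 * pi" for t
  proof (cases "t \<le> t0")
    case True then show ?thesis using T by simp
  next
    case False
    then have "ln t0 \<le> ln t" "ln t \<le> ln (2 * pi)" using t t0 by (auto intro: ln_mono)
    moreover have "T = ln (2 * pi) - ln t0" unfolding T_def using t0 by (intro ln_divide_pos) auto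
    ultimately show ?thesis using False by (simp add: min_def)
  qed
  define C1 where "C1 = ln (1 + C) + ln K + \<beta> * T"
  have grow: "\<alpha> * ln (t / s) - C1 \<le> ln (P v t / P v s)" "ln (P v t / P v s) \<le> \<beta> * ln (t / s) + C1"
    if st: "0 < s" "s \<le> t" "t \<le> 2 * pi" for v s t
  proof -
    define s' t' where "s' = min s t0" and "t' = min t t0"
    have st': "0 < s'" "s' \<le> t'" "t' \<le> t0" using st t0 by (auto simp: s'_def t'_def)
    have g: "\<alpha> * ln (t' / s') - ln (1 + C) \<le> ln (P v t' / P v s')" "ln (P v t' / P v s') \<le> \<beta> * ln (t' / s') + ln (1 + C)"
      using doubling_growth[OF f dbl C st', of v] by (auto simp: P_def \<alpha>_def \<beta>_def)
    have d: "ln (t / s) = ln t - ln s" "ln (t' / s') = ln t' - ln s'"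
      "ln (P v t / P v s) = ln (P v t) - ln (P v s)" "ln (P v t' / P v s') = ln (P v t') - ln (P v s')"
      using st st' by (intro ln_divide_pos Pp; simp)+
    have e: "ln t - ln t' \<in> {0..T}" "ln s - ln s' \<in> {0..T}" "ln (P v t) - ln (P v t') \<in> {0..ln K}"
      "ln (P v s) - ln (P v s') \<in> {0..ln K}"
      unfolding s'_def t'_def using lnT[of t] lnT[of s] lnK[of t v] lnK[of s v] st by auto
    have "\<alpha> * (ln t - ln s) \<le> \<alpha> * (ln t' - ln s' + T)" using e ab by (intro mult_left_mono) auto
    moreover have "\<alpha> * T \<le> \<beta> * T" using ab T by (intro mult_right_mono) auto
    ultimately show "\<alpha> * ln (t / s) - C1 \<le> ln (P v t / P v s)"
      using g(1) e unfolding d C1_def by (simp add: algebra_simps)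
    have "\<beta> * (ln t' - ln s') \<le> \<beta> * (ln t - ln s + T)" using e ab by (intro mult_left_mono) auto
    then show "ln (P v t / P v s) \<le> \<beta> * ln (t / s) + C1"
      using g(2) e unfolding d C1_def by (simp add: algebra_simps)
  qed
  have NP: "\<bar>ln (N v s) - ln (P v s)\<bar> \<le> ln C + ln K" if s: "0 < s" "s \<le> 2 * pi" for v s
  proof -
    define s' where "s' = min s t0"
    have s': "0 < s'" "s' \<le> t0" "s' \<le> s" using s t0 by (auto simp: s'_def)
    have db: "P v s' \<le> C * N v s'" "N v s' \<le> C * P v s'"
      using dbl s' unfolding doubling_def P_def N_def by auto
    have "N v s \<le> K * N v s'" using PK[OF s] by (simp add: s'_def)
    also have "\<dots> \<le> K * (C * P v s)" using db Pm(1)[OF s'(3), of v] C K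
      by (intro mult_left_mono) (auto intro: order_trans[OF db(2)] mult_left_mono)
    finally have "N v s \<le> C * K * P v s" by (simp add: mult_ac)
    then have "ln (N v s) \<le> ln (C * K * P v s)" using Pp s C K by (intro ln_mono mult_pos_pos) auto
    also have "\<dots> = ln C + ln K + ln (P v s)" using Pp s C K by (simp add: ln_mult_pos)
    finally have 1: "ln (N v s) - ln (P v s) \<le> ln C + ln K" by simp
    have "P v s \<le> K * P v s'" using PK[OF s] by (simp add: s'_def)
    also have "\<dots> \<le> K * (C * N v s)" using db Pm(2)[OF s'(3), of v] C K
      by (intro mult_left_mono) (auto intro: order_trans[OF db(1)] mult_left_mono)
    finally have "P v s \<le> C * K * N v s" by (simp add: mult_ac)
    then have "ln (P v s) \<le> ln (C * K * N v s)" using Pp s C K by (intro ln_mono mult_pos_pos) auto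
    also have "\<dots> = ln C + ln K + ln (N v s)" using Pp s C K by (simp add: ln_mult_pos)
    finally show ?thesis using 1 by simp
  qed
  define C0 where "C0 = C1 + ln C + ln K"
  have C1: "C1 \<ge> 0" unfolding C1_def using K C ab T by (intro add_nonneg_nonneg) auto
  show ?thesis
  proof (rule that[of C0])
    show "C0 \<ge> 0" unfolding C0_def using C1 C K by simp
    fix u v w assume uvw: "u < v" "v < w" "w \<le> u + 2 * pi"
    define s t where "s = v - u" and "t = w - v"
    have st: "0 < s" "0 < t" "s \<le> 2 * pi" "t \<le> 2 * pi" using uvw by (auto simp: s_def t_def)
    have F: "f v - f u = N v s" "f w - f v = P v t" by (auto simp: N_def P_def s_def t_def)
    have l1: "ln (N v s / P v t) = ln (N v s) - ln (P v t)" using st by (intro ln_divide_pos Pp)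
    have l2: "ln (s / t) = ln s - ln t" "ln (t / s) = ln t - ln s" using st by (auto intro!: ln_divide_pos)
    have l3: "ln (P v s / P v t) = ln (P v s) - ln (P v t)" "ln (P v t / P v s) = ln (P v t) - ln (P v s)"
      using st by (intro ln_divide_pos Pp; simp)+
    note np = NP[OF st(1,3), of v]
    define X where "X = ln s - ln t"
    have X: "\<alpha> * ln (s / t) = \<alpha> * X" "\<alpha> * ln (t / s) = - (\<alpha> * X)" "\<beta> * ln (s / t) = \<beta> * X" "\<beta> * ln (t / s) = - (\<beta> * X)"
      unfolding l2 X_def by (simp_all add: algebra_simps)
    have "quasi_linear \<alpha> \<beta> C0 X (ln (N v s) - ln (P v t))"
    proof (cases "s \<le> t")
      case True
      have "- (\<alpha> * X) - C1 \<le> ln (P v t) - ln (P v s)" "ln (P v t) - ln (P v s) \<le> - (\<beta> * X) + C1"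
        using grow[OF st(1) True st(4), of v] unfolding X l3 by auto
      moreover have "X \<le> 0" unfolding X_def using True st by simp
      ultimately show ?thesis using np unfolding C0_def by (intro quasi_linear_nonpos) linarith+
    next
      case False
      then have ts: "t \<le> s" by simp
      have "\<alpha> * X - C1 \<le> ln (P v s) - ln (P v t)" "ln (P v s) - ln (P v t) \<le> \<beta> * X + C1"
        using grow[OF st(2) ts st(3), of v] unfolding X l3 by auto
      moreover have "X \<ge> 0" unfolding X_def using ts st by simp
      ultimately show ?thesis using np unfolding C0_def by (intro quasi_linear_nonneg) linarith+
    qed
    then show "quasi_linear (log 2 (1 + 1 / C)) (log 2 (1 + C)) C0 (ln ((v - u) / (w - v))) (ln ((f v - f u) / (f w - f v)))"
      unfolding \<alpha>_def[symmetric] \<beta>_def[symmetric] F l1 s_def[symmetric] t_def[symmetric] l2 X_def .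
  qed
qed

section \<open>Distortion of cross ratios\<close>

text \<open>With \<open>x\<close>, \<open>z\<close> the logarithms of the ratios of the outer gaps to the middle gap, \<open>phi x z\<close> is the
  logarithm of the cross ratio up to a bounded error. Unlike a sum of two ratios it allows no
  cancellation, so that quasi-linear bounds on \<open>x\<close> and \<open>z\<close> carry over.\<close>

definition phi :: "real \<Rightarrow> real \<Rightarrow> real" where
  "phi x z = min x z + min 0 (max x z)"

text \<open>Replacing ln (a + b + c) by the logarithm of the largest gap costs at most ln 3 and
  leaves exactly \<open>phi\<close>.\<close>

lemma phi_approx:
  assumes "a > 0" "b > 0" "c > 0"
  shows "\<bar>ln a + ln c - ln b - ln (a + b + c) - phi (ln a - ln b) (ln c - ln b)\<bar> \<le> ln 3"
proof -
  define m where "m = max (max a b) c"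
  have m: "m > 0" "m \<le> a + b + c" "a + b + c \<le> 3 * m" using assms by (auto simp: m_def)
  have "ln m \<le> ln (a + b + c)" using m by (intro ln_mono) auto
  moreover have "ln (a + b + c) \<le> ln (3 * m)" using m assms by (intro ln_mono) auto
  moreover have "ln (3 * m) = ln 3 + ln m" using m by (intro ln_mult_pos) auto
  moreover have "ln m = max (max (ln a) (ln b)) (ln c)"
    unfolding m_def using assms by (auto simp: max_def)
  moreover have "phi (x - y) (z - y) = x + z - y - max (max x y) z" for x y z :: real
    unfolding phi_def by (auto simp: min_def max_def)
  ultimately show ?thesis by (simp only: abs_le_iff) linarith
qed

text \<open>\<open>phi\<close> increases in both arguments and never exceeds the smaller one; for x
  \<le> z it is x if z \<ge> 0 and x + z if z < 0. Bounds for x' and z' therefore pass to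
  \<open>phi\<close>, and the two summands double the constant.\<close>

lemma quasi_linear_phi:
  assumes ab: "0 \<le> \<alpha>" "\<alpha> \<le> \<beta>" and C: "0 \<le> C"
    and x: "quasi_linear \<alpha> \<beta> C x x'" and z: "quasi_linear \<alpha> \<beta> C z z'"
  shows "quasi_linear \<alpha> \<beta> (2 * C) (phi x z) (phi x' z')"
proof -
  have key: "quasi_linear \<alpha> \<beta> (2 * C) (phi x z) (phi x' z')"
    if xz: "x \<le> z" and x: "quasi_linear \<alpha> \<beta> C x x'" and z: "quasi_linear \<alpha> \<beta> C z z'" for x z x' z'
  proof -
    have m: "\<alpha> * x \<le> \<alpha> * z" "\<beta> * x \<le> \<beta> * z" using ab xz by (auto intro: mult_left_mono)
    have s: "0 \<le> y \<Longrightarrow> \<alpha> * y \<le> \<beta> * y" "y \<le> 0 \<Longrightarrow> \<beta> * y \<le> \<alpha> * y"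
      "0 \<le> y \<Longrightarrow> 0 \<le> \<alpha> * y" "y \<le> 0 \<Longrightarrow> \<alpha> * y \<le> 0" for y
      using ab by (auto intro: mult_right_mono mult_right_mono_neg simp: mult_nonneg_nonpos)
    consider "0 \<le> x" | "x < 0" "0 \<le> z" | "z < 0" using xz by linarith
    then show ?thesis
    proof cases
      case 1
      then have p: "phi x z = x" using xz by (auto simp: phi_def)
      have "\<alpha> * x - C \<le> x'" "x' \<le> \<beta> * x + C" "\<alpha> * z - C \<le> z'"
        using 1 xz x z by (auto simp: quasi_linear_def)
      then show ?thesis unfolding p using 1 m(1) s(3)[OF 1] C
        by (intro quasi_linear_nonneg) (auto simp: phi_def min_def max_def)
    next
      case 2
      then have p: "phi x z = x" using xz by (auto simp: phi_def)
      have b: "\<beta> * x - C \<le> x'" "x' \<le> \<alpha> * x + C" "\<alpha> * z - C \<le> z'"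
        using 2 x z by (auto simp: quasi_linear_def)
      have b2: "\<beta> * x \<le> \<alpha> * x" "\<alpha> * x \<le> 0" "0 \<le> \<alpha> * z" using s[of x] s[of z] 2 by auto
      have g: "bx - 2 * C \<le> phi x' z' \<and> phi x' z' \<le> ax + 2 * C"
        if "bx - C \<le> x'" "x' \<le> ax + C" "az - C \<le> z'" "bx \<le> ax" "ax \<le> 0" "0 \<le> az" for ax bx az
        using that C by (auto simp: phi_def min_def max_def)
      show ?thesis unfolding p using g[OF b b2] 2 by (intro quasi_linear_nonpos) auto
    next
      case 3
      then have p: "phi x z = x + z" using xz by (auto simp: phi_def)
      have b: "\<beta> * x - C \<le> x'" "x' \<le> \<alpha> * x + C" "\<beta> * z - C \<le> z'" "z' \<le> \<alpha> * z + C"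
        using 3 xz x z by (auto simp: quasi_linear_def)
      have b2: "\<beta> * z \<le> \<alpha> * z" "\<alpha> * z \<le> 0" using s[of z] 3 by auto
      have g: "bx + bz - 2 * C \<le> phi x' z' \<and> phi x' z' \<le> ax + az + 2 * C"
        if "bx - C \<le> x'" "x' \<le> ax + C" "bz - C \<le> z'" "z' \<le> az + C" "bz \<le> az" "az \<le> 0" "ax \<le> az" "bx \<le> bz" for ax bx az bz
        using that C by (auto simp: phi_def min_def max_def)
      show ?thesis unfolding p using g[OF b b2 m] 3 xz by (intro quasi_linear_nonpos) (auto simp: distrib_left)
    qed
  qed
  show ?thesis
  proof (cases "x \<le> z")
    case True then show ?thesis using key x z by blast
  next
    case False
    then have "quasi_linear \<alpha> \<beta> (2 * C) (phi z x) (phi z' x')" using key z x by simp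
    then show ?thesis by (simp add: phi_def min.commute max.commute)
  qed
qed

text \<open>If x and x1 have different signs, both are at most K in modulus, so exchanging the
  slopes costs no more than \<beta> K.\<close>

lemma quasi_linear_perturb:
  assumes ab: "0 \<le> \<alpha>" "\<alpha> \<le> \<beta>" and q: "quasi_linear \<alpha> \<beta> C x y"
    and x: "\<bar>x1 - x\<bar> \<le> K" and y: "\<bar>y1 - y\<bar> \<le> K"
  shows "quasi_linear \<alpha> \<beta> (C + K + \<beta> * K) x1 y1"
proof -
  have K: "K \<ge> 0" using x by linarith
  have m: "\<alpha> * x \<le> \<alpha> * (x1 + K)" "\<beta> * x \<le> \<beta> * (x1 + K)" "\<alpha> * x1 \<le> \<alpha> * (x + K)" "\<beta> * x1 \<le> \<beta> * (x + K)"
    using ab x by (intro mult_left_mono; linarith)+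
  have aK: "\<alpha> * K \<le> \<beta> * K" using ab K by (intro mult_right_mono)
  have s: "0 \<le> w \<Longrightarrow> \<alpha> * w \<le> \<beta> * w" "w \<le> 0 \<Longrightarrow> \<beta> * w \<le> \<alpha> * w" for w
    using ab by (auto intro: mult_right_mono mult_right_mono_neg)
  show ?thesis
  proof (cases "x1 \<ge> 0")
    case True
    show ?thesis
    proof (rule quasi_linear_nonneg[OF True])
      show "\<alpha> * x1 - (C + K + \<beta> * K) \<le> y1" "y1 \<le> \<beta> * x1 + (C + K + \<beta> * K)"
        using q y m aK s(1)[OF True] s(1)[of x] s(2)[of x] unfolding quasi_linear_def distrib_left abs_le_iff
        by (cases "x \<ge> 0"; linarith)+
    qed
  next
    case False
    then have F: "x1 \<le> 0" by simp
    show ?thesis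
    proof (rule quasi_linear_nonpos[OF F])
      show "\<beta> * x1 - (C + K + \<beta> * K) \<le> y1" "y1 \<le> \<alpha> * x1 + (C + K + \<beta> * K)"
        using q y m aK s(2)[OF F] s(1)[of x] s(2)[of x] unfolding quasi_linear_def distrib_left abs_le_iff
        by (cases "x \<ge> 0"; linarith)+
    qed
  qed
qed

section \<open>Chords against arcs\<close>

definition lnsinc :: "real \<Rightarrow> real" where
  "lnsinc y = (if y = 0 then 0 else ln (sin y / y))"

lemma lnsinc_cont: "continuous_on {0..<pi} lnsinc"
proof -
  have pos: "sin y / y > 0" if "0 < y" "y < pi" for y using sin_gt_zero[OF that] that by simp
  have "isCont (\<lambda>y::real. if y = 0 then 1 else sin y / y) 0"
  proof -
    have "((\<lambda>y::real. sin y / y) \<longlongrightarrow> 1) (at 0)" by real_asymp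
    then have "((\<lambda>y::real. if y = 0 then 1 else sin y / y) \<longlongrightarrow> 1) (at 0)"
      by (rule Lim_transform_eventually) (auto simp: eventually_at_filter)
    then show ?thesis by (simp add: isCont_def)
  qed
  moreover have "isCont (\<lambda>y::real. if y = 0 then 1 else sin y / y) y" if "y \<noteq> 0" for y
  proof -
    have "isCont (\<lambda>y. sin y / y) y" using that by (intro continuous_intros) auto
    moreover have "\<forall>\<^sub>F x in nhds y. (if x = 0 then 1 else sin x / x) = sin x / x"
      using t1_space_nhds[OF that] by eventually_elim auto
    ultimately show ?thesis using isCont_cong by fast
  qed
  ultimately have "continuous_on {0..<pi} (\<lambda>y::real. if y = 0 then 1 else sin y / y)"
    by (intro continuous_at_imp_continuous_on) metis
  then have "continuous_on {0..<pi} (\<lambda>y::real. ln (if y = 0 then 1 else sin y / y))"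
  proof (intro continuous_intros ballI)
    show "(if y = 0 then 1 else sin y / y) \<noteq> 0" if "y \<in> {0..<pi}" for y :: real
      using pos[of y] that by (cases "y = 0") auto
  qed
  moreover have "lnsinc = (\<lambda>y. ln (if y = 0 then 1 else sin y / y))" by (auto simp: lnsinc_def)
  ultimately show ?thesis by (simp only:)
qed

lemma lnsinc_bounded:
  assumes "c > 0" obtains K where "K \<ge> 0" "\<And>y. 0 \<le> y \<Longrightarrow> y \<le> pi - c \<Longrightarrow> \<bar>lnsinc y\<bar> \<le> K"
proof -
  have "continuous_on {0..pi - c} lnsinc" using lnsinc_cont by (rule continuous_on_subset) (use assms in auto)
  then have "bounded (lnsinc ` {0..pi - c})" by (intro compact_imp_bounded compact_continuous_image) auto
  then obtain K where "\<And>y. y \<in> {0..pi - c} \<Longrightarrow> \<bar>lnsinc y\<bar> \<le> K"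
    unfolding bounded_iff by (metis imageI real_norm_def)
  then show ?thesis by (intro that[of "max K 0"]) (auto simp: le_max_iff_disj)
qed

lemma lnsinc_uniform:
  assumes "c > 0" "e > 0"
  obtains d where "d > 0" "\<And>x y. 0 \<le> x \<Longrightarrow> x \<le> pi - c \<Longrightarrow> 0 \<le> y \<Longrightarrow> y \<le> pi - c \<Longrightarrow> \<bar>y - x\<bar> < d \<Longrightarrow> \<bar>lnsinc y - lnsinc x\<bar> < e"
proof -
  have "continuous_on {0..pi - c} lnsinc" using lnsinc_cont by (rule continuous_on_subset) (use assms in auto)
  then have "uniformly_continuous_on {0..pi - c} lnsinc" by (intro compact_uniformly_continuous) auto
  then obtain d where "d > 0" "\<And>x y. x \<in> {0..pi - c} \<Longrightarrow> y \<in> {0..pi - c} \<Longrightarrow> dist y x < d \<Longrightarrow> dist (lnsinc y) (lnsinc x) < e"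
    using assms unfolding uniformly_continuous_on_def by meson
  then show ?thesis by (intro that[of d]) (auto simp: dist_real_def)
qed

definition lsin :: "(real \<Rightarrow> real) \<Rightarrow> real \<Rightarrow> real \<Rightarrow> real" where
  "lsin f u v = ln (sin ((f v - f u) / 2))"

text \<open>The logarithm of the cross ratio of the image quadruple, by the sine formula
  \<open>cr_cis\<close>; \<open>lsin\<close> is the logarithm of half a chord.\<close>

definition lcr :: "(real \<Rightarrow> real) \<Rightarrow> real \<Rightarrow> real \<Rightarrow> real \<Rightarrow> real \<Rightarrow> real" where
  "lcr f t1 t2 t3 t4 = lsin f t1 t2 + lsin f t3 t4 - lsin f t2 t3 - lsin f t1 t4"

definition quad_angles :: "real \<Rightarrow> real \<Rightarrow> real \<Rightarrow> real \<Rightarrow> bool" where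
  "quad_angles t1 t2 t3 t4 \<longleftrightarrow> t1 < t2 \<and> t2 < t3 \<and> t3 < t4 \<and> t4 < t1 + 2 * pi"

lemma quad_angles_rotate: "quad_angles t1 t2 t3 t4 \<Longrightarrow> quad_angles t2 t3 t4 (t1 + 2 * pi)"
  by (auto simp: quad_angles_def)

lemma quad_angles_lift: "circle_lift f \<Longrightarrow> quad_angles t1 t2 t3 t4 \<Longrightarrow> quad_angles (f t1) (f t2) (f t3) (f t4)"
  using lift_less[of f] lift_2pi[of f t1] unfolding quad_angles_def by metis

lemma lsin_2pi: "circle_lift f \<Longrightarrow> lsin f u (v + 2 * pi) = lsin f v u"
proof -
  assume f: "circle_lift f"
  have "(f (v + 2 * pi) - f u) / 2 = pi - (f u - f v) / 2" using lift_2pi[OF f, of v] by (simp add: field_simps)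
  then have "sin ((f (v + 2 * pi) - f u) / 2) = sin ((f u - f v) / 2)" by (simp only: sin_pi_minus)
  then show ?thesis by (simp only: lsin_def)
qed

lemma lcr_rotate: "circle_lift f \<Longrightarrow> lcr f t2 t3 t4 (t1 + 2 * pi) = - lcr f t1 t2 t3 t4"
  by (simp add: lcr_def lsin_2pi)

text \<open>One of the four gaps has length at least \<open>\<pi>/2\<close>; rotate it to the last position.\<close>

lemma quad_wlog:
  assumes base: "\<And>t1 t2 t3 t4. quad_angles t1 t2 t3 t4 \<Longrightarrow> t4 - t1 \<le> 3 * pi / 2 \<Longrightarrow> P t1 t2 t3 t4"
    and rot: "\<And>t1 t2 t3 t4. quad_angles t1 t2 t3 t4 \<Longrightarrow> P t2 t3 t4 (t1 + 2 * pi) \<Longrightarrow> P t1 t2 t3 t4"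
    and q: "quad_angles t1 t2 t3 t4"
  shows "P t1 t2 t3 t4"
proof -
  note q1 = quad_angles_rotate[OF q] note q2 = quad_angles_rotate[OF q1] note q3 = quad_angles_rotate[OF q2]
  consider "t4 - t1 \<le> 3 * pi / 2" | "t1 + 2 * pi - t2 \<le> 3 * pi / 2" | "t2 + 2 * pi - t3 \<le> 3 * pi / 2" | "t3 + 2 * pi - t4 \<le> 3 * pi / 2"
    using q unfolding quad_angles_def by linarith
  then show ?thesis
  proof cases
    case 1 show ?thesis by (rule base[OF q 1])
  next
    case 2 show ?thesis by (rule rot[OF q base[OF q1 2]])
  next
    case 3 show ?thesis by (rule rot[OF q rot[OF q1 base[OF q2]]]) (use 3 in auto)
  next
    case 4 show ?thesis by (rule rot[OF q rot[OF q1 rot[OF q2 base[OF q3]]]]) (use 4 in auto)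
  qed
qed

text \<open>An arc of length at most 3 pi/2 leaves out an arc of length at least pi/2, whose image
  has length bounded below. Half the image of the former thus stays away from pi, where
  \<open>lnsinc\<close> is singular.\<close>

lemma lift_span:
  assumes f: "circle_lift f"
  obtains c where "c > 0" "\<And>u v. v - u \<le> 3 * pi / 2 \<Longrightarrow> (f v - f u) / 2 \<le> pi - c"
proof -
  obtain c where c: "c > 0" "\<And>x y. x + pi / 2 \<le> y \<Longrightarrow> c \<le> f y - f x" using lift_gap[OF f, of "pi / 2"] by auto
  have "(f v - f u) / 2 \<le> pi - c / 2" if "v - u \<le> 3 * pi / 2" for u v
  proof -
    have "c \<le> f (u + 2 * pi) - f v" using that by (intro c(2)) (simp add: field_simps)
    then show ?thesis using lift_2pi[OF f, of u] by simp
  qed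
  then show ?thesis using that[of "c / 2"] c(1) by auto
qed

text \<open>The half chord sin y differs from the half arc y by the factor sin y / y, whose
  logarithm \<open>lnsinc\<close> is continuous on [0, pi) with value 0 at 0.\<close>

lemma lsin_lnsinc:
  assumes f: "circle_lift f" and uv: "u < v" "v < u + 2 * pi"
  shows "lsin f u v = ln (f v - f u) - ln 2 + lnsinc ((f v - f u) / 2)"
proof -
  define y where "y = (f v - f u) / 2"
  have "f u < f v" "f v < f (u + 2 * pi)" using lift_less[OF f] uv by simp_all
  then have y: "y > 0" "y < pi" using lift_2pi[OF f, of u] by (auto simp: y_def)
  have "ln (sin y / y) = ln (sin y) - ln y" using y sin_gt_zero[of y] by (intro ln_divide_pos) auto
  moreover have "ln y = ln (f v - f u) - ln 2" unfolding y_def using y by (intro ln_divide_pos) (auto simp: y_def)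
  ultimately show ?thesis using y unfolding lsin_def lnsinc_def y_def[symmetric] by simp
qed

lemma lcr_approx:
  assumes f: "circle_lift f"
  obtains K where "K \<ge> 0" "\<And>t1 t2 t3 t4. quad_angles t1 t2 t3 t4 \<Longrightarrow> t4 - t1 \<le> 3 * pi / 2 \<Longrightarrow>
    \<bar>lcr f t1 t2 t3 t4 - phi (ln ((f t2 - f t1) / (f t3 - f t2))) (ln ((f t4 - f t3) / (f t3 - f t2)))\<bar> \<le> K"
proof -
  obtain c where c: "c > 0" "\<And>u v. v - u \<le> 3 * pi / 2 \<Longrightarrow> (f v - f u) / 2 \<le> pi - c" using lift_span[OF f] by blast
  obtain K where K: "K \<ge> 0" "\<And>y. 0 \<le> y \<Longrightarrow> y \<le> pi - c \<Longrightarrow> \<bar>lnsinc y\<bar> \<le> K" using lnsinc_bounded[OF c(1)] by blast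
  show ?thesis
  proof (rule that[of "4 * K + ln 3"])
    show "0 \<le> 4 * K + ln 3" using K by simp
    fix t1 t2 t3 t4 assume q: "quad_angles t1 t2 t3 t4" and sp: "t4 - t1 \<le> 3 * pi / 2"
    define a b c' where "a = f t2 - f t1" and "b = f t3 - f t2" and "c' = f t4 - f t3"
    have abc: "a > 0" "b > 0" "c' > 0" unfolding a_def b_def c'_def using lift_less[OF f] q by (auto simp: quad_angles_def)
    have s: "\<bar>lsin f u v - (ln (f v - f u) - ln 2)\<bar> \<le> K" if "u < v" "v - u \<le> 3 * pi / 2" for u v
    proof -
      have "v < u + 2 * pi" using that pi_gt_zero by linarith
      moreover have "f v - f u \<ge> 0" using lift_le[OF f, of u v] that by simp
      ultimately show ?thesis using lsin_lnsinc[OF f that(1)] K(2)[of "(f v - f u) / 2"] c(2)[OF that(2)] by simp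
    qed
    have "\<bar>lsin f t1 t2 - (ln a - ln 2)\<bar> \<le> K" "\<bar>lsin f t2 t3 - (ln b - ln 2)\<bar> \<le> K" "\<bar>lsin f t3 t4 - (ln c' - ln 2)\<bar> \<le> K"
      "\<bar>lsin f t1 t4 - (ln (f t4 - f t1) - ln 2)\<bar> \<le> K"
      unfolding a_def b_def c'_def using q sp by (auto simp: quad_angles_def intro!: s)
    moreover have "f t4 - f t1 = a + b + c'" by (simp add: a_def b_def c'_def)
    moreover have "ln (a / b) = ln a - ln b" "ln (c' / b) = ln c' - ln b" using abc by (auto intro!: ln_divide_pos)
    ultimately show "\<bar>lcr f t1 t2 t3 t4 - phi (ln ((f t2 - f t1) / (f t3 - f t2))) (ln ((f t4 - f t3) / (f t3 - f t2)))\<bar> \<le> 4 * K + ln 3"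
      using phi_approx[OF abc] unfolding lcr_def a_def[symmetric] b_def[symmetric] c'_def[symmetric]
      by (simp only: abs_le_iff) linarith
  qed
qed

text \<open>The slopes are those of \<open>doubling_growth\<close>; passing from ratios to cross
  ratios changes only the additive constant. For C near 1 they are therefore still near 1.\<close>

theorem lcr_quasi_linear:
  assumes f: "circle_lift f" and dbl: "doubling f C t0" and C: "C \<ge> 1" and t0: "0 < t0" "t0 < pi"
  obtains C1 where "C1 \<ge> 0" "\<And>t1 t2 t3 t4. quad_angles t1 t2 t3 t4 \<Longrightarrow>
    quasi_linear (log 2 (1 + 1 / C)) (log 2 (1 + C)) C1 (lcr (\<lambda>x. x) t1 t2 t3 t4) (lcr f t1 t2 t3 t4)"
proof -
  define \<alpha> \<beta> where "\<alpha> = log 2 (1 + 1 / C)" and "\<beta> = log 2 (1 + C)"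
  have "1 / C \<le> 1" using C by simp
  then have "1 / C \<le> C" using C by linarith
  then have ab: "0 \<le> \<alpha>" "\<alpha> \<le> \<beta>" unfolding \<alpha>_def \<beta>_def using C by (auto simp: add_pos_pos)
  obtain C0 where C0: "C0 \<ge> 0" "\<And>u v w. u < v \<Longrightarrow> v < w \<Longrightarrow> w \<le> u + 2 * pi \<Longrightarrow>
    quasi_linear \<alpha> \<beta> C0 (ln ((v - u) / (w - v))) (ln ((f v - f u) / (f w - f v)))"
    using doubling_quasi_linear[OF f dbl C t0] unfolding \<alpha>_def \<beta>_def by blast
  obtain K1 where K1: "K1 \<ge> 0" "\<And>t1 t2 t3 t4. quad_angles t1 t2 t3 t4 \<Longrightarrow> t4 - t1 \<le> 3 * pi / 2 \<Longrightarrow>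
    \<bar>lcr f t1 t2 t3 t4 - phi (ln ((f t2 - f t1) / (f t3 - f t2))) (ln ((f t4 - f t3) / (f t3 - f t2)))\<bar> \<le> K1"
    using lcr_approx[OF f] by blast
  obtain K2 where K2: "K2 \<ge> 0" "\<And>t1 t2 t3 t4. quad_angles t1 t2 t3 t4 \<Longrightarrow> t4 - t1 \<le> 3 * pi / 2 \<Longrightarrow>
    \<bar>lcr (\<lambda>x. x) t1 t2 t3 t4 - phi (ln ((t2 - t1) / (t3 - t2))) (ln ((t4 - t3) / (t3 - t2)))\<bar> \<le> K2"
    using lcr_approx[OF circle_lift_id] by blast
  define K where "K = max K1 K2"
  show ?thesis
  proof (rule that[of "2 * C0 + K + \<beta> * K"])
    show "0 \<le> 2 * C0 + K + \<beta> * K" using C0 K1 ab by (simp add: K_def)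
    show "quasi_linear (log 2 (1 + 1 / C)) (log 2 (1 + C)) (2 * C0 + K + \<beta> * K) (lcr (\<lambda>x. x) t1 t2 t3 t4) (lcr f t1 t2 t3 t4)"
      if "quad_angles t1 t2 t3 t4" for t1 t2 t3 t4
      using that unfolding \<alpha>_def[symmetric] \<beta>_def[symmetric]
    proof (rule quad_wlog[rotated 2])
      fix t1 t2 t3 t4 :: real assume q: "quad_angles t1 t2 t3 t4" and sp: "t4 - t1 \<le> 3 * pi / 2"
      note t = q[unfolded quad_angles_def]
      have a: "quasi_linear \<alpha> \<beta> C0 (ln ((t2 - t1) / (t3 - t2))) (ln ((f t2 - f t1) / (f t3 - f t2)))"
        using t by (intro C0(2)) auto
      have fl: "f t1 < f t2" "f t2 < f t3" "f t3 < f t4" using lift_less[OF f] t by auto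
      have "quasi_linear \<alpha> \<beta> C0 (ln ((t3 - t2) / (t4 - t3))) (ln ((f t3 - f t2) / (f t4 - f t3)))"
        using t by (intro C0(2)) auto
      moreover have "ln ((t3 - t2) / (t4 - t3)) = - ln ((t4 - t3) / (t3 - t2))"
         "ln ((f t3 - f t2) / (f t4 - f t3)) = - ln ((f t4 - f t3) / (f t3 - f t2))"
        using t fl by (auto simp: ln_divide_pos)
      ultimately have b: "quasi_linear \<alpha> \<beta> C0 (ln ((t4 - t3) / (t3 - t2))) (ln ((f t4 - f t3) / (f t3 - f t2)))"
        using quasi_linear_uminus by metis
      show "quasi_linear \<alpha> \<beta> (2 * C0 + K + \<beta> * K) (lcr (\<lambda>x. x) t1 t2 t3 t4) (lcr f t1 t2 t3 t4)"
        by (rule quasi_linear_perturb[OF ab quasi_linear_phi[OF ab C0(1) a b]])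
          (use K1(2)[OF q sp] K2(2)[OF q sp] in \<open>auto simp: K_def\<close>)
    next
      fix t1 t2 t3 t4 :: real
      assume "quasi_linear \<alpha> \<beta> (2 * C0 + K + \<beta> * K) (lcr (\<lambda>x. x) t2 t3 t4 (t1 + 2 * pi)) (lcr f t2 t3 t4 (t1 + 2 * pi))"
      then show "quasi_linear \<alpha> \<beta> (2 * C0 + K + \<beta> * K) (lcr (\<lambda>x. x) t1 t2 t3 t4) (lcr f t1 t2 t3 t4)"
        unfolding lcr_rotate[OF f] lcr_rotate[OF circle_lift_id] quasi_linear_uminus .
    qed
  qed
qed

section \<open>Asymptotic comparison of two lifts\<close>

definition lratio :: "(real \<Rightarrow> real) \<Rightarrow> real \<Rightarrow> real \<Rightarrow> real \<Rightarrow> real" where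
  "lratio f u v w = ln ((f v - f u) / (f w - f v))"

definition same_asymptotics :: "(real \<Rightarrow> real) \<Rightarrow> (real \<Rightarrow> real) \<Rightarrow> bool" where
  "same_asymptotics f g \<longleftrightarrow> (\<forall>e>0. \<exists>d>0. \<forall>x t. 0 < t \<and> t < d \<longrightarrow>
     \<bar>lratio g (x - t) x (x + t) - lratio f (x - t) x (x + t)\<bar> < e)"

text \<open>The logarithm of the quotient of the increments of g and f. Its differences over
  adjacent intervals are differences of \<open>lratio\<close>.\<close>

definition lquot :: "(real \<Rightarrow> real) \<Rightarrow> (real \<Rightarrow> real) \<Rightarrow> real \<Rightarrow> real \<Rightarrow> real" where
  "lquot f g u v = ln (g v - g u) - ln (f v - f u)"

lemma lratio_eq: "circle_lift f \<Longrightarrow> u < v \<Longrightarrow> v < w \<Longrightarrow> lratio f u v w = ln (f v - f u) - ln (f w - f v)"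
  unfolding lratio_def using lift_less[of f] by (intro ln_divide_pos) auto

lemma lratio_reflect: "circle_lift f \<Longrightarrow> u < v \<Longrightarrow> v < w \<Longrightarrow> lratio (\<lambda>x. - f (- x)) u v w = - lratio f (- w) (- v) (- u)"
  using lratio_eq[OF circle_lift_reflect, of f u v w] lratio_eq[of f "-w" "-v" "-u"] by simp

lemma same_asymptotics_reflect:
  assumes "circle_lift f" "circle_lift g" "same_asymptotics f g"
  shows "same_asymptotics (\<lambda>x. - f (- x)) (\<lambda>x. - g (- x))"
  unfolding same_asymptotics_def
proof (intro allI impI)
  fix e :: real assume "e > 0"
  then obtain d where d: "d > 0" "\<And>x t. 0 < t \<and> t < d \<Longrightarrow> \<bar>lratio g (x - t) x (x + t) - lratio f (x - t) x (x + t)\<bar> < e"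
    using assms(3) unfolding same_asymptotics_def by blast
  have "\<bar>lratio (\<lambda>x. - g (- x)) (x - t) x (x + t) - lratio (\<lambda>x. - f (- x)) (x - t) x (x + t)\<bar> < e"
    if "0 < t \<and> t < d" for x t
    using d(2)[OF that, of "- x"] lratio_reflect[OF assms(1), of "x - t" x "x + t"]
      lratio_reflect[OF assms(2), of "x - t" x "x + t"] that by (simp add: abs_minus_commute)
  then show "\<exists>d>0. \<forall>x t. 0 < t \<and> t < d \<longrightarrow>
    \<bar>lratio (\<lambda>x. - g (- x)) (x - t) x (x + t) - lratio (\<lambda>x. - f (- x)) (x - t) x (x + t)\<bar> < e"
    using d(1) by blast
qed

section \<open>Subdivision of adjacent intervals\<close>

definition bounded_distortion :: "(real \<Rightarrow> real) \<Rightarrow> real \<Rightarrow> real \<Rightarrow> real \<Rightarrow> bool" where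
  "bounded_distortion f \<alpha> \<beta> C \<longleftrightarrow> circle_lift f \<and> 0 < \<alpha> \<and> \<alpha> \<le> \<beta> \<and> 0 \<le> C \<and>
    (\<forall>u v w. u < v \<and> v < w \<and> w \<le> u + 2 * pi \<longrightarrow> quasi_linear \<alpha> \<beta> C (ln ((v - u) / (w - v))) (lratio f u v w))"

lemma bounded_distortion_reflect:
  assumes "bounded_distortion f \<alpha> \<beta> C" shows "bounded_distortion (\<lambda>x. - f (- x)) \<alpha> \<beta> C"
proof -
  have f: "circle_lift f" and b: "\<And>u v w. u < v \<and> v < w \<and> w \<le> u + 2 * pi \<Longrightarrow> quasi_linear \<alpha> \<beta> C (ln ((v - u) / (w - v))) (lratio f u v w)"
    using assms by (auto simp: bounded_distortion_def)
  have "quasi_linear \<alpha> \<beta> C (ln ((v - u) / (w - v))) (lratio (\<lambda>x. - f (- x)) u v w)"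
    if t: "u < v" "v < w" "w \<le> u + 2 * pi" for u v w
  proof -
    have "quasi_linear \<alpha> \<beta> C (ln ((- v - - w) / (- u - - v))) (lratio f (- w) (- v) (- u))"
      using t by (intro b) auto
    moreover have "ln ((- v - - w) / (- u - - v)) = - ln ((v - u) / (w - v))" using t by (simp add: ln_divide_pos)
    ultimately have "quasi_linear \<alpha> \<beta> C (- ln ((v - u) / (w - v))) (- lratio (\<lambda>x. - f (- x)) u v w)"
      using lratio_reflect[OF f t(1,2)] by simp
    then show ?thesis by (simp only: quasi_linear_uminus)
  qed
  then show ?thesis using assms circle_lift_reflect[OF f] by (auto simp: bounded_distortion_def)
qed

lemma doubling_bounded_distortion:
  assumes "circle_lift f" "doubling f C t0" "C \<ge> 1" "0 < t0" "t0 < pi"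
  obtains C0 where "bounded_distortion f (log 2 (1 + 1 / C)) (log 2 (1 + C)) C0"
proof -
  have "1 / C \<le> 1" using assms by simp
  then have "1 / C \<le> C" using assms by linarith
  then have "0 < log 2 (1 + 1 / C)" "log 2 (1 + 1 / C) \<le> log 2 (1 + C)" using assms by (auto simp: add_pos_pos)
  moreover obtain C0 where "C0 \<ge> 0" "\<And>u v w. u < v \<Longrightarrow> v < w \<Longrightarrow> w \<le> u + 2 * pi \<Longrightarrow>
    quasi_linear (log 2 (1 + 1 / C)) (log 2 (1 + C)) C0 (ln ((v - u) / (w - v))) (ln ((f v - f u) / (f w - f v)))"
    using doubling_quasi_linear[OF assms] by blast
  ultimately have "bounded_distortion f (log 2 (1 + 1 / C)) (log 2 (1 + C)) C0"
    using assms(1) by (simp only: bounded_distortion_def lratio_def) blast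
  then show ?thesis by (rule that)
qed

text \<open>The increment over n cells exceeds that over the next one by a factor at least exp
  (\<alpha> ln n - C), which passes 1/e for large n, uniformly in position and cell length.\<close>

lemma bounded_distortion_cell:
  assumes b: "bounded_distortion f \<alpha> \<beta> C" and e: "e > 0"
  obtains N where "N \<ge> 1" "\<And>n v t. n \<ge> N \<Longrightarrow> 0 < t \<Longrightarrow> real (n + 1) * t \<le> 2 * pi \<Longrightarrow>
    f (v + real (n + 1) * t) - f (v + real n * t) \<le> e * (f (v + real n * t) - f v)"
proof -
  have a: "\<alpha> > 0" and f: "circle_lift f" using b by (auto simp: bounded_distortion_def)
  have B: "quasi_linear \<alpha> \<beta> C (ln ((v - u) / (w - v))) (lratio f u v w)" if "u < v" "v < w" "w \<le> u + 2 * pi" for u v w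
    using b that unfolding bounded_distortion_def by blast
  \<comment> \<open>Solves \<alpha> ln M - C = - ln e.\<close>
  define M where "M = exp ((C - ln e) / \<alpha>)"
  obtain N0 :: nat where N0: "real N0 \<ge> M" using real_arch_simple by blast
  have "f (v + real (n + 1) * t) - f (v + real n * t) \<le> e * (f (v + real n * t) - f v)"
    if n: "n \<ge> max N0 1" and t: "0 < t" "real (n + 1) * t \<le> 2 * pi" for n v t
  proof -
    have n1: "real n \<ge> 1" "real n \<ge> M" using n N0 by (auto simp: max_def split: if_splits)
    have o: "v < v + real n * t" "v + real n * t < v + real (n + 1) * t" using n1 t by (auto simp: algebra_simps)
    have "((v + real n * t) - v) / ((v + real (n + 1) * t) - (v + real n * t)) = real n" using t by (simp add: field_simps)
    moreover have "quasi_linear \<alpha> \<beta> C (ln (((v + real n * t) - v) / ((v + real (n + 1) * t) - (v + real n * t))))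
        (lratio f v (v + real n * t) (v + real (n + 1) * t))"
    proof (rule B[OF o])
      show "v + real (n + 1) * t \<le> v + 2 * pi" using t(2) by linarith
    qed
    ultimately have q: "quasi_linear \<alpha> \<beta> C (ln (real n)) (lratio f v (v + real n * t) (v + real (n + 1) * t))"
      by (simp only:)
    have "ln (real n) \<ge> 0" using n1 by simp
    then have "\<alpha> * ln (real n) - C \<le> lratio f v (v + real n * t) (v + real (n + 1) * t)"
      using q by (simp add: quasi_linear_def)
    moreover have "\<alpha> * ln (real n) \<ge> C - ln e"
    proof -
      have "ln M \<le> ln (real n)" using n1 by (intro ln_mono) (auto simp: M_def)
      then have "(C - ln e) / \<alpha> \<le> ln (real n)" by (simp add: M_def)
      then show ?thesis using a by (simp add: divide_le_eq mult.commute)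
    qed
    ultimately have "- ln e \<le> ln (f (v + real n * t) - f v) - ln (f (v + real (n + 1) * t) - f (v + real n * t))"
      unfolding lratio_eq[OF f o] by linarith
    then have l: "ln (f (v + real (n + 1) * t) - f (v + real n * t)) \<le> ln (e * (f (v + real n * t) - f v))"
      using e lift_less[OF f] o by (simp add: ln_mult_pos)
    have p: "f (v + real (n + 1) * t) - f (v + real n * t) > 0" "e * (f (v + real n * t) - f v) > 0"
      using e lift_less[OF f] o by auto
    show ?thesis using l ln_le_cancel_iff[OF p] by blast
  qed
  then show ?thesis using that[of "max N0 1"] by auto
qed

text \<open>The mediant inequality: the increments of g on both intervals lie between exp (r - K)
  and exp (r + K) times those of f, and such bounds add up.\<close>

lemma lquot_sum:
  assumes f: "circle_lift f" and g: "circle_lift g" and "u < v" "v < w"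
    and "\<bar>lquot f g u v - r\<bar> \<le> K" "\<bar>lquot f g v w - r\<bar> \<le> K"
  shows "\<bar>lquot f g u w - r\<bar> \<le> K"
proof -
  have iff: "\<bar>lquot f g x y - r\<bar> \<le> K \<longleftrightarrow> g y - g x \<le> exp (r + K) * (f y - f x) \<and> exp (r - K) * (f y - f x) \<le> g y - g x" if "x < y" for x y
  proof -
    have p: "g y - g x > 0" "f y - f x > 0" using lift_less[OF f] lift_less[OF g] that by auto
    have "ln (g y - g x) \<le> r + K + ln (f y - f x) \<longleftrightarrow> ln (g y - g x) \<le> ln (exp (r + K) * (f y - f x))"
      using p by (simp add: ln_mult_pos)
    also have "\<dots> \<longleftrightarrow> g y - g x \<le> exp (r + K) * (f y - f x)" using p by (intro ln_le_cancel_iff) auto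
    finally have 1: "ln (g y - g x) \<le> r + K + ln (f y - f x) \<longleftrightarrow> g y - g x \<le> exp (r + K) * (f y - f x)" .
    have "r - K + ln (f y - f x) \<le> ln (g y - g x) \<longleftrightarrow> ln (exp (r - K) * (f y - f x)) \<le> ln (g y - g x)"
      using p by (simp add: ln_mult_pos)
    also have "\<dots> \<longleftrightarrow> exp (r - K) * (f y - f x) \<le> g y - g x" using p by (intro ln_le_cancel_iff) auto
    finally have 2: "r - K + ln (f y - f x) \<le> ln (g y - g x) \<longleftrightarrow> exp (r - K) * (f y - f x) \<le> g y - g x" .
    show ?thesis unfolding 1[symmetric] 2[symmetric] lquot_def abs_le_iff by (simp add: algebra_simps conj_commute)
  qed
  have uw: "u < w" using assms by simp
  have "g v - g u \<le> exp (r + K) * (f v - f u)" "exp (r - K) * (f v - f u) \<le> g v - g u"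
    "g w - g v \<le> exp (r + K) * (f w - f v)" "exp (r - K) * (f w - f v) \<le> g w - g v"
    using assms(5,6) iff[OF assms(3)] iff[OF assms(4)] by auto
  then show ?thesis unfolding iff[OF uw] by (simp add: algebra_simps)
qed

text \<open>From cell to cell \<open>lquot\<close> moves by at most K, so the i-th cell, counted
  from 0, is within i K of the first, and \<open>lquot_sum\<close> passes such a bound to the
  union.\<close>

lemma lquot_row:
  assumes f: "circle_lift f" and g: "circle_lift g" and t: "0 < t" and K: "K \<ge> 0"
    and step: "\<And>x. \<bar>lratio g (x - t) x (x + t) - lratio f (x - t) x (x + t)\<bar> \<le> K"
  shows "n \<ge> 1 \<Longrightarrow> \<bar>lquot f g v (v + real n * t) - lquot f g v (v + t)\<bar> \<le> real n * K"
proof -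
  have cell: "\<bar>lquot f g (v + real i * t) (v + real (Suc i) * t) - lquot f g v (v + t)\<bar> \<le> real i * K" for i
  proof (induction i)
    case (Suc i)
    define x where "x = v + real (Suc i) * t"
    have e: "x - t = v + real i * t" "x + t = v + real (Suc (Suc i)) * t" by (auto simp: x_def algebra_simps)
    have "\<bar>lquot f g (x - t) x - lquot f g x (x + t)\<bar> \<le> K"
      using step[of x] lratio_eq[OF f, of "x - t" x "x + t"] lratio_eq[OF g, of "x - t" x "x + t"] t
      unfolding lquot_def by simp
    then show ?case using Suc unfolding e unfolding x_def[symmetric] by (simp add: distrib_right)
  qed simp
  show "n \<ge> 1 \<Longrightarrow> \<bar>lquot f g v (v + real n * t) - lquot f g v (v + t)\<bar> \<le> real n * K"
  proof (induction n rule: nat_induct_at_least)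
    case base
    then show ?case using K by simp
  next
    case (Suc n)
    have o: "v < v + real n * t" "v + real n * t < v + real (Suc n) * t" using Suc.hyps t by (auto simp: algebra_simps)
    have "real n * K \<le> real (Suc n) * K" using K by (simp add: distrib_right)
    then have ab: "\<bar>lquot f g v (v + real n * t) - lquot f g v (v + t)\<bar> \<le> real (Suc n) * K"
      "\<bar>lquot f g (v + real n * t) (v + real (Suc n) * t) - lquot f g v (v + t)\<bar> \<le> real (Suc n) * K"
      using Suc.IH cell[of n] by linarith+
    show ?case by (rule lquot_sum[OF f g o ab])
  qed
qed

text \<open>The order of the choices matters: N, independent of M, makes the remainder beyond the
  last full cell negligible; the scale d depends in addition on the upper bound M for the number of
  cells, over which errors accumulate.\<close>

lemma lquot_right:
  assumes bf: "bounded_distortion f \<alpha>1 \<beta>1 C1" and bg: "bounded_distortion g \<alpha>2 \<beta>2 C2"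
    and s: "same_asymptotics f g" and e: "e > 0"
  obtains N where "N \<ge> 1" "\<And>M. \<exists>d>0. \<forall>v w t n. 0 < t \<and> t < d \<and> N \<le> n \<and> n \<le> M \<and> real n * t \<le> w - v \<and> w - v \<le> real (n + 1) * t
     \<longrightarrow> \<bar>lquot f g v w - lquot f g v (v + t)\<bar> < e"
proof -
  have f: "circle_lift f" and g: "circle_lift g" using bf bg by (auto simp: bounded_distortion_def)
  have e4: "e / 4 > 0" using e by simp
  obtain N1 where N1: "N1 \<ge> 1" "\<And>n v t. n \<ge> N1 \<Longrightarrow> 0 < t \<Longrightarrow> real (n + 1) * t \<le> 2 * pi \<Longrightarrow>
    f (v + real (n + 1) * t) - f (v + real n * t) \<le> (e / 4) * (f (v + real n * t) - f v)"
    using bounded_distortion_cell[OF bf e4] by blast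
  obtain N2 where N2: "N2 \<ge> 1" "\<And>n v t. n \<ge> N2 \<Longrightarrow> 0 < t \<Longrightarrow> real (n + 1) * t \<le> 2 * pi \<Longrightarrow>
    g (v + real (n + 1) * t) - g (v + real n * t) \<le> (e / 4) * (g (v + real n * t) - g v)"
    using bounded_distortion_cell[OF bg e4] by blast
  define N where "N = max N1 N2"
  have tail: "ln (h (v + real n * t) - h v) \<le> ln (h w - h v) \<and> ln (h w - h v) \<le> ln (h (v + real n * t) - h v) + e / 4"
    if h: "circle_lift h" and c: "h (v + real (n + 1) * t) - h (v + real n * t) \<le> (e / 4) * (h (v + real n * t) - h v)"
      and n: "0 < real n * t" and w: "real n * t \<le> w - v" "w - v \<le> real (n + 1) * t" for h v w n t
  proof -
    have m: "h v < h (v + real n * t)" "h (v + real n * t) \<le> h w" "h w \<le> h (v + real (n + 1) * t)"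
      using lift_less[OF h] lift_le[OF h] n w by auto
    have "h w - h v \<le> (1 + e / 4) * (h (v + real n * t) - h v)" using c m by (simp add: algebra_simps)
    also have "\<dots> \<le> exp (e / 4) * (h (v + real n * t) - h v)"
      using m exp_ge_add_one_self[of "e / 4"] by (intro mult_right_mono) auto
    finally have "ln (h w - h v) \<le> ln (exp (e / 4) * (h (v + real n * t) - h v))" using m by (intro ln_mono) auto
    also have "\<dots> = e / 4 + ln (h (v + real n * t) - h v)" using m by (simp add: ln_mult_pos)
    finally show ?thesis using m by simp
  qed
  have "\<exists>d>0. \<forall>v w t n. 0 < t \<and> t < d \<and> N \<le> n \<and> n \<le> M \<and> real n * t \<le> w - v \<and> w - v \<le> real (n + 1) * t
     \<longrightarrow> \<bar>lquot f g v w - lquot f g v (v + t)\<bar> < e" for M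
  proof -
    \<comment> \<open>At most M errors of size K stay below e/4; two further quarters go to the
      remainders of f and of g.\<close>
    define K where "K = e / (4 * real (M + 1))"
    have K: "K > 0" using e by (simp add: K_def)
    obtain d where d: "d > 0" "\<And>x t. 0 < t \<and> t < d \<Longrightarrow> \<bar>lratio g (x - t) x (x + t) - lratio f (x - t) x (x + t)\<bar> < K"
      using s K unfolding same_asymptotics_def by blast
    have "\<bar>lquot f g v w - lquot f g v (v + t)\<bar> < e"
      if t: "0 < t" "t < min d (2 * pi / real (M + 1))" and n: "N \<le> n" "n \<le> M"
        and w: "real n * t \<le> w - v" "w - v \<le> real (n + 1) * t" for v w t n
    proof -
      have n1: "n \<ge> 1" "n \<ge> N1" "n \<ge> N2" using n N1 by (auto simp: N_def)
      have nt: "0 < real n * t" using n1 t by simp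
      have "real (n + 1) * t \<le> real (M + 1) * t" using n t by (intro mult_right_mono) auto
      also have "\<dots> \<le> 2 * pi" using t(2) by (simp add: less_divide_eq mult.commute)
      finally have big: "real (n + 1) * t \<le> 2 * pi" .
      have row: "\<bar>lquot f g v (v + real n * t) - lquot f g v (v + t)\<bar> \<le> real n * K"
        using d(2) t K by (intro lquot_row[OF f g t(1) _ _ n1(1)]) (auto intro: less_imp_le)
      have "real n * K \<le> real (M + 1) * K" using n K by (intro mult_right_mono) auto
      also have "\<dots> = e / 4" unfolding K_def by (simp add: field_simps)
      finally have "\<bar>lquot f g v (v + real n * t) - lquot f g v (v + t)\<bar> \<le> e / 4" using row by simp
      moreover note tail[OF f N1(2)[OF n1(2) t(1) big] nt w] tail[OF g N2(2)[OF n1(3) t(1) big] nt w]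
      ultimately show ?thesis using e unfolding lquot_def abs_le_iff abs_less_iff by linarith
    qed
    moreover have "0 < min d (2 * pi / real (M + 1))" using d(1) by simp
    ultimately show ?thesis by blast
  qed
  then show ?thesis using that[of N] N1(1) by (auto simp: N_def)
qed

text \<open>Subdivide both intervals into cells of equal small length. The quotient of the increments of
  the two lifts changes little from cell to cell, and the incomplete last cell is negligible.\<close>

theorem lratio_asymptotics:
  assumes bf: "bounded_distortion f \<alpha>1 \<beta>1 C1" and bg: "bounded_distortion g \<alpha>2 \<beta>2 C2"
    and s: "same_asymptotics f g" and e: "e > 0"
  obtains d where "d > 0" "\<And>u v w. u < v \<Longrightarrow> v < w \<Longrightarrow> w - u < d \<Longrightarrow> \<bar>ln ((v - u) / (w - v))\<bar> \<le> L \<Longrightarrow>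
    \<bar>lratio g u v w - lratio f u v w\<bar> < e"
proof -
  have f: "circle_lift f" and g: "circle_lift g" using bf bg by (auto simp: bounded_distortion_def)
  have e3: "e / 3 > 0" using e by simp
  obtain N1 where N1: "N1 \<ge> 1" "\<And>M. \<exists>d>0. \<forall>v w t n. 0 < t \<and> t < d \<and> N1 \<le> n \<and> n \<le> M \<and> real n * t \<le> w - v \<and> w - v \<le> real (n + 1) * t
     \<longrightarrow> \<bar>lquot f g v w - lquot f g v (v + t)\<bar> < e / 3" using lquot_right[OF bf bg s e3] by blast
  \<comment> \<open>Reflection turns the interval to the left of v into one to the right of -v, so
    \<open>lquot_right\<close> is used once for each side.\<close>
  obtain N2 where N2: "N2 \<ge> 1" "\<And>M. \<exists>d>0. \<forall>v w t n. 0 < t \<and> t < d \<and> N2 \<le> n \<and> n \<le> M \<and> real n * t \<le> w - v \<and> w - v \<le> real (n + 1) * t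
     \<longrightarrow> \<bar>lquot (\<lambda>x. - f (- x)) (\<lambda>x. - g (- x)) v w - lquot (\<lambda>x. - f (- x)) (\<lambda>x. - g (- x)) v (v + t)\<bar> < e / 3"
    using lquot_right[OF bounded_distortion_reflect[OF bf] bounded_distortion_reflect[OF bg] same_asymptotics_reflect[OF f g s] e3] by blast
  define N where "N = max N1 N2"
  have N: "N \<ge> 1" "N \<ge> N1" "N \<ge> N2" using N1 by (auto simp: N_def)
  \<comment> \<open>The longer interval is at most exp L times the shorter one, which will consist
    of N cells.\<close>
  define M where "M = nat \<lceil>exp L * real N\<rceil> + 1"
  have M: "exp L * real N \<le> real M" unfolding M_def by linarith
  obtain d1 where d1: "d1 > 0" "\<And>v w t n. 0 < t \<Longrightarrow> t < d1 \<Longrightarrow> N1 \<le> n \<Longrightarrow> n \<le> M \<Longrightarrow> real n * t \<le> w - v \<Longrightarrow> w - v \<le> real (n + 1) * t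
     \<Longrightarrow> \<bar>lquot f g v w - lquot f g v (v + t)\<bar> < e / 3" using N1(2)[of M] by blast
  obtain d2 where d2: "d2 > 0" "\<And>v w t n. 0 < t \<Longrightarrow> t < d2 \<Longrightarrow> N2 \<le> n \<Longrightarrow> n \<le> M \<Longrightarrow> real n * t \<le> w - v \<Longrightarrow> w - v \<le> real (n + 1) * t
     \<Longrightarrow> \<bar>lquot (\<lambda>x. - f (- x)) (\<lambda>x. - g (- x)) v w - lquot (\<lambda>x. - f (- x)) (\<lambda>x. - g (- x)) v (v + t)\<bar> < e / 3"
    using N2(2)[of M] by blast
  obtain d3 where d3: "d3 > 0" "\<And>x t. 0 < t \<and> t < d3 \<Longrightarrow> \<bar>lratio g (x - t) x (x + t) - lratio f (x - t) x (x + t)\<bar> < e / 3"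
    using s e3 unfolding same_asymptotics_def by blast
  have "\<bar>lratio g u v w - lratio f u v w\<bar> < e"
    if uvw: "u < v" "v < w" "w - u < min d1 (min d2 d3)" and L: "\<bar>ln ((v - u) / (w - v))\<bar> \<le> L" for u v w
  proof -
    define a b where "a = v - u" and "b = w - v"
    have ab: "a > 0" "b > 0" using uvw by (auto simp: a_def b_def)
    define m where "m = min a b"
    define t where "t = m / real N"
    have m: "m > 0" "m \<le> a" "m \<le> b" using ab by (auto simp: m_def)
    have t: "t > 0" "t \<le> m" "m = real N * t" using m N by (auto simp: t_def divide_le_eq)
    have td: "t < d1" "t < d2" "t < d3"
    proof -
      have "w - u < d1" "w - u < d2" "w - u < d3" using uvw by auto
      then show "t < d1" "t < d2" "t < d3" using t(2) m ab unfolding a_def b_def by linarith+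
    qed
    have "ln a - ln b \<le> L" "ln b - ln a \<le> L" using L ab unfolding a_def[symmetric] b_def[symmetric] by (auto simp: ln_divide_pos)
    then have "ln a \<le> ln (exp L * b)" "ln b \<le> ln (exp L * a)" "0 \<le> L" using ab by (auto simp: ln_mult_pos)
    then have "a \<le> exp L * b" "b \<le> exp L * a" "1 \<le> exp L" using ab by (auto simp: ln_le_cancel_iff mult_pos_pos)
    moreover have "1 * a \<le> exp L * a" "1 * b \<le> exp L * b" using \<open>1 \<le> exp L\<close> ab by (intro mult_right_mono; simp)+
    ultimately have "a \<le> exp L * m" "b \<le> exp L * m" by (auto simp: m_def min_def)
    then have abM: "a \<le> real M * t" "b \<le> real M * t"

    proof -
      have "exp L * m \<le> real M * t" using mult_right_mono[OF M, of t] t by (simp add: mult.assoc)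
      then show "a \<le> real M * t" "b \<le> real M * t" using \<open>a \<le> exp L * m\<close> \<open>b \<le> exp L * m\<close> by linarith+
    qed
    have ex: "\<exists>n. N \<le> n \<and> n \<le> M \<and> real n * t \<le> x \<and> x \<le> real (n + 1) * t" if x: "m \<le> x" "x \<le> real M * t" for x
    proof (intro exI conjI)
      define n where "n = nat \<lfloor>x / t\<rfloor>"
      have "real N \<le> x / t" using x t by (simp add: le_divide_eq)
      then show "N \<le> nat \<lfloor>x / t\<rfloor>" by linarith
      have xt: "x / t \<ge> 0" using x(1) m(1) t(1) by (intro divide_nonneg_nonneg) linarith+
      have "x / t \<le> real M" using x t by (simp add: divide_le_eq)
      then show "nat \<lfloor>x / t\<rfloor> \<le> M" by linarith
      have "real (nat \<lfloor>x / t\<rfloor>) \<le> x / t" "x / t \<le> real (nat \<lfloor>x / t\<rfloor> + 1)" using xt by linarith+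
      then show "real (nat \<lfloor>x / t\<rfloor>) * t \<le> x" "x \<le> real (nat \<lfloor>x / t\<rfloor> + 1) * t"
        using t by (simp_all add: le_divide_eq divide_le_eq)
    qed
    obtain n1 where n1: "N \<le> n1" "n1 \<le> M" "real n1 * t \<le> b" "b \<le> real (n1 + 1) * t" using ex[of b] m abM by blast
    obtain n2 where n2: "N \<le> n2" "n2 \<le> M" "real n2 * t \<le> a" "a \<le> real (n2 + 1) * t" using ex[of a] m abM by blast
    have r: "\<bar>lquot f g v w - lquot f g v (v + t)\<bar> < e / 3"
      using n1 N t td by (intro d1(2)[of t n1]) (auto simp: b_def)
    have l: "\<bar>lquot (\<lambda>x. - f (- x)) (\<lambda>x. - g (- x)) (- v) (- u) - lquot (\<lambda>x. - f (- x)) (\<lambda>x. - g (- x)) (- v) (- v + t)\<bar> < e / 3"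
      using n2 N t td by (intro d2(2)[of t n2]) (auto simp: a_def)
    have l': "\<bar>lquot f g u v - lquot f g (v - t) v\<bar> < e / 3"
      using l by (simp add: lquot_def)
    have c: "\<bar>lquot f g (v - t) v - lquot f g v (v + t)\<bar> < e / 3"
    proof -
      have "v - t < v" "v < v + t" using t by auto
      note eq = lratio_eq[OF f this] lratio_eq[OF g this]
      have "\<bar>lratio g (v - t) v (v + t) - lratio f (v - t) v (v + t)\<bar> < e / 3" using d3(2) td t by blast
      then show ?thesis unfolding lquot_def eq abs_less_iff by linarith
    qed
    have "lratio g u v w - lratio f u v w = lquot f g u v - lquot f g v w"
      unfolding lratio_eq[OF f uvw(1,2)] lratio_eq[OF g uvw(1,2)] lquot_def by simp
    then show ?thesis using r l' c unfolding abs_less_iff by linarith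
  qed
  then show ?thesis using that[of "min d1 (min d2 d3)"] d1 d2 d3 by auto
qed

section \<open>Logarithmic cross ratios of small quadruples\<close>

definition mingap :: "real \<Rightarrow> real \<Rightarrow> real \<Rightarrow> real \<Rightarrow> real" where
  "mingap t1 t2 t3 t4 = min (min (t2 - t1) (t3 - t2)) (min (t4 - t3) (t1 + 2 * pi - t4))"

lemma mingap_rotate: "mingap t2 t3 t4 (t1 + 2 * pi) = mingap t1 t2 t3 t4"
  by (auto simp: mingap_def min_def)

text \<open>For r the logarithm of the ratio of two adjacent intervals, \<open>softplus r\<close> is
  the logarithm of their total length over the second. It is 1-Lipschitz and at most exp r, so
  errors in r are not amplified and very negative r contribute almost nothing.\<close>

definition softplus :: "real \<Rightarrow> real" where "softplus x = ln (1 + exp x)"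

lemma softplus_pos: "softplus x > 0"
  unfolding softplus_def by (intro ln_gt_zero) simp

lemma softplus_le_exp: "softplus x \<le> exp x"
  unfolding softplus_def by (rule ln_add_one_self_le_self) simp

lemma softplus_Lipschitz: "\<bar>softplus x - softplus y\<bar> \<le> \<bar>x - y\<bar>"
proof -
  have *: "softplus y \<le> softplus x" "softplus x - softplus y \<le> x - y" if "y \<le> x" for x y
  proof -
    show "softplus y \<le> softplus x" unfolding softplus_def using that by (intro ln_mono) (auto simp: add_pos_pos)
    have "1 + exp x \<le> exp (x - y) * (1 + exp y)" using that by (simp add: distrib_left flip: exp_add)
    then have "ln (1 + exp x) \<le> ln (exp (x - y) * (1 + exp y))" by (intro ln_mono) (auto simp: add_pos_pos)
    also have "\<dots> = (x - y) + ln (1 + exp y)" by (subst ln_mult_pos) (auto simp: add_pos_pos)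
    finally show "softplus x - softplus y \<le> x - y" by (simp add: softplus_def)
  qed
  show ?thesis using *[of x y] *[of y x] by (cases "y \<le> x") auto
qed

lemma lratio_softplus:
  assumes "circle_lift f" "u < v" "v < w"
  shows "ln (f w - f v) - ln (f w - f u) = - softplus (lratio f u v w)"
proof -
  have p: "f v - f u > 0" "f w - f v > 0" using lift_less[OF assms(1)] assms by auto
  have "exp (lratio f u v w) = (f v - f u) / (f w - f v)" unfolding lratio_def using p by simp
  then have "1 + exp (lratio f u v w) = (f w - f u) / (f w - f v)" using p by (simp add: field_simps)
  then show ?thesis unfolding softplus_def using p by (simp add: ln_divide_pos)
qed

text \<open>The chords are paired as t1 t2 with t2 t3 and t3 t4 with t1 t4. Within each pair the
  image arcs differ by at most the image of [t1, t3], so by uniform continuity the two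
  \<open>lnsinc\<close> corrections nearly cancel; t4 may be far away.\<close>

lemma lsin_differences_small:
  assumes f: "circle_lift f" and e: "e > 0"
  obtains d where "d > 0" "\<And>t1 t2 t3 t4. quad_angles t1 t2 t3 t4 \<Longrightarrow> t4 - t1 \<le> 3 * pi / 2 \<Longrightarrow> t3 - t1 < d \<Longrightarrow>
    \<bar>lcr f t1 t2 t3 t4 - (lratio f t1 t2 t3 - softplus (lratio f t1 t3 t4))\<bar> < e"
proof -
  obtain c where c: "c > 0" "\<And>u v. v - u \<le> 3 * pi / 2 \<Longrightarrow> (f v - f u) / 2 \<le> pi - c" using lift_span[OF f] by blast
  obtain d0 where d0: "d0 > 0" "\<And>x y. 0 \<le> x \<Longrightarrow> x \<le> pi - c \<Longrightarrow> 0 \<le> y \<Longrightarrow> y \<le> pi - c \<Longrightarrow> \<bar>y - x\<bar> < d0 \<Longrightarrow> \<bar>lnsinc y - lnsinc x\<bar> < e / 2"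
    using lnsinc_uniform[OF c(1), of "e / 2"] e by auto
  obtain d where d: "d > 0" "\<And>x y. y - x < d \<Longrightarrow> f y - f x < d0" using lift_small[OF f d0(1)] by blast
  show ?thesis
  proof (rule that[OF d(1)])
    fix t1 t2 t3 t4 assume q: "quad_angles t1 t2 t3 t4" and sp: "t4 - t1 \<le> 3 * pi / 2" and sm: "t3 - t1 < d"
    note t = q[unfolded quad_angles_def]
    have fl: "f t1 < f t2" "f t2 < f t3" "f t3 < f t4" using lift_less[OF f] t by auto
    have F: "f t3 - f t1 < d0" using d(2)[OF sm] .
    have b: "0 \<le> (f v - f u) / 2" "(f v - f u) / 2 \<le> pi - c" if "t1 \<le> u" "u \<le> v" "v \<le> t4" for u v
      using lift_le[OF f, of u v] that sp c(2)[of v u] by auto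
    have h: "\<bar>(f t2 - f t1) / 2 - (f t3 - f t2) / 2\<bar> < d0" "\<bar>(f t4 - f t3) / 2 - (f t4 - f t1) / 2\<bar> < d0"
      unfolding abs_less_iff using F fl by (simp_all add: field_simps)
    have 1: "\<bar>lnsinc ((f t2 - f t1) / 2) - lnsinc ((f t3 - f t2) / 2)\<bar> < e / 2"
      by (rule d0(2)[OF _ _ _ _ h(1)]; rule b; use t in linarith)
    have 2: "\<bar>lnsinc ((f t4 - f t3) / 2) - lnsinc ((f t4 - f t1) / 2)\<bar> < e / 2"
      by (rule d0(2)[OF _ _ _ _ h(2)]; rule b; use t in linarith)
    have 3: "lsin f t1 t2 = ln (f t2 - f t1) - ln 2 + lnsinc ((f t2 - f t1) / 2)"
      "lsin f t2 t3 = ln (f t3 - f t2) - ln 2 + lnsinc ((f t3 - f t2) / 2)"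
      "lsin f t3 t4 = ln (f t4 - f t3) - ln 2 + lnsinc ((f t4 - f t3) / 2)"
      "lsin f t1 t4 = ln (f t4 - f t1) - ln 2 + lnsinc ((f t4 - f t1) / 2)"
      using t by (auto intro!: lsin_lnsinc[OF f])
    have 4: "lratio f t1 t2 t3 = ln (f t2 - f t1) - ln (f t3 - f t2)" using t by (intro lratio_eq[OF f]) auto
    have 5: "ln (f t4 - f t3) - ln (f t4 - f t1) = - softplus (lratio f t1 t3 t4)"
      using t by (intro lratio_softplus[OF f]) auto
    show "\<bar>lcr f t1 t2 t3 t4 - (lratio f t1 t2 t3 - softplus (lratio f t1 t3 t4))\<bar> < e"
      using 1 2 5 unfolding lcr_def 3 4 abs_less_iff by linarith
  qed
qed

text \<open>Let a \<le> c be the outer gaps and b the middle one. A bounded cross ratio makes a and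
  b comparable and b at most a multiple of c, so a small gap makes a + b small while c may be large.
  The term \<open>lratio f t1 t2 t3\<close> is covered by \<open>lratio_asymptotics\<close>; so is
  the other term if c is comparable to a + b, and if c is far larger both values of
  \<open>softplus\<close> are negligible.\<close>

lemma lcr_asymptotics_core:
  assumes b: "bounded_distortion f \<alpha> \<beta> C" and s: "same_asymptotics (\<lambda>x. x) f" and e: "e > 0"
  shows "\<exists>d>0. \<forall>t1 t2 t3 t4. quad_angles t1 t2 t3 t4 \<longrightarrow> t4 - t1 \<le> 3 * pi / 2 \<longrightarrow> mingap t1 t2 t3 t4 < d \<longrightarrow>
    \<bar>lcr (\<lambda>x. x) t1 t2 t3 t4\<bar> \<le> L \<longrightarrow> t2 - t1 \<le> t4 - t3 \<longrightarrow> \<bar>lcr f t1 t2 t3 t4 - lcr (\<lambda>x. x) t1 t2 t3 t4\<bar> < e"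
proof -
  have f: "circle_lift f" and a: "\<alpha> > 0" using b by (auto simp: bounded_distortion_def)
  have B: "quasi_linear \<alpha> \<beta> C (ln ((v - u) / (w - v))) (lratio f u v w)" if "u < v" "v < w" "w \<le> u + 2 * pi" for u v w
    using b that unfolding bounded_distortion_def by blast
  have "doubling (\<lambda>x::real. x) 1 1" by (simp add: doubling_def)
  then obtain Ci where bi: "bounded_distortion (\<lambda>x::real. x) (log 2 (1 + 1 / 1)) (log 2 (1 + 1)) Ci"
    using doubling_bounded_distortion[OF circle_lift_id, of 1 1] pi_gt3 by auto
  obtain K where K: "K \<ge> 0" "\<And>t1 t2 t3 t4. quad_angles t1 t2 t3 t4 \<Longrightarrow> t4 - t1 \<le> 3 * pi / 2 \<Longrightarrow>
    \<bar>lcr (\<lambda>x. x) t1 t2 t3 t4 - phi (ln ((t2 - t1) / (t3 - t2))) (ln ((t4 - t3) / (t3 - t2)))\<bar> \<le> K"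
    using lcr_approx[OF circle_lift_id] by blast
  define L' where "L' = max 0 (L + K)"
  define \<Lambda> where "\<Lambda> = exp L'"
  have \<Lambda>: "\<Lambda> \<ge> 1" by (simp add: \<Lambda>_def L'_def)
  define R where "R = ln ((\<Lambda> + 1) * \<Lambda>)"
  \<comment> \<open>The threshold for r = ln ((a + b) / c): below -T both exp r and the bound exp (C
    + \<alpha> r) for the image are at most e/8.\<close>
  define T where "T = max 0 (max (- ln (e / 8)) ((C - ln (e / 8)) / \<alpha>))"
  have T: "exp (- T) \<le> e / 8" "exp (C - \<alpha> * T) \<le> e / 8"
  proof -
    have "- T \<le> ln (e / 8)" by (simp add: T_def)
    then show "exp (- T) \<le> e / 8" using e by (metis divide_pos_pos exp_le_cancel_iff exp_ln zero_less_numeral)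
    have "(C - ln (e / 8)) / \<alpha> \<le> T" by (simp add: T_def)
    then have "C - \<alpha> * T \<le> ln (e / 8)" using a by (simp add: divide_le_eq mult.commute)
    then show "exp (C - \<alpha> * T) \<le> e / 8" using e by (metis divide_pos_pos exp_le_cancel_iff exp_ln zero_less_numeral)
  qed
  have e4: "e / 4 > 0" using e by simp
  obtain d1 where d1: "d1 > 0" "\<And>u v w. u < v \<Longrightarrow> v < w \<Longrightarrow> w - u < d1 \<Longrightarrow> \<bar>ln ((v - u) / (w - v))\<bar> \<le> max L' (max \<bar>R\<bar> \<bar>T\<bar>) \<Longrightarrow>
    \<bar>lratio f u v w - lratio (\<lambda>x. x) u v w\<bar> < e / 4"
    using lratio_asymptotics[OF bi b s e4] by blast
  obtain d2 where d2: "d2 > 0" "\<And>t1 t2 t3 t4. quad_angles t1 t2 t3 t4 \<Longrightarrow> t4 - t1 \<le> 3 * pi / 2 \<Longrightarrow> t3 - t1 < d2 \<Longrightarrow>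
    \<bar>lcr f t1 t2 t3 t4 - (lratio f t1 t2 t3 - softplus (lratio f t1 t3 t4))\<bar> < e / 4"
    using lsin_differences_small[OF f e4] by blast
  obtain d3 where d3: "d3 > 0" "\<And>t1 t2 t3 t4. quad_angles t1 t2 t3 t4 \<Longrightarrow> t4 - t1 \<le> 3 * pi / 2 \<Longrightarrow> t3 - t1 < d3 \<Longrightarrow>
    \<bar>lcr (\<lambda>x. x) t1 t2 t3 t4 - (lratio (\<lambda>x. x) t1 t2 t3 - softplus (lratio (\<lambda>x. x) t1 t3 t4))\<bar> < e / 4"
    using lsin_differences_small[OF circle_lift_id e4] by blast
  define D where "D = min d1 (min d2 d3)"
  \<comment> \<open>Makes a + b < D, and also a + b + c < D whenever c \<le> exp T (a + b); the
    bound pi/2 excludes that the last gap is the one below d.\<close>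
  define d where "d = min (pi / 2) (D / (2 * \<Lambda> * (1 + exp T)))"
  have D: "D > 0" using d1 d2 d3 by (simp add: D_def)
  have \<Lambda>T: "2 * \<Lambda> * (1 + exp T) > 0" using \<Lambda> by (intro mult_pos_pos) (auto simp: add_pos_pos)
  have d: "d > 0" "d \<le> pi / 2"
  proof -
    have "D / (2 * \<Lambda> * (1 + exp T)) > 0" using D \<Lambda>T by (rule divide_pos_pos)
    then show "d > 0" by (simp add: d_def)
    show "d \<le> pi / 2" unfolding d_def by (rule min.cobounded1)
  qed
  have dD: "2 * \<Lambda> * d * (1 + exp T) \<le> D"
  proof -
    have "d \<le> D / (2 * \<Lambda> * (1 + exp T))" by (simp add: d_def)
    then show ?thesis using \<Lambda>T by (simp add: le_divide_eq mult_ac)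
  qed
  have "\<bar>lcr f t1 t2 t3 t4 - lcr (\<lambda>x. x) t1 t2 t3 t4\<bar> < e"
    if q: "quad_angles t1 t2 t3 t4" and sp: "t4 - t1 \<le> 3 * pi / 2" and min_gap: "mingap t1 t2 t3 t4 < d"
      and L: "\<bar>lcr (\<lambda>x. x) t1 t2 t3 t4\<bar> \<le> L" and g13: "t2 - t1 \<le> t4 - t3" for t1 t2 t3 t4
  proof -
    note t = q[unfolded quad_angles_def]
    define a b c where "a = t2 - t1" and "b = t3 - t2" and "c = t4 - t3"
    have abc: "a > 0" "b > 0" "c > 0" "a \<le> c" using t g13 by (auto simp: a_def b_def c_def)
    define x z where "x = ln a - ln b" and "z = ln c - ln b"
    have xz: "x \<le> z" using abc by (simp add: x_def z_def)
    have "ln (a / b) = x" "ln (c / b) = z" using abc by (auto simp: x_def z_def ln_divide_pos)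
    then have "\<bar>phi x z\<bar> \<le> L'" using K(2)[OF q sp] L unfolding a_def[symmetric] b_def[symmetric] c_def[symmetric] L'_def
      by (simp only: abs_le_iff le_max_iff_disj) linarith
    then have xL: "\<bar>x\<bar> \<le> L'" "- z \<le> L'" using xz unfolding phi_def L'_def by (auto simp: min_def max_def abs_le_iff split: if_splits)
    have "ln a \<le> ln (\<Lambda> * b)" "ln b \<le> ln (\<Lambda> * a)" "ln b \<le> ln (\<Lambda> * c)"
      using xL abc unfolding x_def z_def \<Lambda>_def by (auto simp: ln_mult_pos abs_le_iff)
    then have ab: "a \<le> \<Lambda> * b" "b \<le> \<Lambda> * a" "b \<le> \<Lambda> * c"
      using abc \<Lambda> by (auto simp: ln_le_cancel_iff mult_pos_pos)
    have "t1 + 2 * pi - t4 \<ge> d" using sp d by linarith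
    then have "min a b < d" using min_gap abc unfolding mingap_def a_def[symmetric] b_def[symmetric] c_def[symmetric] by auto
    then have "\<Lambda> * min a b < \<Lambda> * d" using \<Lambda> by (intro mult_strict_left_mono) auto
    moreover have "1 * a \<le> \<Lambda> * a" "1 * b \<le> \<Lambda> * b" using \<Lambda> abc by (intro mult_right_mono; simp)+
    then have "a \<le> \<Lambda> * min a b" "b \<le> \<Lambda> * min a b" using ab by (auto simp: min_def)
    ultimately have "a < \<Lambda> * d" "b < \<Lambda> * d" by linarith+
    then have s13: "t3 - t1 < 2 * \<Lambda> * d" "t3 - t1 = a + b" by (auto simp: a_def b_def)
    have "2 * \<Lambda> * d * 1 \<le> 2 * \<Lambda> * d * (1 + exp T)" using \<Lambda> d by (intro mult_left_mono) auto
    then have sD: "t3 - t1 < D" using s13 dD by linarith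
    then have sd: "t3 - t1 < d1" "t3 - t1 < d2" "t3 - t1 < d3" by (auto simp: D_def)
    have A1: "\<bar>lratio f t1 t2 t3 - lratio (\<lambda>x. x) t1 t2 t3\<bar> < e / 4"
      using t sd xL \<open>ln (a / b) = x\<close> by (intro d1(2)) (auto simp: a_def b_def)
    define r where "r = ln ((t3 - t1) / (t4 - t3))"
    have lr: "lratio (\<lambda>x. x) t1 t3 t4 = r" by (simp add: lratio_def r_def)
    have r: "r = ln (a + b) - ln c" unfolding r_def s13(2) c_def[symmetric] using abc by (intro ln_divide_pos) auto
    have rR: "r \<le> R"
    proof -
      have "a + b \<le> (\<Lambda> + 1) * b" using ab by (simp add: algebra_simps)
      also have "\<dots> \<le> (\<Lambda> + 1) * (\<Lambda> * c)" using ab \<Lambda> by (intro mult_left_mono) auto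
      finally have "(t3 - t1) / (t4 - t3) \<le> (\<Lambda> + 1) * \<Lambda>"
        using abc unfolding s13(2) c_def[symmetric] by (simp add: divide_le_eq mult.assoc)
      then show ?thesis unfolding r_def R_def using t \<Lambda> by (intro ln_mono) (auto intro!: divide_pos_pos mult_pos_pos)
    qed
    have A2: "\<bar>softplus (lratio f t1 t3 t4) - softplus (lratio (\<lambda>x. x) t1 t3 t4)\<bar> < e / 4"
    proof (cases "r \<ge> - T")
      case True
      then have rl: "\<bar>r\<bar> \<le> max L' (max \<bar>R\<bar> \<bar>T\<bar>)" using rR by auto
      have "ln c \<le> ln (exp T * (a + b))" using True abc unfolding r by (simp add: ln_mult_pos)
      then have "c \<le> exp T * (a + b)" using abc by (simp add: ln_le_cancel_iff)
      then have "t4 - t1 \<le> (1 + exp T) * (t3 - t1)" unfolding s13(2) by (simp add: a_def b_def c_def algebra_simps)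
      also have "\<dots> < (1 + exp T) * (2 * \<Lambda> * d)" using s13(1) by (intro mult_strict_left_mono) (auto simp: add_pos_pos)
      also have "\<dots> \<le> D" using dD by (simp add: mult_ac)
      finally have "t4 - t1 < d1" by (simp add: D_def)
      then have "\<bar>lratio f t1 t3 t4 - lratio (\<lambda>x. x) t1 t3 t4\<bar> < e / 4"
        using t rl by (intro d1(2)) (auto simp: r_def)
      then show ?thesis using softplus_Lipschitz[of "lratio f t1 t3 t4" "lratio (\<lambda>x. x) t1 t3 t4"] by linarith
    next
      case False
      have "softplus r \<le> exp r" by (rule softplus_le_exp)
      also have "\<dots> \<le> exp (- T)" using False by simp
      finally have 1: "softplus r \<le> e / 8" using T by linarith
      have "T \<ge> 0" by (simp add: T_def)
      then have T0: "r \<le> 0" using False by linarith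
      have 2: "softplus (lratio f t1 t3 t4) \<le> e / 8"
      proof -
        have bq: "quasi_linear \<alpha> \<beta> C r (lratio f t1 t3 t4)" unfolding r_def using t by (intro B) auto
        have "lratio f t1 t3 t4 \<le> \<alpha> * r + C" using bq T0 by (simp add: quasi_linear_def)
        moreover have "\<alpha> * r \<le> \<alpha> * (- T)" using False a by (intro mult_left_mono) auto
        ultimately have "lratio f t1 t3 t4 \<le> C - \<alpha> * T" by simp
        then have "exp (lratio f t1 t3 t4) \<le> exp (C - \<alpha> * T)" by simp
        then show ?thesis using softplus_le_exp[of "lratio f t1 t3 t4"] T by linarith
      qed
      show ?thesis using 1 2 softplus_pos[of r] softplus_pos[of "lratio f t1 t3 t4"] e unfolding lr abs_less_iff by linarith
    qed
    show ?thesis using A1 A2 d2(2)[OF q sp sd(2)] d3(2)[OF q sp sd(3)] unfolding abs_less_iff by linarith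
  qed
  then show ?thesis using d(1) by blast
qed

lemma lcr_reflect:
  "lcr (\<lambda>x. - f (- x)) (- t4) (- t3) (- t2) (- t1) = lcr f t1 t2 t3 t4"
  by (simp add: lcr_def lsin_def)

text \<open>Rotation puts a large gap last, reflection makes the first gap at most the third; both
  preserve \<open>mingap\<close> and change logarithmic cross ratios at most in sign.\<close>

theorem lcr_asymptotics_bounded:
  assumes b: "bounded_distortion f \<alpha> \<beta> C" and s: "same_asymptotics (\<lambda>x. x) f" and e: "e > 0"
  obtains d where "d > 0" "\<And>t1 t2 t3 t4. quad_angles t1 t2 t3 t4 \<Longrightarrow> mingap t1 t2 t3 t4 < d \<Longrightarrow>
    \<bar>lcr (\<lambda>x. x) t1 t2 t3 t4\<bar> \<le> L \<Longrightarrow> \<bar>lcr f t1 t2 t3 t4 - lcr (\<lambda>x. x) t1 t2 t3 t4\<bar> < e"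
proof -
  have f: "circle_lift f" using b by (simp add: bounded_distortion_def)
  obtain d1 where d1: "d1 > 0" "\<And>t1 t2 t3 t4. quad_angles t1 t2 t3 t4 \<Longrightarrow> t4 - t1 \<le> 3 * pi / 2 \<Longrightarrow> mingap t1 t2 t3 t4 < d1 \<Longrightarrow>
    \<bar>lcr (\<lambda>x. x) t1 t2 t3 t4\<bar> \<le> L \<Longrightarrow> t2 - t1 \<le> t4 - t3 \<Longrightarrow> \<bar>lcr f t1 t2 t3 t4 - lcr (\<lambda>x. x) t1 t2 t3 t4\<bar> < e"
    using lcr_asymptotics_core[OF b s e, of L] by blast
  have s': "same_asymptotics (\<lambda>x. x) (\<lambda>x. - f (- x))"
    using same_asymptotics_reflect[OF circle_lift_id f s] by simp
  obtain d2 where d2: "d2 > 0" "\<And>t1 t2 t3 t4. quad_angles t1 t2 t3 t4 \<Longrightarrow> t4 - t1 \<le> 3 * pi / 2 \<Longrightarrow> mingap t1 t2 t3 t4 < d2 \<Longrightarrow>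
    \<bar>lcr (\<lambda>x. x) t1 t2 t3 t4\<bar> \<le> L \<Longrightarrow> t2 - t1 \<le> t4 - t3 \<Longrightarrow> \<bar>lcr (\<lambda>x. - f (- x)) t1 t2 t3 t4 - lcr (\<lambda>x. x) t1 t2 t3 t4\<bar> < e"
    using lcr_asymptotics_core[OF bounded_distortion_reflect[OF b] s' e, of L] by blast
  have "mingap t1 t2 t3 t4 < min d1 d2 \<longrightarrow> \<bar>lcr (\<lambda>x. x) t1 t2 t3 t4\<bar> \<le> L \<longrightarrow> \<bar>lcr f t1 t2 t3 t4 - lcr (\<lambda>x. x) t1 t2 t3 t4\<bar> < e"
    if "quad_angles t1 t2 t3 t4" for t1 t2 t3 t4
    using that
  proof (rule quad_wlog[rotated 2])
    fix t1 t2 t3 t4 :: real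
    assume q: "quad_angles t1 t2 t3 t4" and sp: "t4 - t1 \<le> 3 * pi / 2"
    show "mingap t1 t2 t3 t4 < min d1 d2 \<longrightarrow> \<bar>lcr (\<lambda>x. x) t1 t2 t3 t4\<bar> \<le> L \<longrightarrow> \<bar>lcr f t1 t2 t3 t4 - lcr (\<lambda>x. x) t1 t2 t3 t4\<bar> < e"
    proof (cases "t2 - t1 \<le> t4 - t3")
      case True
      then show ?thesis using d1(2)[OF q sp] by simp
    next
      case False
      have li: "lcr (\<lambda>x. x) (- t4) (- t3) (- t2) (- t1) = lcr (\<lambda>x. x) t1 t2 t3 t4" by (simp add: lcr_def lsin_def)
      have "quad_angles (- t4) (- t3) (- t2) (- t1)" using q by (auto simp: quad_angles_def)
      moreover have "mingap (- t4) (- t3) (- t2) (- t1) = mingap t1 t2 t3 t4" by (auto simp: mingap_def min_def)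
      ultimately show ?thesis using d2(2)[of "- t4" "- t3" "- t2" "- t1"] sp False unfolding lcr_reflect li by simp
    qed
  next
    fix t1 t2 t3 t4 :: real
    assume "mingap t2 t3 t4 (t1 + 2 * pi) < min d1 d2 \<longrightarrow> \<bar>lcr (\<lambda>x. x) t2 t3 t4 (t1 + 2 * pi)\<bar> \<le> L \<longrightarrow>
      \<bar>lcr f t2 t3 t4 (t1 + 2 * pi) - lcr (\<lambda>x. x) t2 t3 t4 (t1 + 2 * pi)\<bar> < e"
    then show "mingap t1 t2 t3 t4 < min d1 d2 \<longrightarrow> \<bar>lcr (\<lambda>x. x) t1 t2 t3 t4\<bar> \<le> L \<longrightarrow> \<bar>lcr f t1 t2 t3 t4 - lcr (\<lambda>x. x) t1 t2 t3 t4\<bar> < e"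
      unfolding mingap_rotate lcr_rotate[OF f] lcr_rotate[OF circle_lift_id] by (simp add: abs_minus_commute)
  qed
  then show ?thesis using that[of "min d1 d2"] d1(1) d2(1) by simp
qed

text \<open>The identity has ratio 1 on adjacent intervals of equal length, so at small scales any
  constant above 1 will do.\<close>

lemma same_asymptotics_doubling:
  assumes f: "circle_lift f" and s: "same_asymptotics (\<lambda>x. x) f" and C: "C > 1"
  obtains t0 where "0 < t0" "t0 < pi" "doubling f C t0"
proof -
  have "ln C > 0" using C by simp
  then obtain d where d: "d > 0" "\<And>x t. 0 < t \<and> t < d \<Longrightarrow> \<bar>lratio f (x - t) x (x + t) - lratio (\<lambda>x. x) (x - t) x (x + t)\<bar> < ln C"
    using s unfolding same_asymptotics_def by blast
  have "f (x + t) - f x \<le> C * (f x - f (x - t)) \<and> f x - f (x - t) \<le> C * (f (x + t) - f x)" if t: "0 < t" "t < d" for x t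
  proof -
    have p: "f x - f (x - t) > 0" "f (x + t) - f x > 0" using lift_less[OF f] t by auto
    have "lratio f (x - t) x (x + t) = ln (f x - f (x - t)) - ln (f (x + t) - f x)" using t by (intro lratio_eq[OF f]) auto
    moreover have "lratio (\<lambda>x. x) (x - t) x (x + t) = 0" using t by (simp add: lratio_def)
    ultimately have "ln (f (x + t) - f x) \<le> ln (C * (f x - f (x - t)))" "ln (f x - f (x - t)) \<le> ln (C * (f (x + t) - f x))"
      using d(2)[of t x] t p C by (auto simp: ln_mult_pos abs_less_iff)
    then show ?thesis using p C by (auto simp: ln_le_cancel_iff)
  qed
  then have "doubling f C (min (d / 2) 1)" using d(1) unfolding doubling_def by auto
  then show ?thesis using that[of "min (d / 2) 1"] d(1) pi_gt3 by auto
qed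

text \<open>For C close to 1 the slopes of \<open>lcr_quasi_linear\<close> are within e/2 of 1, and
  beyond |x| = 2 C'/e the constant C' is at most (e/2) |x|. The remaining quadruples have bounded
  cross ratio.\<close>

theorem lcr_asymptotics:
  assumes f: "circle_lift f" and s: "same_asymptotics (\<lambda>x. x) f" and e: "e > 0"
  obtains d where "d > 0" "\<And>t1 t2 t3 t4. quad_angles t1 t2 t3 t4 \<Longrightarrow> mingap t1 t2 t3 t4 < d \<Longrightarrow>
    \<bar>lcr f t1 t2 t3 t4 - lcr (\<lambda>x. x) t1 t2 t3 t4\<bar> \<le> e * (1 + \<bar>lcr (\<lambda>x. x) t1 t2 t3 t4\<bar>)"
proof -
  obtain C :: real where C: "C > 1" "1 - e / 2 \<le> log 2 (1 + 1 / C)" "log 2 (1 + C) \<le> 1 + e / 2"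
  proof -
    have "((\<lambda>C::real. log 2 (1 + 1 / C)) \<longlongrightarrow> 1) (at_right 1)" "((\<lambda>C::real. log 2 (1 + C)) \<longlongrightarrow> 1) (at_right 1)"
      by (auto intro!: tendsto_eq_intros)
    then have "\<forall>\<^sub>F C in at_right (1::real). 1 - e / 2 < log 2 (1 + 1 / C)" "\<forall>\<^sub>F C in at_right (1::real). log 2 (1 + C) < 1 + e / 2"
      using e by (auto intro: order_tendstoD)
    moreover have "\<forall>\<^sub>F C in at_right (1::real). C > 1" by (rule eventually_at_right_less)
    ultimately have "\<forall>\<^sub>F C in at_right (1::real). C > 1 \<and> 1 - e / 2 < log 2 (1 + 1 / C) \<and> log 2 (1 + C) < 1 + e / 2"
      by (simp add: eventually_conj_iff)
    from eventually_happens[OF this] show ?thesis using that by (force simp: trivial_limit_at_right_real)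
  qed
  obtain t0 where t0: "0 < t0" "t0 < pi" "doubling f C t0" using same_asymptotics_doubling[OF f s C(1)] by blast
  have C1: "C \<ge> 1" using C by simp
  obtain C' where C': "C' \<ge> 0" "\<And>t1 t2 t3 t4. quad_angles t1 t2 t3 t4 \<Longrightarrow>
    quasi_linear (log 2 (1 + 1 / C)) (log 2 (1 + C)) C' (lcr (\<lambda>x. x) t1 t2 t3 t4) (lcr f t1 t2 t3 t4)"
    using lcr_quasi_linear[OF f t0(3) C1 t0(1,2)] by blast
  obtain C0 where b: "bounded_distortion f (log 2 (1 + 1 / C)) (log 2 (1 + C)) C0"
    using doubling_bounded_distortion[OF f t0(3) C1 t0(1,2)] by blast
  obtain d where d: "d > 0" "\<And>t1 t2 t3 t4. quad_angles t1 t2 t3 t4 \<Longrightarrow> mingap t1 t2 t3 t4 < d \<Longrightarrow>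
    \<bar>lcr (\<lambda>x. x) t1 t2 t3 t4\<bar> \<le> 2 * C' / e \<Longrightarrow> \<bar>lcr f t1 t2 t3 t4 - lcr (\<lambda>x. x) t1 t2 t3 t4\<bar> < e"
    using lcr_asymptotics_bounded[OF b s e] by blast
  have "\<bar>lcr f t1 t2 t3 t4 - lcr (\<lambda>x. x) t1 t2 t3 t4\<bar> \<le> e * (1 + \<bar>lcr (\<lambda>x. x) t1 t2 t3 t4\<bar>)"
    if q: "quad_angles t1 t2 t3 t4" and m: "mingap t1 t2 t3 t4 < d" for t1 t2 t3 t4
  proof -
    define x y where "x = lcr (\<lambda>x. x) t1 t2 t3 t4" and "y = lcr f t1 t2 t3 t4"
    show ?thesis
    proof (cases "\<bar>x\<bar> \<le> 2 * C' / e")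
      case True
      then have "\<bar>y - x\<bar> < e" using d(2)[OF q m] by (simp add: x_def y_def)
      moreover have "e * 1 \<le> e * (1 + \<bar>x\<bar>)" using e by (intro mult_left_mono) auto
      ultimately show ?thesis unfolding x_def[symmetric] y_def[symmetric] by linarith
    next
      case False
      then have C'x: "C' \<le> e / 2 * \<bar>x\<bar>" using e by (simp add: divide_less_eq field_simps)
      have ql: "quasi_linear (log 2 (1 + 1 / C)) (log 2 (1 + C)) C' x y" using C'(2)[OF q] by (simp add: x_def y_def)
      have "\<bar>y - x\<bar> \<le> e / 2 * \<bar>x\<bar> + C'"
      proof (cases "x \<ge> 0")
        case True
        have "(1 - e / 2) * x \<le> log 2 (1 + 1 / C) * x" "log 2 (1 + C) * x \<le> (1 + e / 2) * x"
          using C True by (auto intro: mult_right_mono)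
        then show ?thesis using ql True unfolding quasi_linear_def by (auto simp: abs_le_iff algebra_simps)
      next
        case False
        have "log 2 (1 + 1 / C) * x \<le> (1 - e / 2) * x" "(1 + e / 2) * x \<le> log 2 (1 + C) * x"
          using C False by (auto intro: mult_right_mono_neg)
        then show ?thesis using ql False unfolding quasi_linear_def by (auto simp: abs_le_iff algebra_simps)
      qed
      then have "\<bar>y - x\<bar> \<le> e * \<bar>x\<bar>" using C'x by linarith
      then show ?thesis using e unfolding x_def[symmetric] y_def[symmetric] by (simp add: distrib_left)
    qed
  qed
  then show ?thesis using that d(1) by blast
qed

section \<open>Symmetric and quasisymmetric homeomorphisms\<close>

text \<open>The quotients in the definitions are formed from chords, \<open>lratio\<close> from
  lengths of arcs; at small scales the correction \<open>lnsinc\<close> is nearly the same for both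
  neighbouring arcs.\<close>

lemma chord_lratio:
  assumes f: "circle_lift f" and e: "e > 0"
  obtains d where "d > 0" "d < pi" "\<And>x t. 0 < t \<Longrightarrow> t < d \<Longrightarrow> \<bar>lratio f (x - t) x (x + t) - (lsin f (x - t) x - lsin f x (x + t))\<bar> < e"
proof -
  obtain c where c: "c > 0" "\<And>u v. v - u \<le> 3 * pi / 2 \<Longrightarrow> (f v - f u) / 2 \<le> pi - c" using lift_span[OF f] by blast
  obtain d0 where d0: "d0 > 0" "\<And>x y. 0 \<le> x \<Longrightarrow> x \<le> pi - c \<Longrightarrow> 0 \<le> y \<Longrightarrow> y \<le> pi - c \<Longrightarrow> \<bar>y - x\<bar> < d0 \<Longrightarrow> \<bar>lnsinc y - lnsinc x\<bar> < e"
    using lnsinc_uniform[OF c(1) e] by blast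
  obtain d where d: "d > 0" "\<And>x y. y - x < d \<Longrightarrow> f y - f x < d0" using lift_small[OF f d0(1)] by blast
  have "\<bar>lratio f (x - t) x (x + t) - (lsin f (x - t) x - lsin f x (x + t))\<bar> < e" if t: "0 < t" "t < min (d / 2) 1" for x t
  proof -
    have fl: "f (x - t) < f x" "f x < f (x + t)" using lift_less[OF f] t by auto
    have F: "f (x + t) - f (x - t) < d0" using t by (intro d(2)) auto
    have l: "lsin f (x - t) x = ln (f x - f (x - t)) - ln 2 + lnsinc ((f x - f (x - t)) / 2)"
      "lsin f x (x + t) = ln (f (x + t) - f x) - ln 2 + lnsinc ((f (x + t) - f x) / 2)"
      using t pi_gt3 by (auto intro!: lsin_lnsinc[OF f])
    have r: "lratio f (x - t) x (x + t) = ln (f x - f (x - t)) - ln (f (x + t) - f x)" using t by (intro lratio_eq[OF f]) auto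
    have b: "(f x - f (x - t)) / 2 \<le> pi - c" "(f (x + t) - f x) / 2 \<le> pi - c"
      by (rule c(2); use t pi_gt3 in linarith)+
    have h: "\<bar>(f x - f (x - t)) / 2 - (f (x + t) - f x) / 2\<bar> < d0"
      unfolding abs_less_iff using F fl by (simp_all add: field_simps)
    have "\<bar>lnsinc ((f x - f (x - t)) / 2) - lnsinc ((f (x + t) - f x) / 2)\<bar> < e"
      by (rule d0(2)) (use b h fl in auto)
    then show ?thesis unfolding r l abs_less_iff by linarith
  qed
  then show ?thesis using that[of "min (d / 2) 1"] d(1) pi_gt3 by auto
qed

text \<open>The quadruple of angles \<open>x - t\<close>, \<open>x\<close>, \<open>x + t\<close>, \<open>x + \<pi>\<close> has cross ratio 1.\<close>

lemma lcr_antipodal: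
  assumes f: "circle_lift f" and e: "e > 0"
  obtains d where "d > 0" "d < pi / 2" "\<And>x t. 0 < t \<Longrightarrow> t < d \<Longrightarrow> \<bar>lcr f (x - t) x (x + t) (x + pi) - lratio f (x - t) x (x + t)\<bar> < e"
proof -
  obtain d1 where d1: "d1 > 0" "\<And>t1 t2 t3 t4. quad_angles t1 t2 t3 t4 \<Longrightarrow> t4 - t1 \<le> 3 * pi / 2 \<Longrightarrow> t3 - t1 < d1 \<Longrightarrow>
    \<bar>lcr f t1 t2 t3 t4 - (lratio f t1 t2 t3 - softplus (lratio f t1 t3 t4))\<bar> < e / 2"
    using lsin_differences_small[OF f, of "e / 2"] e by auto
  \<comment> \<open>The arc from x + t to x + pi keeps a definite image length, so the fourth point
    contributes only a vanishing \<open>softplus\<close> term.\<close>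
  obtain c where c: "c > 0" "\<And>x y. x + pi / 2 \<le> y \<Longrightarrow> c \<le> f y - f x" using lift_gap[OF f, of "pi / 2"] by auto
  have "c * (e / 2) > 0" using c e by simp
  then obtain d2 where d2: "d2 > 0" "\<And>x y. y - x < d2 \<Longrightarrow> f y - f x < c * (e / 2)" using lift_small[OF f] by blast
  have "\<bar>lcr f (x - t) x (x + t) (x + pi) - lratio f (x - t) x (x + t)\<bar> < e"
    if t: "0 < t" "t < min (min (d1 / 2) (d2 / 2)) 1" for x t
  proof -
    have q: "quad_angles (x - t) x (x + t) (x + pi)" using t pi_gt3 by (auto simp: quad_angles_def)
    have 1: "\<bar>lcr f (x - t) x (x + t) (x + pi) - (lratio f (x - t) x (x + t) - softplus (lratio f (x - t) (x + t) (x + pi)))\<bar> < e / 2"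
      by (rule d1(2)[OF q]) (use t pi_gt3 in auto)
    have o: "f (x - t) < f (x + t)" "f (x + t) < f (x + pi)" using lift_less[OF f] t pi_gt3 by auto
    have "exp (lratio f (x - t) (x + t) (x + pi)) = (f (x + t) - f (x - t)) / (f (x + pi) - f (x + t))"
      unfolding lratio_def using o by simp
    also have "\<dots> < e / 2"
    proof -
      have "c \<le> f (x + pi) - f (x + t)" using t pi_gt3 by (intro c(2)) auto
      then have "c * (e / 2) \<le> (f (x + pi) - f (x + t)) * (e / 2)" using e by (intro mult_right_mono) auto
      moreover have "f (x + t) - f (x - t) < c * (e / 2)" using t by (intro d2(2)) auto
      ultimately show ?thesis using o by (simp add: divide_less_eq mult.commute)
    qed
    finally have "softplus (lratio f (x - t) (x + t) (x + pi)) < e / 2" using softplus_le_exp le_less_trans by blast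
    then show ?thesis using 1 softplus_pos[of "lratio f (x - t) (x + t) (x + pi)"] unfolding abs_less_iff by linarith
  qed
  moreover have "min (min (d1 / 2) (d2 / 2)) 1 < pi / 2" using pi_gt3 by (simp add: min_less_iff_disj)
  ultimately show ?thesis using that[of "min (min (d1 / 2) (d2 / 2)) 1"] d1(1) d2(1) by auto
qed

lemma lcr_antipodal_eq_0:
  assumes "0 < t" "t < pi" shows "lcr (\<lambda>x. x) (x - t) x (x + t) (x + pi) = 0"
proof -
  have "(x + pi - (x - t)) / 2 = pi - (x + pi - (x + t)) / 2" by (simp add: field_simps)
  then have "sin ((x + pi - (x - t)) / 2) = sin ((x + pi - (x + t)) / 2)" by (simp only: sin_pi_minus)
  then have "lsin (\<lambda>x. x) (x - t) (x + pi) = lsin (\<lambda>x. x) (x + t) (x + pi)" by (simp only: lsin_def)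
  moreover have "lsin (\<lambda>x. x) (x - t) x = lsin (\<lambda>x. x) x (x + t)" by (simp add: lsin_def)
  ultimately show ?thesis by (simp add: lcr_def)
qed

lemma harmonic_same_asymptotics:
  assumes f: "circle_lift f" and g: "circle_lift g"
    and h: "\<And>e. e > 0 \<Longrightarrow> \<exists>d>0. \<forall>t1 t2 t3 t4. quad_angles t1 t2 t3 t4 \<longrightarrow> lcr (\<lambda>x. x) t1 t2 t3 t4 = 0 \<longrightarrow> mingap t1 t2 t3 t4 < d
      \<longrightarrow> \<bar>lcr g t1 t2 t3 t4 - lcr f t1 t2 t3 t4\<bar> < e"
  shows "same_asymptotics f g"
  unfolding same_asymptotics_def
proof (intro allI impI)
  fix e :: real assume "e > 0"
  then have e3: "e / 3 > 0" by simp
  obtain d1 where d1: "d1 > 0" "d1 < pi / 2" "\<And>x t. 0 < t \<Longrightarrow> t < d1 \<Longrightarrow> \<bar>lcr f (x - t) x (x + t) (x + pi) - lratio f (x - t) x (x + t)\<bar> < e / 3"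
    using lcr_antipodal[OF f e3] by blast
  obtain d2 where d2: "d2 > 0" "d2 < pi / 2" "\<And>x t. 0 < t \<Longrightarrow> t < d2 \<Longrightarrow> \<bar>lcr g (x - t) x (x + t) (x + pi) - lratio g (x - t) x (x + t)\<bar> < e / 3"
    using lcr_antipodal[OF g e3] by blast
  obtain d3 where d3: "d3 > 0" "\<And>t1 t2 t3 t4. quad_angles t1 t2 t3 t4 \<Longrightarrow> lcr (\<lambda>x. x) t1 t2 t3 t4 = 0 \<Longrightarrow> mingap t1 t2 t3 t4 < d3
      \<Longrightarrow> \<bar>lcr g t1 t2 t3 t4 - lcr f t1 t2 t3 t4\<bar> < e / 3"
    using h[OF e3] by blast
  have "\<bar>lratio g (x - t) x (x + t) - lratio f (x - t) x (x + t)\<bar> < e" if t: "0 < t \<and> t < min d1 (min d2 d3)" for x t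
  proof -
    have "\<bar>lcr g (x - t) x (x + t) (x + pi) - lcr f (x - t) x (x + t) (x + pi)\<bar> < e / 3"
    proof (rule d3(2))
      show "quad_angles (x - t) x (x + t) (x + pi)" using t d1(2) pi_gt3 by (auto simp: quad_angles_def)
      show "lcr (\<lambda>x. x) (x - t) x (x + t) (x + pi) = 0" using t d1(2) pi_gt3 by (intro lcr_antipodal_eq_0) auto
      have "mingap (x - t) x (x + t) (x + pi) \<le> t" by (simp add: mingap_def)
      then show "mingap (x - t) x (x + t) (x + pi) < d3" using t by auto
    qed
    then show ?thesis using d1(3)[of t x] d2(3)[of t x] t unfolding abs_less_iff by linarith
  qed
  then show "\<exists>d>0. \<forall>x t. 0 < t \<and> t < d \<longrightarrow> \<bar>lratio g (x - t) x (x + t) - lratio f (x - t) x (x + t)\<bar> < e"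
    using d1(1) d2(1) d3(1) by (intro exI[of _ "min d1 (min d2 d3)"]) simp
qed

text \<open>Points with equidistant images under f are in general not equidistant, but by bounded
  distortion the ratio of their gaps lies within a factor exp (C1 / \<alpha>1) of 1. This is where
  \<open>lratio_asymptotics\<close> is required beyond equal intervals.\<close>

lemma same_asymptotics_quotient:
  assumes bf: "bounded_distortion f \<alpha>1 \<beta>1 C1" and bg: "bounded_distortion g \<alpha>2 \<beta>2 C2"
    and s: "same_asymptotics f g"
  shows "same_asymptotics (\<lambda>x. x) (\<lambda>x. g (inv f x))"
  unfolding same_asymptotics_def
proof (intro allI impI)
  fix e :: real assume e: "e > 0"
  have f: "circle_lift f" and g: "circle_lift g" and a: "\<alpha>1 > 0" using bf bg by (auto simp: bounded_distortion_def)
  have B: "quasi_linear \<alpha>1 \<beta>1 C1 (ln ((v - u) / (w - v))) (lratio f u v w)" if "u < v" "v < w" "w \<le> u + 2 * pi" for u v w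
    using bf that unfolding bounded_distortion_def by blast
  obtain d where d: "d > 0" "\<And>u v w. u < v \<Longrightarrow> v < w \<Longrightarrow> w - u < d \<Longrightarrow> \<bar>ln ((v - u) / (w - v))\<bar> \<le> C1 / \<alpha>1 \<Longrightarrow>
    \<bar>lratio g u v w - lratio f u v w\<bar> < e"
    using lratio_asymptotics[OF bf bg s e] by blast
  obtain d' where d': "d' > 0" "\<And>x y. y - x < d' \<Longrightarrow> inv f y - inv f x < min d 1"
    using lift_small[OF lift_inv(3)[OF f], of "min d 1"] d(1) by auto
  have "\<bar>lratio (\<lambda>x. g (inv f x)) (x - t) x (x + t) - lratio (\<lambda>x. x) (x - t) x (x + t)\<bar> < e" if t: "0 < t \<and> t < d' / 2" for x t
  proof -
    define u v w where "u = inv f (x - t)" and "v = inv f x" and "w = inv f (x + t)"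
    have o: "u < v" "v < w" unfolding u_def v_def w_def using lift_less[OF lift_inv(3)[OF f]] t by auto
    have wu: "w - u < min d 1" unfolding u_def w_def using t by (intro d'(2)) auto
    have fuvw: "f u = x - t" "f v = x" "f w = x + t" unfolding u_def v_def w_def using lift_inv(1)[OF f] by auto
    have r0: "lratio f u v w = 0" "lratio (\<lambda>x. x) (x - t) x (x + t) = 0" using t unfolding lratio_def fuvw by auto
    have "quasi_linear \<alpha>1 \<beta>1 C1 (ln ((v - u) / (w - v))) (lratio f u v w)" using o wu pi_gt3 by (intro B) auto
    then have "\<bar>ln ((v - u) / (w - v))\<bar> \<le> C1 / \<alpha>1"
      unfolding r0(1) quasi_linear_def using a by (auto simp: le_divide_eq abs_le_iff mult.commute) 
    then have "\<bar>lratio g u v w - lratio f u v w\<bar> < e" using o wu by (intro d(2)) auto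
    then show ?thesis unfolding r0 by (simp add: lratio_def u_def v_def w_def)
  qed
  then show "\<exists>d>0. \<forall>x t. 0 < t \<and> t < d \<longrightarrow> \<bar>lratio (\<lambda>x. g (inv f x)) (x - t) x (x + t) - lratio (\<lambda>x. x) (x - t) x (x + t)\<bar> < e"
    using d'(1) by (intro exI[of _ "d' / 2"]) simp
qed

section \<open>Homeomorphisms of the circle and their lifts\<close>

definition lift_of :: "(complex \<Rightarrow> complex) \<Rightarrow> (real \<Rightarrow> real) \<Rightarrow> bool" where
  "lift_of h f \<longleftrightarrow> op_circle_homeo h \<and> circle_lift f \<and> (\<forall>x. h (cis x) = cis (f x))"

lemma cis_eq_cis: "cis a = cis b \<longleftrightarrow> (\<exists>n::int. a = b + 2 * pi * of_int n)"
proof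
  assume "cis a = cis b"
  then have "sin a = sin b \<and> cos a = cos b" by (simp add: complex_eq_iff)
  then show "\<exists>n::int. a = b + 2 * pi * of_int n" unfolding sin_cos_eq_iff by blast
next
  assume "\<exists>n::int. a = b + 2 * pi * of_int n"
  then show "cis a = cis b" using sin_cos_eq_iff[of a b] by (auto simp: complex_eq_iff)
qed

text \<open>Over a full turn the lift increases by 2 pi n with n \<ge> 1. If n were at least 2, a
  point strictly inside the turn would have the same image as its beginning.\<close>

lemma op_circle_homeo_lift:
  assumes "op_circle_homeo h" obtains f where "lift_of h f"
proof -
  obtain g f where hg: "homeomorphism circle circle h g" and f: "continuous_on UNIV f" "strict_mono f" "\<And>x. h (cis x) = cis (f x)"
    using assms unfolding op_circle_homeo_def by blast
  have inj: "inj_on h circle" using hg by (metis homeomorphism_def inj_on_inverseI)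
  have "f (x + 2 * pi) = f x + 2 * pi" for x
  proof -
    have "cis (f (x + 2 * pi)) = cis (f x)" unfolding f(3)[symmetric] by (simp flip: cis_mult)
    then obtain n :: int where n: "f (x + 2 * pi) = f x + 2 * pi * of_int n" using cis_eq_cis by blast
    have lt: "f x < f (x + 2 * pi)" using f(2) by (simp add: strict_mono_less)
    then have "n > 0" unfolding n by (simp add: zero_less_mult_iff)
    moreover have "\<not> n \<ge> 2"
    proof
      assume "n \<ge> 2"
      then have "2 * pi * 2 \<le> 2 * pi * of_int n" by (intro mult_left_mono) auto
      then have "f x + 2 * pi \<le> f (x + 2 * pi)" unfolding n by simp
      then obtain y where y: "x \<le> y" "y \<le> x + 2 * pi" "f y = f x + 2 * pi"
        using IVT'[of f x "f x + 2 * pi" "x + 2 * pi"] f(1) by (auto intro: continuous_on_subset)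
      have "h (cis y) = h (cis x)" unfolding f(3) y(3) by (simp flip: cis_mult)
      then have "cis y = cis x" using inj by (auto dest: inj_onD)
      then obtain k :: int where k: "y = x + 2 * pi * of_int k" using cis_eq_cis by blast
      have "2 * pi * 0 \<le> 2 * pi * of_int k" "2 * pi * of_int k \<le> 2 * pi * 1" using y k by auto
      then have "(0::real) \<le> of_int k" "of_int k \<le> (1::real)"
        by (subst (asm) mult_le_cancel_left_pos; simp)+
      then have "0 \<le> k" "k \<le> 1" by auto
      then have "y = x \<or> y = x + 2 * pi" unfolding k using le_less by fastforce
      then show False using y(3) n \<open>2 * pi * 2 \<le> 2 * pi * of_int n\<close> pi_gt_zero by auto
    qed
    ultimately have "n = 1" by simp
    then show ?thesis using n by simp
  qed
  then have "lift_of h f" using assms f unfolding lift_of_def circle_lift_def by blast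
  then show ?thesis by (rule that)
qed

lemma lift_of_circle_inv:
  assumes "lift_of h f" shows "lift_of (circle_inv h) (inv f)" "homeomorphism circle circle h (circle_inv h)"
proof -
  have f: "circle_lift f" "\<And>x. h (cis x) = cis (f x)" using assms by (auto simp: lift_of_def)
  obtain g where hg: "homeomorphism circle circle h g" using assms unfolding lift_of_def op_circle_homeo_def by blast
  have inj: "inj_on h circle" using hg by (metis homeomorphism_def inj_on_inverseI)
  have im: "h ` circle = circle" using hg by (auto simp: homeomorphism_def)
  have "circle_inv h y = g y" if "y \<in> circle" for y
    using hg that inj unfolding homeomorphism_def by (metis imageI inv_into_f_f)
  then show hom: "homeomorphism circle circle h (circle_inv h)"
    using homeomorphism_cong[OF hg refl refl, of h "circle_inv h"] by simp
  have l: "circle_inv h (cis x) = cis (inv f x)" for x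
  proof -
    have "h (cis (inv f x)) = cis x" using f lift_inv(1)[OF f(1)] by simp
    then show ?thesis using inj by (metis inv_into_f_f norm_cis mem_sphere_0)
  qed
  have "op_circle_homeo (circle_inv h)" unfolding op_circle_homeo_def
    using homeomorphism_symD[OF hom] lift_inv(3)[OF f(1)] l unfolding circle_lift_def by blast
  then show "lift_of (circle_inv h) (inv f)" unfolding lift_of_def using lift_inv(3)[OF f(1)] l by blast
qed

lemma lift_of_compose:
  assumes "lift_of h f" "lift_of k g" shows "lift_of (h \<circ> k) (\<lambda>x. f (g x))"
proof -
  obtain h' k' where hk: "homeomorphism circle circle h h'" "homeomorphism circle circle k k'"
    using assms unfolding lift_of_def op_circle_homeo_def by blast
  have c: "circle_lift (\<lambda>x. f (g x))" using assms circle_lift_compose unfolding lift_of_def by blast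
  have l: "(h \<circ> k) (cis x) = cis (f (g x))" for x using assms by (simp add: lift_of_def)
  have "op_circle_homeo (h \<circ> k)" unfolding op_circle_homeo_def
    using homeomorphism_compose[OF hk(2,1)] c l unfolding circle_lift_def by blast
  then show ?thesis unfolding lift_of_def using c l by blast
qed

lemma symm_ratio_lift:
  assumes "lift_of h f" "0 < t" "t < pi"
  shows "symm_ratio h x t > 0" "ln (symm_ratio h x t) = lsin f x (x + t) - lsin f (x - t) x"
proof -
  have f: "circle_lift f" "\<And>x. h (cis x) = cis (f x)" using assms by (auto simp: lift_of_def)
  have s: "sin ((f v - f u) / 2) > 0" if "u < v" "v < u + 2 * pi" for u v
  proof -
    have "f u < f v" "f v < f (u + 2 * pi)" using lift_less[OF f(1)] that by auto
    then show ?thesis using lift_2pi[OF f(1), of u] by (intro sin_gt_zero) auto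
  qed
  have p: "sin ((f (x + t) - f x) / 2) > 0" "sin ((f x - f (x - t)) / 2) > 0" using assms by (auto intro!: s)
  have "symm_ratio h x t = sin ((f (x + t) - f x) / 2) / sin ((f x - f (x - t)) / 2)"
    unfolding symm_ratio_def f(2) cmod_cis_diff using p by simp
  then show "symm_ratio h x t > 0" "ln (symm_ratio h x t) = lsin f x (x + t) - lsin f (x - t) x"
    using p by (auto simp: lsin_def ln_divide_pos)
qed

lemma symmetric_iff:
  assumes l: "lift_of h f"
  shows "symmetric h \<longleftrightarrow> same_asymptotics (\<lambda>x. x) f"
proof
  have f: "circle_lift f" using l by (simp add: lift_of_def)
  have id0: "lratio (\<lambda>x. x) (x - t) x (x + t) = 0" if "0 < t" for x t :: real using that by (simp add: lratio_def)
  show "same_asymptotics (\<lambda>x. x) f" if sy: "symmetric h"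
    unfolding same_asymptotics_def
  proof (intro allI impI)
    fix e :: real assume e: "e > 0"
    obtain \<delta> where \<delta>: "uniform_limit UNIV (\<lambda>t x. \<delta> x t) (\<lambda>x. 0) (at_right 0)"
      "\<forall>\<^sub>F t in at_right 0. \<forall>x. inverse (1 + \<delta> x t) \<le> symm_ratio h x t \<and> symm_ratio h x t \<le> 1 + \<delta> x t"
      using sy unfolding symmetric_def by blast
    have "\<forall>\<^sub>F t in at_right (0::real). \<forall>x. \<bar>\<delta> x t\<bar> < e / 2" using uniform_limitD[OF \<delta>(1), of "e / 2"] e by (simp add: dist_real_def)
    then have "\<forall>\<^sub>F t in at_right (0::real). \<forall>x. \<bar>\<delta> x t\<bar> < e / 2 \<and> inverse (1 + \<delta> x t) \<le> symm_ratio h x t \<and> symm_ratio h x t \<le> 1 + \<delta> x t"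
      using \<delta>(2) by eventually_elim auto
    then obtain d1 where d1: "d1 > 0" "\<And>t x. 0 < t \<Longrightarrow> t < d1 \<Longrightarrow> \<bar>\<delta> x t\<bar> < e / 2 \<and> inverse (1 + \<delta> x t) \<le> symm_ratio h x t \<and> symm_ratio h x t \<le> 1 + \<delta> x t"
      unfolding eventually_at_right_field by auto
    obtain d2 where d2: "d2 > 0" "d2 < pi" "\<And>x t. 0 < t \<Longrightarrow> t < d2 \<Longrightarrow> \<bar>lratio f (x - t) x (x + t) - (lsin f (x - t) x - lsin f x (x + t))\<bar> < e / 2"
      using chord_lratio[OF f, of "e / 2"] e by auto
    have "\<bar>lratio f (x - t) x (x + t) - lratio (\<lambda>x. x) (x - t) x (x + t)\<bar> < e" if t: "0 < t \<and> t < min d1 d2" for x t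
    proof -
      have p: "symm_ratio h x t > 0" "ln (symm_ratio h x t) = lsin f x (x + t) - lsin f (x - t) x"
        using symm_ratio_lift[OF l, of t x] t d2 by auto
      have b: "\<bar>\<delta> x t\<bar> < e / 2" "inverse (1 + \<delta> x t) \<le> symm_ratio h x t" "symm_ratio h x t \<le> 1 + \<delta> x t" using d1(2)[of t x] t by auto
      have "1 + \<delta> x t > 0" using b(3) p(1) by linarith
      then have "ln (symm_ratio h x t) \<le> ln (1 + \<delta> x t)" "- ln (1 + \<delta> x t) \<le> ln (symm_ratio h x t)"
        using b p(1) ln_mono[of "inverse (1 + \<delta> x t)" "symm_ratio h x t"] by (auto simp: ln_inverse)
      moreover have "ln (1 + \<delta> x t) \<le> \<delta> x t" using ln_le_minus_one[OF \<open>1 + \<delta> x t > 0\<close>] by simp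
      ultimately have "\<bar>lsin f (x - t) x - lsin f x (x + t)\<bar> < e / 2" using b(1) p(2) unfolding abs_less_iff by linarith
      then show ?thesis using d2(3)[of t x] t id0[of t x] unfolding abs_less_iff by linarith
    qed
    then show "\<exists>d>0. \<forall>x t. 0 < t \<and> t < d \<longrightarrow> \<bar>lratio f (x - t) x (x + t) - lratio (\<lambda>x. x) (x - t) x (x + t)\<bar> < e"
      using d1(1) d2(1) by (intro exI[of _ "min d1 d2"]) simp
  qed
  show "symmetric h" if sa: "same_asymptotics (\<lambda>x. x) f"
  proof -
    \<comment> \<open>The least admissible choice: 1 + \<delta> is the larger of the ratio and its
      inverse.\<close>
    define \<delta> where "\<delta> x t = exp \<bar>ln (symm_ratio h x t)\<bar> - 1" for x t
    have "\<exists>d>0. \<forall>t>0. t < d \<longrightarrow> (\<forall>x. \<bar>\<delta> x t\<bar> < e)" if e: "e > 0" for e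
    proof -
      have l2: "ln (1 + e) / 2 > 0" using e by simp
      obtain d1 where d1: "d1 > 0" "\<And>x t. 0 < t \<and> t < d1 \<Longrightarrow> \<bar>lratio f (x - t) x (x + t) - lratio (\<lambda>x. x) (x - t) x (x + t)\<bar> < ln (1 + e) / 2"
        using sa l2 unfolding same_asymptotics_def by blast
      obtain d2 where d2: "d2 > 0" "d2 < pi" "\<And>x t. 0 < t \<Longrightarrow> t < d2 \<Longrightarrow> \<bar>lratio f (x - t) x (x + t) - (lsin f (x - t) x - lsin f x (x + t))\<bar> < ln (1 + e) / 2"
        using chord_lratio[OF f l2] by blast
      have "\<bar>\<delta> x t\<bar> < e" if t: "0 < t" "t < min d1 d2" for x t
      proof -
        have "\<bar>ln (symm_ratio h x t)\<bar> < ln (1 + e)"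
        proof -
          have t': "0 < t \<and> t < d1" "t < d2" "t < pi" using t d2(2) by auto
          show ?thesis
            using d1(2)[OF t'(1), of x] d2(3)[OF t(1) t'(2), of x] id0[OF t(1), of x] symm_ratio_lift(2)[OF l t(1) t'(3), of x]
            unfolding abs_less_iff by linarith
        qed
        then have "exp \<bar>ln (symm_ratio h x t)\<bar> < exp (ln (1 + e))" by simp
        then have "\<delta> x t < e" using e by (simp add: \<delta>_def)
        moreover have "\<delta> x t \<ge> 0" by (simp add: \<delta>_def)
        ultimately show ?thesis by simp
      qed
      then show ?thesis using d1(1) d2(1) by (intro exI[of _ "min d1 d2"]) simp
    qed
    then have "uniform_limit UNIV (\<lambda>t x. \<delta> x t) (\<lambda>x. 0) (at_right 0)"
      unfolding uniform_limit_iff eventually_at_right_field by (simp add: dist_real_def)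
    moreover have "\<forall>\<^sub>F t in at_right 0. \<forall>x. inverse (1 + \<delta> x t) \<le> symm_ratio h x t \<and> symm_ratio h x t \<le> 1 + \<delta> x t"
      unfolding eventually_at_right_field
    proof (intro exI[of _ pi] conjI allI impI)
      fix t x :: real assume t: "0 < t" "t < pi"
      define r where "r = symm_ratio h x t"
      have r: "r > 0" using symm_ratio_lift(1)[OF l t] by (simp add: r_def)
      have "exp (ln r) \<le> exp \<bar>ln r\<bar>" "exp (- ln r) \<le> exp \<bar>ln r\<bar>" by (simp_all only: exp_le_cancel_iff abs_ge_self abs_ge_minus_self)
      then have "r \<le> exp \<bar>ln r\<bar>" "inverse r \<le> exp \<bar>ln r\<bar>" using r by (simp_all add: exp_minus)
      then show "symm_ratio h x t \<le> 1 + \<delta> x t" "inverse (1 + \<delta> x t) \<le> symm_ratio h x t"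
        using r unfolding \<delta>_def r_def[symmetric] by (simp_all add: inverse_le_imp_le[of r] le_imp_inverse_le)
    qed simp
    ultimately show ?thesis using l unfolding symmetric_def lift_of_def by blast
  qed
qed

lemma quasisymmetric_bounded_distortion:
  assumes q: "quasisymmetric h" and l: "lift_of h f"
  obtains \<alpha> \<beta> C C1 where "bounded_distortion f \<alpha> \<beta> C" "C1 \<ge> 0" "\<And>t1 t2 t3 t4. quad_angles t1 t2 t3 t4 \<Longrightarrow>
    quasi_linear \<alpha> \<beta> C1 (lcr (\<lambda>x. x) t1 t2 t3 t4) (lcr f t1 t2 t3 t4)"
proof -
  have f: "circle_lift f" using l by (simp add: lift_of_def)
  obtain C where C: "C \<ge> 1" "\<And>x t. 0 < t \<Longrightarrow> t < pi \<Longrightarrow> 1 / C \<le> symm_ratio h x t \<and> symm_ratio h x t \<le> C"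
    using q unfolding quasisymmetric_def by blast
  obtain d where d: "d > 0" "d < pi" "\<And>x t. 0 < t \<Longrightarrow> t < d \<Longrightarrow> \<bar>lratio f (x - t) x (x + t) - (lsin f (x - t) x - lsin f x (x + t))\<bar> < 1"
    using chord_lratio[OF f, of 1] by auto
  \<comment> \<open>The factor exp 1 pays for replacing chords by arcs, an error of at most 1 in the
    logarithm.\<close>
  define C' where "C' = exp 1 * C"
  have C': "C' \<ge> 1" unfolding C'_def using C(1) exp_ge_add_one_self[of 1] mult_mono[of 1 "exp 1" 1 C] by simp
  have "f (x + t) - f x \<le> C' * (f x - f (x - t)) \<and> f x - f (x - t) \<le> C' * (f (x + t) - f x)" if t: "0 < t" "t < d" for x t
  proof -
    have p: "f x - f (x - t) > 0" "f (x + t) - f x > 0" using lift_less[OF f] t by auto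
    have r: "lratio f (x - t) x (x + t) = ln (f x - f (x - t)) - ln (f (x + t) - f x)" using t by (intro lratio_eq[OF f]) auto
    have s: "symm_ratio h x t > 0" "ln (symm_ratio h x t) = lsin f x (x + t) - lsin f (x - t) x"
      using symm_ratio_lift[OF l, of t x] t d by auto
    have "1 / C \<le> symm_ratio h x t" "symm_ratio h x t \<le> C" using C(2)[of t x] t d by auto
    then have "ln (1 / C) \<le> ln (symm_ratio h x t)" "ln (symm_ratio h x t) \<le> ln C" using C(1) s(1) by (intro ln_mono; simp)+
    moreover have "ln (1 / C) = - ln C" using C(1) by (simp add: ln_divide_pos)
    moreover have "ln C' = 1 + ln C" unfolding C'_def using C(1) by (simp add: ln_mult_pos)
    ultimately have "ln (f (x + t) - f x) \<le> ln C' + ln (f x - f (x - t))" "ln (f x - f (x - t)) \<le> ln C' + ln (f (x + t) - f x)"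
      using d(3)[OF t, of x] s(2) unfolding r abs_less_iff by linarith+
    then have "ln (f (x + t) - f x) \<le> ln (C' * (f x - f (x - t)))" "ln (f x - f (x - t)) \<le> ln (C' * (f (x + t) - f x))"
      using p C' by (auto simp: ln_mult_pos)
    then show ?thesis using p C' by (auto simp: ln_le_cancel_iff)
  qed
  then have db: "doubling f C' (d / 2)" using d(1) unfolding doubling_def by auto
  have t0: "0 < d / 2" "d / 2 < pi" using d by auto
  obtain C0 where "bounded_distortion f (log 2 (1 + 1 / C')) (log 2 (1 + C')) C0"
    using doubling_bounded_distortion[OF f db C' t0] by blast
  moreover obtain C1 where "C1 \<ge> 0" "\<And>t1 t2 t3 t4. quad_angles t1 t2 t3 t4 \<Longrightarrow>
    quasi_linear (log 2 (1 + 1 / C')) (log 2 (1 + C')) C1 (lcr (\<lambda>x. x) t1 t2 t3 t4) (lcr f t1 t2 t3 t4)"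
    using lcr_quasi_linear[OF f db C' t0] by blast
  ultimately show ?thesis using that by blast
qed

section \<open>The two distances in terms of lifts\<close>

type_synonym angles = "real \<times> real \<times> real \<times> real"

definition angle_quads :: "angles set" where "angle_quads = {(t1, t2, t3, t4). quad_angles t1 t2 t3 t4}"
definition cis_quad :: "angles \<Rightarrow> quad" where "cis_quad = (\<lambda>(t1, t2, t3, t4). (cis t1, cis t2, cis t3, cis t4))"
definition lift_quad :: "(real \<Rightarrow> real) \<Rightarrow> angles \<Rightarrow> angles" where "lift_quad f = (\<lambda>(t1, t2, t3, t4). (f t1, f t2, f t3, f t4))"
definition rotate_quad :: "angles \<Rightarrow> angles" where "rotate_quad = (\<lambda>(t1, t2, t3, t4). (t2, t3, t4, t1 + 2 * pi))"
definition min_gap :: "angles \<Rightarrow> real" where "min_gap = (\<lambda>(t1, t2, t3, t4). mingap t1 t2 t3 t4)"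
definition lcr_of :: "(real \<Rightarrow> real) \<Rightarrow> angles \<Rightarrow> real" where "lcr_of f = (\<lambda>(t1, t2, t3, t4). lcr f t1 t2 t3 t4)"

abbreviation lcr_id :: "angles \<Rightarrow> real" where "lcr_id \<equiv> lcr_of (\<lambda>x. x)"

lemma is_quadruple_iff: "is_quadruple Q \<longleftrightarrow> (\<exists>q\<in>angle_quads. Q = cis_quad q)"
  by (cases Q) (force simp: is_quadruple_def angle_quads_def cis_quad_def quad_angles_def)

lemma is_quadruple_cis_quad: "q \<in> angle_quads \<Longrightarrow> is_quadruple (cis_quad q)"
  unfolding is_quadruple_iff by (intro bexI[of _ q] refl)

lemma cr_cis_quad:
  assumes "q \<in> angle_quads" shows "cr (cis_quad q) = exp (lcr_id q)"
proof -
  obtain t1 t2 t3 t4 where q: "q = (t1, t2, t3, t4)" "quad_angles t1 t2 t3 t4" using assms by (auto simp: angle_quads_def)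
  note t = q(2)[unfolded quad_angles_def]
  have p: "sin ((t2 - t1) / 2) > 0" "sin ((t4 - t3) / 2) > 0" "sin ((t3 - t2) / 2) > 0" "sin ((t4 - t1) / 2) > 0"
    using t by (auto intro!: sin_gt_zero)
  show ?thesis using cr_cis[of t1 t2 t3 t4] t p
    by (simp add: q(1) cis_quad_def lcr_of_def lcr_def lsin_def exp_diff exp_add)
qed

lemma lift_quad_angle_quads: "circle_lift f \<Longrightarrow> q \<in> angle_quads \<Longrightarrow> lift_quad f q \<in> angle_quads"
  by (auto simp: angle_quads_def lift_quad_def quad_angles_lift split: prod.splits)

lemma map_quad_cis_quad: "lift_of h f \<Longrightarrow> map_quad h (cis_quad q) = cis_quad (lift_quad f q)"
  by (auto simp: map_quad_def cis_quad_def lift_quad_def lift_of_def split: prod.splits)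

lemma lcr_of_lift_quad: "lcr_of g (lift_quad f q) = lcr_of (\<lambda>x. g (f x)) q"
  by (auto simp: lcr_of_def lift_quad_def lcr_def lsin_def split: prod.splits)

lemma lift_quad_comp: "lift_quad f (lift_quad g q) = lift_quad (\<lambda>x. f (g x)) q"
  by (auto simp: lift_quad_def split: prod.splits)

lemma lcr_of_rotate_quad: "circle_lift f \<Longrightarrow> lcr_of f (rotate_quad q) = - lcr_of f q"
  by (auto simp: lcr_of_def rotate_quad_def lcr_rotate split: prod.splits)

lemma rotate_quad_angle_quads: "q \<in> angle_quads \<Longrightarrow> rotate_quad q \<in> angle_quads"
  by (auto simp: angle_quads_def rotate_quad_def quad_angles_rotate split: prod.splits)

lemma min_gap_rotate_quad: "min_gap (rotate_quad q) = min_gap q"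
  by (auto simp: min_gap_def rotate_quad_def mingap_rotate split: prod.splits)

lemma min_gap_less: "min_gap (t1, t2, t3, t4) < d \<longleftrightarrow> t2 - t1 < d \<or> t3 - t2 < d \<or> t4 - t3 < d \<or> t1 + 2 * pi - t4 < d"
  by (auto simp: min_gap_def mingap_def min_less_iff_disj)

lemma min_gap_lift_quad:
  assumes f: "circle_lift f" and e: "e > 0"
  obtains d where "d > 0" "\<And>q. min_gap q < d \<Longrightarrow> min_gap (lift_quad f q) < e"
proof -
  obtain d where d: "d > 0" "\<And>x y. y - x < d \<Longrightarrow> f y - f x < e" using lift_small[OF f e] by blast
  have "min_gap (lift_quad f q) < e" if "min_gap q < d" for q
  proof -
    obtain t1 t2 t3 t4 where q: "q = (t1, t2, t3, t4)" by (cases q)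
    have "f (t1 + 2 * pi) = f t1 + 2 * pi" using lift_2pi[OF f] .
    then show ?thesis using that d(2)[of t2 t1] d(2)[of t3 t2] d(2)[of t4 t3] d(2)[of "t1 + 2 * pi" t4]
      unfolding q lift_quad_def prod.case min_gap_less by auto
  qed
  then show ?thesis using that d(1) by blast
qed

lemma min_scale_cis_quad: "min_scale (cis_quad (t1, t2, t3, t4)) = Min {2 * \<bar>sin ((t2 - t1) / 2)\<bar>, 2 * \<bar>sin ((t3 - t2) / 2)\<bar>, 2 * \<bar>sin ((t4 - t3) / 2)\<bar>, 2 * \<bar>sin ((t1 + 2 * pi - t4) / 2)\<bar>}"
proof -
  have "cmod (cis t4 - cis t1) = cmod (cis (t1 + 2 * pi) - cis t4)" by (simp add: norm_minus_commute flip: cis_mult)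
  then show ?thesis unfolding min_scale_def cis_quad_def prod.case
    using norm_minus_commute[of "cis t1" "cis t2"] norm_minus_commute[of "cis t2" "cis t3"] norm_minus_commute[of "cis t3" "cis t4"]
    by (simp only: cmod_cis_diff)
qed

lemma min_scale_nonneg: "min_scale Q \<ge> 0"
  by (cases Q) (simp add: min_scale_def)

lemma min_scale_le_min_gap:
  assumes "q \<in> angle_quads" shows "min_scale (cis_quad q) \<le> min_gap q"
proof -
  obtain t1 t2 t3 t4 where q: "q = (t1, t2, t3, t4)" "quad_angles t1 t2 t3 t4" using assms by (auto simp: angle_quads_def)
  have s: "2 * \<bar>sin (x / 2)\<bar> \<le> x" if "x > 0" for x :: real using abs_sin_x_le_abs_x[of "x / 2"] that by simp
  have "2 * \<bar>sin ((t2 - t1) / 2)\<bar> \<le> t2 - t1" "2 * \<bar>sin ((t3 - t2) / 2)\<bar> \<le> t3 - t2" "2 * \<bar>sin ((t4 - t3) / 2)\<bar> \<le> t4 - t3"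
    "2 * \<bar>sin ((t1 + 2 * pi - t4) / 2)\<bar> \<le> t1 + 2 * pi - t4"
    using q(2) by (auto intro!: s simp: quad_angles_def)
  moreover have "Min {a, b, c, d} \<le> min (min a' b') (min c' d')" if "a \<le> a'" "b \<le> b'" "c \<le> c'" "d \<le> d'"
    for a b c d a' b' c' d' :: real
  proof -
    have "Min {a, b, c, d} \<le> a" "Min {a, b, c, d} \<le> b" "Min {a, b, c, d} \<le> c" "Min {a, b, c, d} \<le> d"
      by (rule Min_le; simp)+
    then show ?thesis using that by (intro min.boundedI) linarith+
  qed
  ultimately show ?thesis unfolding q(1) min_scale_cis_quad min_gap_def prod.case mingap_def by blast
qed

text \<open>If all four gaps are at least d', each is also at most 2 pi - d', so its chord is at
  least that of d'.\<close>

lemma min_gap_small: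
  assumes "d > 0"
  obtains \<delta> where "\<delta> > 0" "\<And>q. q \<in> angle_quads \<Longrightarrow> min_scale (cis_quad q) < \<delta> \<Longrightarrow> min_gap q < d"
proof -
  define d' where "d' = min d 1"
  have d': "d' > 0" "d' \<le> d" "d' \<le> 1" using assms by (auto simp: d'_def)
  have s: "sin (x / 2) \<ge> sin (d' / 2)" if x: "d' \<le> x" "x \<le> 2 * pi - d'" for x
  proof (cases "x \<le> pi")
    case True
    then show ?thesis using x d' pi_gt3 by (intro sin_monotone_2pi_le) auto
  next
    case False
    have "sin (d' / 2) \<le> sin ((2 * pi - x) / 2)" using x d' False pi_gt3 by (intro sin_monotone_2pi_le) auto
    also have "(2 * pi - x) / 2 = pi - x / 2" by (simp add: field_simps)
    finally show ?thesis by simp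
  qed
  have sp: "sin (d' / 2) > 0" using d' pi_gt3 by (intro sin_gt_zero) auto
  have "min_gap q < d" if q: "q \<in> angle_quads" and m: "min_scale (cis_quad q) < 2 * sin (d' / 2)" for q
  proof (rule ccontr)
    assume "\<not> min_gap q < d"
    obtain t1 t2 t3 t4 where q': "q = (t1, t2, t3, t4)" "quad_angles t1 t2 t3 t4" using q by (auto simp: angle_quads_def)
    have g: "t2 - t1 \<ge> d'" "t3 - t2 \<ge> d'" "t4 - t3 \<ge> d'" "t1 + 2 * pi - t4 \<ge> d'"
      using \<open>\<not> min_gap q < d\<close> d' unfolding q'(1) min_gap_less by auto
    have "sin ((t2 - t1) / 2) \<ge> sin (d' / 2)" "sin ((t3 - t2) / 2) \<ge> sin (d' / 2)" "sin ((t4 - t3) / 2) \<ge> sin (d' / 2)"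
      "sin ((t1 + 2 * pi - t4) / 2) \<ge> sin (d' / 2)"
      using g d' by (auto intro!: s)
    moreover have "\<not> Min {2 * \<bar>a\<bar>, 2 * \<bar>b\<bar>, 2 * \<bar>c\<bar>, 2 * \<bar>e\<bar>} < 2 * k" if "k \<le> a" "k \<le> b" "k \<le> c" "k \<le> e" for a b c e k :: real
      using that by (simp add: Min_less_iff) linarith
    ultimately show False using m unfolding q'(1) min_scale_cis_quad by blast
  qed
  then show ?thesis using that[of "2 * sin (d' / 2)"] sp by auto
qed

text \<open>Smallness measured by chords and by gaps between angles defines the same limit, so
  quantification over quadruples can be replaced by quantification over tuples of angles.\<close>

lemma small_iff:
  "(\<exists>d>0. \<forall>Q. is_quadruple Q \<and> R Q \<longrightarrow> min_scale Q < d \<longrightarrow> P Q) \<longleftrightarrow>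
   (\<exists>d>0. \<forall>q\<in>angle_quads. R (cis_quad q) \<longrightarrow> min_gap q < d \<longrightarrow> P (cis_quad q))"
proof safe
  fix d :: real assume "d > 0" and d: "\<forall>Q. is_quadruple Q \<and> R Q \<longrightarrow> min_scale Q < d \<longrightarrow> P Q"
  have "P (cis_quad q)" if "q \<in> angle_quads" "R (cis_quad q)" "min_gap q < d" for q
  proof -
    have "is_quadruple (cis_quad q)" by (rule is_quadruple_cis_quad[OF that(1)])
    moreover have "min_scale (cis_quad q) < d" using min_scale_le_min_gap[OF that(1)] that(3) by linarith
    ultimately show ?thesis using d that(2) by blast
  qed
  then show "\<exists>d>0. \<forall>q\<in>angle_quads. R (cis_quad q) \<longrightarrow> min_gap q < d \<longrightarrow> P (cis_quad q)" using \<open>d > 0\<close> by blast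
next
  fix d :: real assume "d > 0" and d: "\<forall>q\<in>angle_quads. R (cis_quad q) \<longrightarrow> min_gap q < d \<longrightarrow> P (cis_quad q)"
  obtain \<delta> where "\<delta> > 0" and \<delta>: "\<And>q. q \<in> angle_quads \<Longrightarrow> min_scale (cis_quad q) < \<delta> \<Longrightarrow> min_gap q < d" using min_gap_small[OF \<open>d > 0\<close>] by blast
  have "P Q" if "is_quadruple Q" "R Q" "min_scale Q < \<delta>" for Q
  proof -
    from that(1)[unfolded is_quadruple_iff] obtain q where q: "q \<in> angle_quads" "Q = cis_quad q" by (rule bexE)
    have "min_gap q < d" by (rule \<delta>[OF q(1)]) (use that(3) q(2) in simp)
    then show ?thesis using bspec[OF d q(1)] that(2) q(2) by simp
  qed
  then show "\<exists>d>0. \<forall>Q. is_quadruple Q \<and> R Q \<longrightarrow> min_scale Q < d \<longrightarrow> P Q" using \<open>\<delta> > 0\<close>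
    by (intro exI[of _ \<delta>]) simp
qed

lemmas small_iff' = small_iff[of "\<lambda>_. True", unfolded simp_thms]

text \<open>If the condition fails for some e, choosing a violating q with s q < 1 / (n + 1) for
  each n gives a sequence whose upper limit is at least k + e.\<close>

lemma SUP_limsup_le_iff:
  fixes \<rho> s :: "'q \<Rightarrow> real"
  assumes s: "\<And>q. q \<in> A \<Longrightarrow> s q \<ge> 0"
  shows "(SUP Q \<in> {Q. (\<forall>n. Q n \<in> A) \<and> (\<lambda>n. s (Q n)) \<longlonglongrightarrow> 0}. limsup (\<lambda>n. ereal (\<rho> (Q n)))) \<le> ereal k
    \<longleftrightarrow> (\<forall>e>0. \<exists>d>0. \<forall>q. q \<in> A \<longrightarrow> s q < d \<longrightarrow> \<rho> q < k + e)"
proof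
  assume L: "(SUP Q \<in> {Q. (\<forall>n. Q n \<in> A) \<and> (\<lambda>n. s (Q n)) \<longlonglongrightarrow> 0}. limsup (\<lambda>n. ereal (\<rho> (Q n)))) \<le> ereal k"
  show "\<forall>e>0. \<exists>d>0. \<forall>q. q \<in> A \<longrightarrow> s q < d \<longrightarrow> \<rho> q < k + e"
  proof (rule ccontr)
    assume "\<not> ?thesis"
    then obtain e where e: "e > 0" "\<And>d. d > 0 \<Longrightarrow> \<exists>q. q \<in> A \<and> s q < d \<and> \<not> \<rho> q < k + e" by blast
    have "\<exists>q. q \<in> A \<and> s q < 1 / real (Suc n) \<and> \<not> \<rho> q < k + e" for n by (rule e(2)) simp
    then have "\<exists>Q. \<forall>n. Q n \<in> A \<and> s (Q n) < 1 / real (Suc n) \<and> \<not> \<rho> (Q n) < k + e"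
      by (intro choice allI)
    then obtain Q where Q: "\<And>n::nat. Q n \<in> A \<and> s (Q n) < 1 / real (Suc n) \<and> \<not> \<rho> (Q n) < k + e" by blast
    have "(\<lambda>n. s (Q n)) \<longlonglongrightarrow> 0"
      by (rule tendsto_sandwich[OF _ _ tendsto_const LIMSEQ_Suc[OF lim_1_over_n]])
        (use Q s in \<open>auto intro!: always_eventually less_imp_le\<close>)
    then have "Q \<in> {Q. (\<forall>n. Q n \<in> A) \<and> (\<lambda>n. s (Q n)) \<longlonglongrightarrow> 0}" using Q by blast
    then have "limsup (\<lambda>n. ereal (\<rho> (Q n))) \<le> ereal k" by (rule SUP_upper[THEN order_trans, OF _ L])
    moreover have "ereal (k + e) \<le> limsup (\<lambda>n. ereal (\<rho> (Q n)))"
      by (rule le_Limsup) (use Q in \<open>auto intro!: always_eventually simp: not_less\<close>)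
    ultimately have "ereal (k + e) \<le> ereal k" by (rule order_trans[rotated])
    then show False using e(1) by simp
  qed
next
  assume R: "\<forall>e>0. \<exists>d>0. \<forall>q. q \<in> A \<longrightarrow> s q < d \<longrightarrow> \<rho> q < k + e"
  show "(SUP Q \<in> {Q. (\<forall>n. Q n \<in> A) \<and> (\<lambda>n. s (Q n)) \<longlonglongrightarrow> 0}. limsup (\<lambda>n. ereal (\<rho> (Q n)))) \<le> ereal k"
  proof (rule SUP_least)
    fix Q assume "Q \<in> {Q. (\<forall>n. Q n \<in> A) \<and> (\<lambda>n. s (Q n)) \<longlonglongrightarrow> 0}"
    then have Q: "\<And>n. Q n \<in> A" "(\<lambda>n. s (Q n)) \<longlonglongrightarrow> 0" by auto
    show "limsup (\<lambda>n. ereal (\<rho> (Q n))) \<le> ereal k"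
    proof (rule ereal_le_epsilon2)
      fix e :: real assume "e > 0"
      then obtain d where d: "d > 0" "\<And>q. q \<in> A \<Longrightarrow> s q < d \<Longrightarrow> \<rho> q < k + e" using R by blast
      have "\<forall>\<^sub>F n in sequentially. ereal (\<rho> (Q n)) \<le> ereal (k + e)"
        using order_tendstoD(2)[OF Q(2) d(1)] by eventually_elim (use d(2) Q(1) in \<open>auto intro: less_imp_le\<close>)
      then have "limsup (\<lambda>n. ereal (\<rho> (Q n))) \<le> ereal (k + e)" by (rule Limsup_bounded)
      then show "limsup (\<lambda>n. ereal (\<rho> (Q n))) \<le> ereal k + ereal e" by simp
    qed
  qed
qed

section \<open>Both distances as limits of differences\<close>

lemma quad_modulus_cis_quad: "q \<in> angle_quads \<Longrightarrow> quad_modulus (cis_quad q) = exp (nu (lcr_id q))"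
proof -
  assume q: "q \<in> angle_quads"
  then have "is_quadruple (cis_quad q)" by (rule is_quadruple_cis_quad)
  then have "quad_modulus (cis_quad q) = mu (exp (lcr_id q))" using quad_modulus_eq cr_cis_quad[OF q] by simp
  then show ?thesis using mu_pos[of "exp (lcr_id q)"] by (simp add: nu_def)
qed

lemma d_AC_le_iff:
  assumes l1: "lift_of h1 f1" and l2: "lift_of h2 f2"
  shows "d_AC h1 h2 \<le> ereal k \<longleftrightarrow> (\<forall>e>0. \<exists>d>0. \<forall>q\<in>angle_quads. lcr_id q = 0 \<longrightarrow> min_gap q < d \<longrightarrow> \<bar>lcr_of f2 q - lcr_of f1 q\<bar> < k + e)"
proof -
  define \<rho> where "\<rho> Q = cmod (ln (cross_ratio (map_quad h2 Q) / cross_ratio (map_quad h1 Q)))" for Q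
  have f: "circle_lift f1" "circle_lift f2" using l1 l2 by (auto simp: lift_of_def)
  have \<rho>: "\<rho> (cis_quad q) = \<bar>lcr_of f2 q - lcr_of f1 q\<bar>" if q: "q \<in> angle_quads" for q
  proof -
    have c: "cross_ratio (map_quad h (cis_quad q)) = of_real (exp (lcr_of f q))" if l: "lift_of h f" for h f
    proof -
      have a: "lift_quad f q \<in> angle_quads" using l q by (auto simp: lift_of_def lift_quad_angle_quads)
      then have "is_quadruple (cis_quad (lift_quad f q))" by (rule is_quadruple_cis_quad)
      then show ?thesis using cross_ratio_real cr_cis_quad[OF a] unfolding map_quad_cis_quad[OF l] lcr_of_lift_quad by simp
    qed
    have "cross_ratio (map_quad h2 (cis_quad q)) / cross_ratio (map_quad h1 (cis_quad q)) = of_real (exp (lcr_of f2 q - lcr_of f1 q))"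
      unfolding c[OF l1] c[OF l2] exp_diff of_real_divide ..
    moreover have "ln (of_real (exp (lcr_of f2 q - lcr_of f1 q)) :: complex) = of_real (lcr_of f2 q - lcr_of f1 q)"
      by (subst Ln_of_real) auto
    ultimately show ?thesis unfolding \<rho>_def by (simp only: norm_of_real)
  qed
  have one: "cross_ratio (cis_quad q) = 1 \<longleftrightarrow> lcr_id q = 0" if "q \<in> angle_quads" for q
  proof -
    have "is_quadruple (cis_quad q)" using that by (rule is_quadruple_cis_quad)
    then show ?thesis using cross_ratio_real cr_cis_quad[OF that] by simp
  qed
  have "d_AC h1 h2 \<le> ereal k \<longleftrightarrow> (\<forall>e>0. \<exists>d>0. \<forall>Q. Q \<in> {Q. is_quadruple Q \<and> cross_ratio Q = 1} \<longrightarrow> min_scale Q < d \<longrightarrow> \<rho> Q < k + e)"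
    using SUP_limsup_le_iff[of "{Q. is_quadruple Q \<and> cross_ratio Q = 1}" min_scale \<rho> k, OF min_scale_nonneg]
    unfolding d_AC_def degenerating_quadruples_def \<rho>_def mem_Collect_eq .
  also have "\<dots> \<longleftrightarrow> (\<forall>e>0. \<exists>d>0. \<forall>q\<in>angle_quads. cross_ratio (cis_quad q) = 1 \<longrightarrow> min_gap q < d \<longrightarrow> \<rho> (cis_quad q) < k + e)"
    unfolding mem_Collect_eq small_iff ..
  also have "\<dots> \<longleftrightarrow> (\<forall>e>0. \<exists>d>0. \<forall>q\<in>angle_quads. lcr_id q = 0 \<longrightarrow> min_gap q < d \<longrightarrow> \<bar>lcr_of f2 q - lcr_of f1 q\<bar> < k + e)"
    by (simp add: one \<rho> cong: ball_cong)
  finally show ?thesis .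
qed

lemma half_ln_ereal_le_iff: "ereal (1 / 2) * ln_ereal K \<le> ereal k \<longleftrightarrow> K \<le> ereal (exp (2 * k))"
proof (cases K)
  case (real r)
  show ?thesis
  proof (cases "r \<le> 0")
    case True
    then have "r \<le> exp (2 * k)" using exp_gt_zero[of "2 * k"] by linarith
    then show ?thesis using True real by (simp add: ln_ereal_def)
  next
    case False
    then have "ln r / 2 \<le> k \<longleftrightarrow> r \<le> exp (2 * k)" using ln_ge_iff[of r "2 * k"] ln_le_cancel_iff[of r "exp (2 * k)"] by auto
    then show ?thesis using False real by (simp add: ln_ereal_def)
  qed
qed (auto simp: ln_ereal_def)

text \<open>A lift and its inverse permute the tuples of angles and preserve smallness, so a lift
  may serve as a change of variables.\<close>

lemma angle_quads_subst:
  assumes f: "circle_lift f"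
  shows "(\<exists>d>0. \<forall>q\<in>angle_quads. min_gap q < d \<longrightarrow> P q) \<longleftrightarrow> (\<exists>d>0. \<forall>q\<in>angle_quads. min_gap q < d \<longrightarrow> P (lift_quad f q))"
proof safe
  fix d :: real assume "d > 0" and d: "\<forall>q\<in>angle_quads. min_gap q < d \<longrightarrow> P q"
  obtain d' where "d' > 0" "\<And>q. min_gap q < d' \<Longrightarrow> min_gap (lift_quad f q) < d" using min_gap_lift_quad[OF f \<open>d > 0\<close>] by blast
  then show "\<exists>d>0. \<forall>q\<in>angle_quads. min_gap q < d \<longrightarrow> P (lift_quad f q)" using d lift_quad_angle_quads[OF f] by blast
next
  fix d :: real assume "d > 0" and d: "\<forall>q\<in>angle_quads. min_gap q < d \<longrightarrow> P (lift_quad f q)"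
  have i: "circle_lift (inv f)" using lift_inv(3)[OF f] .
  obtain d' where d': "d' > 0" "\<And>q. min_gap q < d' \<Longrightarrow> min_gap (lift_quad (inv f) q) < d" using min_gap_lift_quad[OF i \<open>d > 0\<close>] by blast
  have "P q" if "q \<in> angle_quads" "min_gap q < d'" for q
  proof -
    have "lift_quad f (lift_quad (inv f) q) = q" unfolding lift_quad_comp lift_inv(1)[OF f] by (cases q) (simp add: lift_quad_def)
    moreover have "P (lift_quad f (lift_quad (inv f) q))" using d d'(2)[OF that(2)] lift_quad_angle_quads[OF i that(1)] by blast
    ultimately show ?thesis by simp
  qed
  then show "\<exists>d>0. \<forall>q\<in>angle_quads. min_gap q < d \<longrightarrow> P q" using d'(1) by blast
qed

text \<open>Substituting f1 turns the quotient map into a comparison of f1 and f2 on the same tuple.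
  \<open>K_am\<close> bounds exp z from above only; rotating the tuple changes the sign of z, since
  \<open>nu\<close> is odd, and the bound becomes one for |z|.\<close>

lemma d_AM_le_iff:
  assumes l1: "lift_of h1 f1" and l2: "lift_of h2 f2"
  shows "d_AM h1 h2 \<le> ereal k \<longleftrightarrow> (\<forall>e>0. \<exists>d>0. \<forall>q\<in>angle_quads. min_gap q < d \<longrightarrow> \<bar>nu (lcr_of f2 q) / 2 - nu (lcr_of f1 q) / 2\<bar> < k + e)"
proof -
  define g where "g = h2 \<circ> circle_inv h1"
  define F where "F = (\<lambda>x. f2 (inv f1 x))"
  have lg: "lift_of g F" unfolding g_def F_def by (rule lift_of_compose[OF l2 lift_of_circle_inv(1)[OF l1]])
  have f1: "circle_lift f1" and f2: "circle_lift f2" and F: "circle_lift F" using l1 l2 lg by (auto simp: lift_of_def)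
  define \<rho> where "\<rho> Q = quad_modulus (map_quad g Q) / quad_modulus Q" for Q
  have \<rho>: "\<rho> (cis_quad q) = exp (nu (lcr_of F q) - nu (lcr_id q))" if q: "q \<in> angle_quads" for q
    unfolding \<rho>_def map_quad_cis_quad[OF lg] quad_modulus_cis_quad[OF q] quad_modulus_cis_quad[OF lift_quad_angle_quads[OF F q]] lcr_of_lift_quad exp_diff ..
  define z where "z q = nu (lcr_of f2 q) - nu (lcr_of f1 q)" for q
  have z: "\<rho> (cis_quad (lift_quad f1 q)) = exp (z q)" if "q \<in> angle_quads" for q
    using \<rho>[OF lift_quad_angle_quads[OF f1 that]] by (simp add: lcr_of_lift_quad F_def lift_inv(2)[OF f1] z_def)
  have zrot: "z (rotate_quad q) = - z q" for q by (simp add: z_def lcr_of_rotate_quad f1 f2 nu_odd)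
  define S where "S c \<longleftrightarrow> (\<exists>d>0. \<forall>q\<in>angle_quads. min_gap q < d \<longrightarrow> exp (z q) < c)" for c
  have "d_AM h1 h2 \<le> ereal k \<longleftrightarrow> K_am g \<le> ereal (exp (2 * k))"
    unfolding d_AM_def g_def[symmetric] half_ln_ereal_le_iff ..
  also have "\<dots> \<longleftrightarrow> (\<forall>e>0. \<exists>d>0. \<forall>Q. Q \<in> {Q. is_quadruple Q} \<longrightarrow> min_scale Q < d \<longrightarrow> \<rho> Q < exp (2 * k) + e)"
    using SUP_limsup_le_iff[of "{Q. is_quadruple Q}" min_scale \<rho> "exp (2 * k)", OF min_scale_nonneg]
    unfolding K_am_def degenerating_quadrilaterals_def \<rho>_def mem_Collect_eq .
  also have "\<dots> \<longleftrightarrow> (\<forall>e>0. \<exists>d>0. \<forall>q\<in>angle_quads. min_gap q < d \<longrightarrow> \<rho> (cis_quad q) < exp (2 * k) + e)"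
    unfolding mem_Collect_eq small_iff' ..
  also have "\<dots> \<longleftrightarrow> (\<forall>e>0. S (exp (2 * k) + e))"
  proof -
    have "(\<exists>d>0. \<forall>q\<in>angle_quads. min_gap q < d \<longrightarrow> \<rho> (cis_quad q) < c) \<longleftrightarrow> S c" for c
      unfolding S_def angle_quads_subst[OF f1, of "\<lambda>q. \<rho> (cis_quad q) < c"] by (simp add: z cong: ball_cong)
    then show ?thesis by simp
  qed
  \<comment> \<open>For positive e, exp (2k) + e and exp (2 (k + e)) both run through all values
    above exp (2k).\<close>
  also have "\<dots> \<longleftrightarrow> (\<forall>e>0. S (exp (2 * (k + e))))"
  proof safe
    fix e :: real assume "\<forall>e>0. S (exp (2 * k) + e)" "e > 0"
    moreover have "exp (2 * (k + e)) - exp (2 * k) > 0" using \<open>e > 0\<close> by simp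
    ultimately have "S (exp (2 * k) + (exp (2 * (k + e)) - exp (2 * k)))" by blast
    then show "S (exp (2 * (k + e)))" by simp
  next
    fix e :: real assume a: "\<forall>e>0. S (exp (2 * (k + e)))" and e: "e > 0"
    have p: "exp (2 * k) + e > 0" using e by (simp add: add_pos_pos)
    have "2 * k < ln (exp (2 * k) + e)" using e p ln_less_cancel_iff[of "exp (2 * k)" "exp (2 * k) + e"] by simp
    then have "S (exp (2 * (k + (ln (exp (2 * k) + e) / 2 - k))))" using a[rule_format, of "ln (exp (2 * k) + e) / 2 - k"] by simp
    then show "S (exp (2 * k) + e)" using p by simp
  qed
  also have "\<dots> \<longleftrightarrow> (\<forall>e>0. \<exists>d>0. \<forall>q\<in>angle_quads. min_gap q < d \<longrightarrow> z q < 2 * (k + e))"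
    unfolding S_def exp_less_cancel_iff ..
  also have "\<dots> \<longleftrightarrow> (\<forall>e>0. \<exists>d>0. \<forall>q\<in>angle_quads. min_gap q < d \<longrightarrow> \<bar>nu (lcr_of f2 q) / 2 - nu (lcr_of f1 q) / 2\<bar> < k + e)"
  proof -
    have zz: "nu (lcr_of f2 q) / 2 - nu (lcr_of f1 q) / 2 = z q / 2" for q by (simp add: z_def diff_divide_distrib)
    have eq: "(\<forall>q\<in>angle_quads. min_gap q < d \<longrightarrow> z q < 2 * c) \<longleftrightarrow> (\<forall>q\<in>angle_quads. min_gap q < d \<longrightarrow> \<bar>z q / 2\<bar> < c)" for c d
    proof
      assume a: "\<forall>q\<in>angle_quads. min_gap q < d \<longrightarrow> z q < 2 * c"
      show "\<forall>q\<in>angle_quads. min_gap q < d \<longrightarrow> \<bar>z q / 2\<bar> < c"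
      proof (intro ballI impI)
        fix q assume q: "q \<in> angle_quads" "min_gap q < d"
        have "z q < 2 * c" "z (rotate_quad q) < 2 * c" using a q rotate_quad_angle_quads[OF q(1)] min_gap_rotate_quad[of q] by auto
        then show "\<bar>z q / 2\<bar> < c" unfolding zrot by (simp add: abs_less_iff)
      qed
    qed (auto simp: abs_less_iff)
    show ?thesis unfolding zz by (simp only: eq)
  qed
  finally show ?thesis .
qed

text \<open>D is the upper limit of |\<phi> h2 - \<phi> h1| as s tends to 0, hence a pseudometric.
  \<open>bdd\<close> excludes the value infinity, \<open>inh\<close> excludes negative values
  including -infinity, and \<open>ker\<close> identifies the pairs at distance 0.\<close>

lemma asymptotic_metric:
  fixes D :: "'h \<Rightarrow> 'h \<Rightarrow> ereal" and \<phi> :: "'h \<Rightarrow> 'q \<Rightarrow> real" and s :: "'q \<Rightarrow> real"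
  assumes char: "\<And>h1 h2 k. h1 \<in> T \<Longrightarrow> h2 \<in> T \<Longrightarrow> D h1 h2 \<le> ereal k \<longleftrightarrow>
      (\<forall>e>0. \<exists>d>0. \<forall>q\<in>A. s q < d \<longrightarrow> \<bar>\<phi> h2 q - \<phi> h1 q\<bar> < k + e)"
    and bdd: "\<And>h1 h2. h1 \<in> T \<Longrightarrow> h2 \<in> T \<Longrightarrow> \<exists>K. \<forall>q\<in>A. \<bar>\<phi> h2 q - \<phi> h1 q\<bar> \<le> K"
    and inh: "\<And>d. d > 0 \<Longrightarrow> \<exists>q\<in>A. s q < d"
    and R: "R \<subseteq> T \<times> T"
    and ker: "\<And>h1 h2. h1 \<in> T \<Longrightarrow> h2 \<in> T \<Longrightarrow>
      (\<forall>e>0. \<exists>d>0. \<forall>q\<in>A. s q < d \<longrightarrow> \<bar>\<phi> h2 q - \<phi> h1 q\<bar> < e) \<longleftrightarrow> (h1, h2) \<in> R"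
  shows "\<exists>d. (\<forall>h1\<in>T. \<forall>h2\<in>T. ereal (d (R `` {h1}) (R `` {h2})) = D h1 h2) \<and> Metric_space (T // R) d"
proof -
  have nonneg: "k \<ge> 0" if h: "h1 \<in> T" "h2 \<in> T" "D h1 h2 \<le> ereal k" for h1 h2 k
  proof (rule ccontr)
    assume "\<not> k \<ge> 0"
    then have "- k > 0" by simp
    then obtain d where d: "d > 0" "\<forall>q\<in>A. s q < d \<longrightarrow> \<bar>\<phi> h2 q - \<phi> h1 q\<bar> < k + (- k)"
      using char[OF h(1,2), of k] h(3) by blast
    then show False using inh[OF d(1)] by auto
  qed
  have fin: "\<bar>D h1 h2\<bar> \<noteq> \<infinity>" if h: "h1 \<in> T" "h2 \<in> T" for h1 h2
  proof -
    obtain K where K: "\<forall>q\<in>A. \<bar>\<phi> h2 q - \<phi> h1 q\<bar> \<le> K" using bdd[OF h] by blast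
    have "D h1 h2 \<le> ereal K" unfolding char[OF h] using K by (intro allI impI exI[of _ 1]) force
    moreover have "D h1 h2 \<noteq> - \<infinity>" using nonneg[OF h, of "- 1"] by auto
    ultimately show ?thesis by auto
  qed
  define \<delta> where "\<delta> h1 h2 = real_of_ereal (D h1 h2)" for h1 h2
  have \<delta>: "D h1 h2 = ereal (\<delta> h1 h2)" if "h1 \<in> T" "h2 \<in> T" for h1 h2
    using fin[OF that] by (simp add: \<delta>_def ereal_real)
  have le: "\<delta> h1 h2 \<le> k \<longleftrightarrow> (\<forall>e>0. \<exists>d>0. \<forall>q\<in>A. s q < d \<longrightarrow> \<bar>\<phi> h2 q - \<phi> h1 q\<bar> < k + e)"
    if "h1 \<in> T" "h2 \<in> T" for h1 h2 k
    using char[OF that, of k] \<delta>[OF that] by simp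
  have \<delta>0: "\<delta> h1 h2 \<ge> 0" if "h1 \<in> T" "h2 \<in> T" for h1 h2 using nonneg[OF that, of "\<delta> h1 h2"] \<delta>[OF that] by simp
  have sym: "\<delta> h1 h2 = \<delta> h2 h1" if h: "h1 \<in> T" "h2 \<in> T" for h1 h2
  proof -
    have "\<delta> h1 h2 \<le> k \<longleftrightarrow> \<delta> h2 h1 \<le> k" for k unfolding le[OF h] le[OF h(2,1)] by (simp add: abs_minus_commute)
    then show ?thesis by (meson order_antisym order_refl)
  qed
  have tri: "\<delta> h1 h3 \<le> \<delta> h1 h2 + \<delta> h2 h3" if h: "h1 \<in> T" "h2 \<in> T" "h3 \<in> T" for h1 h2 h3
    unfolding le[OF h(1,3)]
  proof (intro allI impI)
    fix e :: real assume "e > 0"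
    then have e: "e / 2 > 0" by simp
    obtain d1 where d1: "d1 > 0" "\<forall>q\<in>A. s q < d1 \<longrightarrow> \<bar>\<phi> h2 q - \<phi> h1 q\<bar> < \<delta> h1 h2 + e / 2"
      using le[OF h(1,2), of "\<delta> h1 h2"] e by blast
    obtain d2 where d2: "d2 > 0" "\<forall>q\<in>A. s q < d2 \<longrightarrow> \<bar>\<phi> h3 q - \<phi> h2 q\<bar> < \<delta> h2 h3 + e / 2"
      using le[OF h(2,3), of "\<delta> h2 h3"] e by blast
    have "\<bar>\<phi> h3 q - \<phi> h1 q\<bar> < \<delta> h1 h2 + \<delta> h2 h3 + e" if q: "q \<in> A" "s q < min d1 d2" for q
    proof -
      have "\<bar>\<phi> h2 q - \<phi> h1 q\<bar> < \<delta> h1 h2 + e / 2" "\<bar>\<phi> h3 q - \<phi> h2 q\<bar> < \<delta> h2 h3 + e / 2" using d1 d2 q by auto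
      then show ?thesis unfolding abs_less_iff by linarith
    qed
    then show "\<exists>d>0. \<forall>q\<in>A. s q < d \<longrightarrow> \<bar>\<phi> h3 q - \<phi> h1 q\<bar> < \<delta> h1 h2 + \<delta> h2 h3 + e"
      using d1(1) d2(1) by (intro exI[of _ "min d1 d2"]) auto
  qed
  have zero: "\<delta> h1 h2 = 0 \<longleftrightarrow> (h1, h2) \<in> R" if h: "h1 \<in> T" "h2 \<in> T" for h1 h2
  proof -
    have "\<delta> h1 h2 = 0 \<longleftrightarrow> \<delta> h1 h2 \<le> 0" using \<delta>0[OF h] by auto
    then show ?thesis using le[OF h, of 0] ker[OF h] by simp
  qed
  \<comment> \<open>Reflexivity comes from \<open>ker\<close>, symmetry and transitivity from the
    pseudometric \<delta>, whose zero relation is R.\<close>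
  have eqv: "equiv T R"
  proof (rule equivI)
    show "R \<subseteq> T \<times> T" by (rule R)
    have "(h, h) \<in> R" if "h \<in> T" for h
      using ker[OF that that] by (metis abs_zero diff_self zero_less_one)
    then show "refl_on T R" unfolding refl_on_def by blast
    show "sym R" unfolding sym_def using R zero sym by (metis mem_Sigma_iff subsetD)
    show "trans R" unfolding trans_def
    proof (intro allI impI)
      fix x y z assume xy: "(x, y) \<in> R" and yz: "(y, z) \<in> R"
      then have T: "x \<in> T" "y \<in> T" "z \<in> T" using R by auto
      have "\<delta> x y = 0" "\<delta> y z = 0" using zero T xy yz by auto
      then have "\<delta> x z = 0" using tri[OF T] \<delta>0[OF T(1,3)] by simp
      then show "(x, z) \<in> R" using zero T by blast
    qed
  qed
  \<comment> \<open>The default 0 outside the quotient keeps d nonnegative and symmetric for all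
    arguments, as \<open>Metric_space\<close> demands.\<close>
  define d where "d X Y = (if X \<in> T // R \<and> Y \<in> T // R then \<delta> (SOME x. x \<in> X) (SOME y. y \<in> Y) else 0)" for X Y
  have rep: "(SOME x. x \<in> R `` {h}) \<in> T \<and> \<delta> h (SOME x. x \<in> R `` {h}) = 0" if "h \<in> T" for h
  proof -
    have "h \<in> R `` {h}" using eqv that by (rule equiv_class_self)
    then have "(SOME x. x \<in> R `` {h}) \<in> R `` {h}" by (rule someI)
    then show ?thesis using R zero that by blast
  qed
  have d: "d (R `` {h1}) (R `` {h2}) = \<delta> h1 h2" if h: "h1 \<in> T" "h2 \<in> T" for h1 h2
  proof -
    define x y where "x = (SOME x. x \<in> R `` {h1})" and "y = (SOME y. y \<in> R `` {h2})"
    have xy: "x \<in> T" "\<delta> h1 x = 0" "y \<in> T" "\<delta> h2 y = 0" using rep[OF h(1)] rep[OF h(2)] by (auto simp: x_def y_def)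
    have "\<delta> x y \<le> \<delta> h1 h2" using tri[OF xy(1) h(1) xy(3)] tri[OF h xy(3)] sym[OF h(1) xy(1)] xy by simp
    moreover have "\<delta> h1 h2 \<le> \<delta> x y" using tri[OF h(1) xy(1) h(2)] tri[OF xy(1,3) h(2)] sym[OF h(2) xy(3)] xy by simp
    moreover have "R `` {h1} \<in> T // R" "R `` {h2} \<in> T // R" using h by (auto intro: quotientI)
    ultimately show ?thesis unfolding d_def x_def y_def by simp
  qed
  have cls: "X \<in> T // R \<Longrightarrow> \<exists>x\<in>T. X = R `` {x}" for X by (auto simp: quotient_def)
  have "Metric_space (T // R) d"
  proof
    fix X Y
    show "0 \<le> d X Y"
    proof (cases "X \<in> T // R \<and> Y \<in> T // R")
      case True
      then obtain x y where xy: "x \<in> T" "y \<in> T" "X = R `` {x}" "Y = R `` {y}" using cls by blast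
      show ?thesis unfolding xy(3,4) d[OF xy(1,2)] by (rule \<delta>0[OF xy(1,2)])
    qed (auto simp: d_def)
    show "d X Y = d Y X"
    proof (cases "X \<in> T // R \<and> Y \<in> T // R")
      case True
      then obtain x y where xy: "x \<in> T" "y \<in> T" "X = R `` {x}" "Y = R `` {y}" using cls by blast
      show ?thesis unfolding xy(3,4) d[OF xy(1,2)] d[OF xy(2,1)] by (rule sym[OF xy(1,2)])
    qed (auto simp: d_def)
  next
    fix X Y assume "X \<in> T // R" "Y \<in> T // R"
    then obtain x y where xy: "x \<in> T" "y \<in> T" "X = R `` {x}" "Y = R `` {y}" using cls by blast
    show "d X Y = 0 \<longleftrightarrow> X = Y" unfolding xy(3,4) d[OF xy(1,2)] zero[OF xy(1,2)]
      using eq_equiv_class_iff[OF eqv xy(1,2)] by simp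
  next
    fix X Y Z assume "X \<in> T // R" "Y \<in> T // R" "Z \<in> T // R"
    then obtain x y z where xyz: "x \<in> T" "y \<in> T" "z \<in> T" "X = R `` {x}" "Y = R `` {y}" "Z = R `` {z}" using cls by metis
    show "d X Z \<le> d X Y + d Y Z"
      unfolding xyz(4-6) d[OF xyz(1,2)] d[OF xyz(2,3)] d[OF xyz(1,3)] by (rule tri[OF xyz(1-3)])
  qed
  then show ?thesis using d \<delta> by (intro exI[of _ d]) simp
qed

text \<open>Two lifts differ by a constant multiple of 2 pi, which cancels in \<open>lcr_of\<close>;
  any choice gives the same values.\<close>

definition the_lift :: "(complex \<Rightarrow> complex) \<Rightarrow> real \<Rightarrow> real" where
  "the_lift h = (SOME f. lift_of h f)"

lemma Teich_lift: assumes "h \<in> Teich" shows "lift_of h (the_lift h)"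
proof -
  have "op_circle_homeo h" using assms by (simp add: Teich_def quasisymmetric_def)
  then obtain f where "lift_of h f" by (rule op_circle_homeo_lift)
  then show ?thesis unfolding the_lift_def using someI[of "lift_of h" f] by simp
qed

section \<open>Finiteness and kernels on Teichmueller maps\<close>

lemma angE:
  assumes "q \<in> angle_quads" obtains t1 t2 t3 t4 where "q = (t1, t2, t3, t4)" "quad_angles t1 t2 t3 t4"
  using assms by (cases q) (simp add: angle_quads_def)

lemma Teich_distortion:
  assumes "h \<in> Teich"
  obtains \<alpha> \<beta> C C1 where "bounded_distortion (the_lift h) \<alpha> \<beta> C" "C1 \<ge> 0"
    "\<And>q. q \<in> angle_quads \<Longrightarrow> quasi_linear \<alpha> \<beta> C1 (lcr_id q) (lcr_of (the_lift h) q)"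
proof -
  have q: "quasisymmetric h" using assms by (simp add: Teich_def)
  obtain \<alpha> \<beta> C C1 where C0: "bounded_distortion (the_lift h) \<alpha> \<beta> C" "C1 \<ge> 0" "\<And>t1 t2 t3 t4. quad_angles t1 t2 t3 t4 \<Longrightarrow>
    quasi_linear \<alpha> \<beta> C1 (lcr (\<lambda>x. x) t1 t2 t3 t4) (lcr (the_lift h) t1 t2 t3 t4)"
    using quasisymmetric_bounded_distortion[OF q Teich_lift[OF assms]] by blast
  have "quasi_linear \<alpha> \<beta> C1 (lcr_id q) (lcr_of (the_lift h) q)" if "q \<in> angle_quads" for q
    using that
  proof (rule angE)
    fix t1 t2 t3 t4 assume t: "q = (t1, t2, t3, t4)" "quad_angles t1 t2 t3 t4"
    show ?thesis unfolding t(1) lcr_of_def prod.case by (rule C0(3)[OF t(2)])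
  qed
  from that[OF C0(1,2) this] show ?thesis .
qed

lemma Teich_bounded_distortion:
  assumes "h \<in> Teich" obtains \<alpha> \<beta> C where "bounded_distortion (the_lift h) \<alpha> \<beta> C"
  by (rule Teich_distortion[OF assms]) (rule that)

lemma harmonic_bound:
  assumes "h \<in> Teich" obtains K where "\<And>q. q \<in> angle_quads \<Longrightarrow> lcr_id q = 0 \<Longrightarrow> \<bar>lcr_of (the_lift h) q\<bar> \<le> K"
proof -
  obtain \<alpha> \<beta> C C1 where C: "bounded_distortion (the_lift h) \<alpha> \<beta> C" "C1 \<ge> 0"
    "\<And>q. q \<in> angle_quads \<Longrightarrow> quasi_linear \<alpha> \<beta> C1 (lcr_id q) (lcr_of (the_lift h) q)" using Teich_distortion[OF assms] by blast
  have "\<bar>lcr_of (the_lift h) q\<bar> \<le> C1" if "q \<in> angle_quads" "lcr_id q = 0" for q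
    using C(3)[OF that(1)] that(2) by (simp add: quasi_linear_def abs_le_iff)
  then show ?thesis by (rule that)
qed

lemma nu_bound:
  assumes "h \<in> Teich" obtains K where "\<And>q. q \<in> angle_quads \<Longrightarrow> \<bar>nu (lcr_of (the_lift h) q) - nu (lcr_id q)\<bar> \<le> K"
proof -
  obtain \<alpha> \<beta> C C1 where C: "bounded_distortion (the_lift h) \<alpha> \<beta> C" "C1 \<ge> 0"
    "\<And>q. q \<in> angle_quads \<Longrightarrow> quasi_linear \<alpha> \<beta> C1 (lcr_id q) (lcr_of (the_lift h) q)" using Teich_distortion[OF assms] by blast
  have "0 < \<alpha>" "\<alpha> \<le> \<beta>" using C(1) by (auto simp: bounded_distortion_def)
  then obtain K where "\<And>x y. quasi_linear \<alpha> \<beta> C1 x y \<Longrightarrow> \<bar>nu y - nu x\<bar> \<le> K" using nu_quasi_linear C(2) by blast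
  then show ?thesis using C(3) by (intro that) blast
qed

text \<open>The antipodal quadruples; being harmonic they meet the requirement \<open>inh\<close> of
  \<open>asymptotic_metric\<close> for both distances.\<close>

lemma angle_quads_harmonic_small:
  assumes "d > 0" shows "\<exists>q\<in>angle_quads. lcr_id q = 0 \<and> min_gap q < d"
proof -
  define t where "t = min (d / 2) 1"
  have t: "0 < t" "t < d" "t < pi / 2" "t < pi" using assms pi_gt3 by (auto simp: t_def min_less_iff_disj)
  have "(0 - t, 0, 0 + t, 0 + pi) \<in> angle_quads" using t by (auto simp: angle_quads_def quad_angles_def)
  moreover have "lcr_id (0 - t, 0, 0 + t, 0 + pi) = 0" unfolding lcr_of_def prod.case using t by (intro lcr_antipodal_eq_0)
  moreover have "min_gap (0 - t, 0, 0 + t, 0 + pi) < d" unfolding min_gap_less using t by simp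
  ultimately show ?thesis by blast
qed

lemma AT_rel_iff:
  assumes "h1 \<in> Teich" "h2 \<in> Teich"
  shows "(h1, h2) \<in> AT_rel \<longleftrightarrow> same_asymptotics (\<lambda>x. x) (\<lambda>x. the_lift h1 (inv (the_lift h2) x))"
  using symmetric_iff[OF lift_of_compose[OF Teich_lift[OF assms(1)] lift_of_circle_inv(1)[OF Teich_lift[OF assms(2)]]]] assms
  by (simp add: AT_rel_def)

lemma harmonic_asymptotics_angle_quads:
  assumes "circle_lift f" "circle_lift g"
    and "\<And>e. e > 0 \<Longrightarrow> \<exists>d>0. \<forall>q\<in>angle_quads. lcr_id q = 0 \<longrightarrow> min_gap q < d \<longrightarrow> \<bar>lcr_of g q - lcr_of f q\<bar> < e"
  shows "same_asymptotics f g"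
proof (rule harmonic_same_asymptotics[OF assms(1,2)])
  fix e :: real assume "e > 0"
  then obtain d where "d > 0" "\<forall>q\<in>angle_quads. lcr_id q = 0 \<longrightarrow> min_gap q < d \<longrightarrow> \<bar>lcr_of g q - lcr_of f q\<bar> < e" using assms(3) by blast
  then show "\<exists>d>0. \<forall>t1 t2 t3 t4. quad_angles t1 t2 t3 t4 \<longrightarrow> lcr (\<lambda>x. x) t1 t2 t3 t4 = 0 \<longrightarrow>
      mingap t1 t2 t3 t4 < d \<longrightarrow> \<bar>lcr g t1 t2 t3 t4 - lcr f t1 t2 t3 t4\<bar> < e"
    by (intro exI[of _ d] conjI allI impI) (simp_all add: angle_quads_def lcr_of_def min_gap_def)
qed

lemma Ball_harmonic: "(\<forall>q\<in>{q \<in> angle_quads. lcr_id q = 0}. P q) \<longleftrightarrow> (\<forall>q\<in>angle_quads. lcr_id q = 0 \<longrightarrow> P q)"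
  by blast

text \<open>The quotient g of f1 by f2 is formed as in \<open>AT_rel\<close>. If g is symmetric,
  harmonic tuples reach it through f2 with logarithmic cross ratio bounded by K, so the relative
  error in \<open>lcr_asymptotics\<close> becomes a small absolute one. Conversely harmonic tuples
  give \<open>same_asymptotics f2 f1\<close>, and \<open>same_asymptotics_quotient\<close> passes to
  g.\<close>

lemma kernel_AC:
  assumes h: "h1 \<in> Teich" "h2 \<in> Teich"
  shows "(\<forall>e>0. \<exists>d>0. \<forall>q\<in>{q \<in> angle_quads. lcr_id q = 0}. min_gap q < d \<longrightarrow> \<bar>lcr_of (the_lift h2) q - lcr_of (the_lift h1) q\<bar> < e) \<longleftrightarrow> (h1, h2) \<in> AT_rel"
proof -
  define f1 f2 where "f1 = the_lift h1" and "f2 = the_lift h2"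
  define g where "g = (\<lambda>x. f1 (inv f2 x))"
  obtain \<alpha>1 \<beta>1 C1 where b1: "bounded_distortion f1 \<alpha>1 \<beta>1 C1"
    unfolding f1_def by (rule Teich_bounded_distortion[OF h(1)])
  obtain \<alpha>2 \<beta>2 C2 where b2: "bounded_distortion f2 \<alpha>2 \<beta>2 C2"
    unfolding f2_def by (rule Teich_bounded_distortion[OF h(2)])
  have f1: "circle_lift f1" and f2: "circle_lift f2" using b1 b2 by (auto simp: bounded_distortion_def)
  have g: "circle_lift g" unfolding g_def using circle_lift_compose[OF f1 lift_inv(3)[OF f2]] .
  have gf: "lcr_of g (lift_quad f2 q) = lcr_of f1 q" "lcr_id (lift_quad f2 q) = lcr_of f2 q" for q
    by (simp_all add: lcr_of_lift_quad g_def lift_inv(2)[OF f2])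
  have c1: "same_asymptotics (\<lambda>x. x) g"
    if a: "\<And>e. e > 0 \<Longrightarrow> \<exists>d>0. \<forall>q\<in>angle_quads. lcr_id q = 0 \<longrightarrow> min_gap q < d \<longrightarrow> \<bar>lcr_of f2 q - lcr_of f1 q\<bar> < e"
  proof -
    have "same_asymptotics f2 f1"
      by (rule harmonic_asymptotics_angle_quads[OF f2 f1]) (use a in \<open>simp add: abs_minus_commute\<close>)
    from same_asymptotics_quotient[OF b2 b1 this] show ?thesis unfolding g_def .
  qed
  have c2: "\<exists>d>0. \<forall>q\<in>angle_quads. lcr_id q = 0 \<longrightarrow> min_gap q < d \<longrightarrow> \<bar>lcr_of f2 q - lcr_of f1 q\<bar> < e"
    if s: "same_asymptotics (\<lambda>x. x) g" and e: "e > 0" for e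
  proof -
    obtain K where K: "\<And>q. q \<in> angle_quads \<Longrightarrow> lcr_id q = 0 \<Longrightarrow> \<bar>lcr_of f2 q\<bar> \<le> K" using harmonic_bound[OF h(2)] unfolding f2_def by blast
    have K1: "1 + \<bar>K\<bar> > 0" by simp
    then have "e / (2 * (1 + \<bar>K\<bar>)) > 0" using e by simp
    then obtain d where d: "d > 0" "\<And>t1 t2 t3 t4. quad_angles t1 t2 t3 t4 \<Longrightarrow> mingap t1 t2 t3 t4 < d \<Longrightarrow>
      \<bar>lcr g t1 t2 t3 t4 - lcr (\<lambda>x. x) t1 t2 t3 t4\<bar> \<le> e / (2 * (1 + \<bar>K\<bar>)) * (1 + \<bar>lcr (\<lambda>x. x) t1 t2 t3 t4\<bar>)"
      using lcr_asymptotics[OF g s] by blast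
    have dq: "\<bar>lcr_of g q - lcr_id q\<bar> \<le> e / (2 * (1 + \<bar>K\<bar>)) * (1 + \<bar>lcr_id q\<bar>)" if "q \<in> angle_quads" "min_gap q < d" for q
      using that(1)
    proof (rule angE)
      fix t1 t2 t3 t4 assume q: "q = (t1, t2, t3, t4)" "quad_angles t1 t2 t3 t4"
      show ?thesis unfolding q(1) lcr_of_def prod.case by (rule d(2)[OF q(2)]) (use that(2) in \<open>simp add: q(1) min_gap_def\<close>)
    qed
    obtain d' where d': "d' > 0" "\<And>q. min_gap q < d' \<Longrightarrow> min_gap (lift_quad f2 q) < d" using min_gap_lift_quad[OF f2 d(1)] by blast
    have "\<bar>lcr_of f2 q - lcr_of f1 q\<bar> < e" if q: "q \<in> angle_quads" "lcr_id q = 0" "min_gap q < d'" for q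
    proof -
      have "\<bar>lcr_of f1 q - lcr_of f2 q\<bar> \<le> e / (2 * (1 + \<bar>K\<bar>)) * (1 + \<bar>lcr_of f2 q\<bar>)"
        using dq[OF lift_quad_angle_quads[OF f2 q(1)] d'(2)[OF q(3)]] unfolding gf .
      also have "\<dots> \<le> e / (2 * (1 + \<bar>K\<bar>)) * (1 + \<bar>K\<bar>)"
        using K[OF q(1,2)] e by (intro mult_left_mono) auto
      also have "\<dots> = e / 2" using K1 by (simp add: field_simps)
      also have "\<dots> < e" using e by simp
      finally show ?thesis by (simp add: abs_minus_commute)
    qed
    then show ?thesis using d'(1) by blast
  qed
  show ?thesis unfolding AT_rel_iff[OF h] f1_def[symmetric] f2_def[symmetric] g_def[symmetric] Ball_harmonic
    by (rule iffI, rule c1, erule allE, erule (1) mp, intro allI impI, rule c2)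
qed

text \<open>Substituting f2 leaves only g and the identity to compare. At harmonic tuples the
  identity contributes \<open>nu 0 = 0\<close>, and since \<open>nu\<close> is strictly increasing
  and odd, a small \<open>nu (lcr_of g q)\<close> forces a small \<open>lcr_of g q\<close>.
  Conversely the relative error in \<open>lcr_asymptotics\<close> is exactly what
  \<open>nu_close\<close> tolerates.\<close>

lemma kernel_AM:
  assumes h: "h1 \<in> Teich" "h2 \<in> Teich"
  shows "(\<forall>e>0. \<exists>d>0. \<forall>q\<in>angle_quads. min_gap q < d \<longrightarrow> \<bar>nu (lcr_of (the_lift h2) q) / 2 - nu (lcr_of (the_lift h1) q) / 2\<bar> < e) \<longleftrightarrow> (h1, h2) \<in> AT_rel"
proof -
  define f1 f2 where "f1 = the_lift h1" and "f2 = the_lift h2"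
  define g where "g = (\<lambda>x. f1 (inv f2 x))"
  have f1: "circle_lift f1" and f2: "circle_lift f2"
    using Teich_lift[OF h(1)] Teich_lift[OF h(2)] by (auto simp: lift_of_def f1_def f2_def)
  have g: "circle_lift g" unfolding g_def using circle_lift_compose[OF f1 lift_inv(3)[OF f2]] .
  have gf: "lcr_of g (lift_quad f2 q) = lcr_of f1 q" "lcr_id (lift_quad f2 q) = lcr_of f2 q" for q
    by (simp_all add: lcr_of_lift_quad g_def lift_inv(2)[OF f2])
  have sub: "(\<exists>d>0. \<forall>q\<in>angle_quads. min_gap q < d \<longrightarrow> \<bar>nu (lcr_of f2 q) / 2 - nu (lcr_of f1 q) / 2\<bar> < e) \<longleftrightarrow>
     (\<exists>d>0. \<forall>q\<in>angle_quads. min_gap q < d \<longrightarrow> \<bar>nu (lcr_id q) / 2 - nu (lcr_of g q) / 2\<bar> < e)" for e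
    unfolding angle_quads_subst[OF f2, of "\<lambda>q. \<bar>nu (lcr_id q) / 2 - nu (lcr_of g q) / 2\<bar> < e"] gf ..
  have c1: "same_asymptotics (\<lambda>x. x) g"
    if a: "\<And>e. e > 0 \<Longrightarrow> \<exists>d>0. \<forall>q\<in>angle_quads. min_gap q < d \<longrightarrow> \<bar>nu (lcr_id q) / 2 - nu (lcr_of g q) / 2\<bar> < e"
  proof (rule harmonic_asymptotics_angle_quads[OF circle_lift_id g])
    fix e :: real assume e: "e > 0"
    have "nu e / 2 > 0" using nu_strict_mono[OF e] nu_0 by simp
    then obtain d where d: "d > 0" "\<And>q. q \<in> angle_quads \<Longrightarrow> min_gap q < d \<Longrightarrow> \<bar>nu (lcr_id q) / 2 - nu (lcr_of g q) / 2\<bar> < nu e / 2"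
      using a by blast
    have "\<bar>lcr_of g q - lcr_id q\<bar> < e" if q: "q \<in> angle_quads" "lcr_id q = 0" "min_gap q < d" for q
    proof (rule ccontr)
      assume "\<not> \<bar>lcr_of g q - lcr_id q\<bar> < e"
      then have "e \<le> lcr_of g q \<or> e \<le> - lcr_of g q" using q(2) by linarith
      then have "nu e \<le> nu (lcr_of g q) \<or> nu e \<le> - nu (lcr_of g q)" using nu_mono nu_odd by metis
      then show False using d(2)[OF q(1,3)] q(2) nu_0 by (auto simp: abs_less_iff)
    qed
    then show "\<exists>d>0. \<forall>q\<in>angle_quads. lcr_id q = 0 \<longrightarrow> min_gap q < d \<longrightarrow> \<bar>lcr_of g q - lcr_id q\<bar> < e" using d(1) by blast
  qed
  have c2: "\<exists>d>0. \<forall>q\<in>angle_quads. min_gap q < d \<longrightarrow> \<bar>nu (lcr_id q) / 2 - nu (lcr_of g q) / 2\<bar> < e"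
    if s: "same_asymptotics (\<lambda>x. x) g" and e: "e > 0" for e
  proof -
    obtain \<delta> where \<delta>: "\<delta> > 0" "\<And>x y. \<bar>y - x\<bar> \<le> \<delta> * (1 + \<bar>x\<bar>) \<Longrightarrow> \<bar>nu y - nu x\<bar> \<le> e" using nu_close[OF e] by blast
    obtain d where d: "d > 0" "\<And>t1 t2 t3 t4. quad_angles t1 t2 t3 t4 \<Longrightarrow> mingap t1 t2 t3 t4 < d \<Longrightarrow>
      \<bar>lcr g t1 t2 t3 t4 - lcr (\<lambda>x. x) t1 t2 t3 t4\<bar> \<le> \<delta> * (1 + \<bar>lcr (\<lambda>x. x) t1 t2 t3 t4\<bar>)"
      using lcr_asymptotics[OF g s \<delta>(1)] by blast
    have "\<bar>nu (lcr_id q) / 2 - nu (lcr_of g q) / 2\<bar> < e" if "q \<in> angle_quads" "min_gap q < d" for q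
    proof -
      have "\<bar>lcr_of g q - lcr_id q\<bar> \<le> \<delta> * (1 + \<bar>lcr_id q\<bar>)" 
        using that(1)
      proof (rule angE)
        fix t1 t2 t3 t4 assume q: "q = (t1, t2, t3, t4)" "quad_angles t1 t2 t3 t4"
        show ?thesis unfolding q(1) lcr_of_def prod.case by (rule d(2)[OF q(2)]) (use that(2) in \<open>simp add: q(1) min_gap_def\<close>)
      qed
      then have "\<bar>nu (lcr_of g q) - nu (lcr_id q)\<bar> \<le> e" by (rule \<delta>(2))
      then show ?thesis using e by (simp add: abs_le_iff abs_less_iff)
    qed
    then show ?thesis using d(1) by blast
  qed
  show ?thesis unfolding AT_rel_iff[OF h] f1_def[symmetric] f2_def[symmetric] g_def[symmetric] sub
    by (rule iffI, rule c1, erule allE, erule (1) mp, intro allI impI, rule c2)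
qed

theorem theorem6:
  shows "(\<exists>d :: (complex \<Rightarrow> complex) set \<Rightarrow> (complex \<Rightarrow> complex) set \<Rightarrow> real.
            (\<forall>h1 \<in> Teich. \<forall>h2 \<in> Teich. ereal (d (AT_class h1) (AT_class h2)) = d_AM h1 h2) \<and>
            Metric_space AT_space d)
       \<and> (\<exists>d :: (complex \<Rightarrow> complex) set \<Rightarrow> (complex \<Rightarrow> complex) set \<Rightarrow> real.
            (\<forall>h1 \<in> Teich. \<forall>h2 \<in> Teich. ereal (d (AT_class h1) (AT_class h2)) = d_AC h1 h2) \<and>
            Metric_space AT_space d)"
proof
  have R: "AT_rel \<subseteq> Teich \<times> Teich" by (auto simp: AT_rel_def)
  show "\<exists>d. (\<forall>h1\<in>Teich. \<forall>h2\<in>Teich. ereal (d (AT_class h1) (AT_class h2)) = d_AM h1 h2) \<and> Metric_space AT_space d"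
    unfolding AT_class_def AT_space_def
  proof (rule asymptotic_metric[where A = angle_quads and s = min_gap and \<phi> = "\<lambda>h q. nu (lcr_of (the_lift h) q) / 2"])
    fix h1 h2 assume h: "h1 \<in> Teich" "h2 \<in> Teich"
    show "\<And>k. d_AM h1 h2 \<le> ereal k \<longleftrightarrow> (\<forall>e>0. \<exists>d>0. \<forall>q\<in>angle_quads. min_gap q < d \<longrightarrow>
        \<bar>nu (lcr_of (the_lift h2) q) / 2 - nu (lcr_of (the_lift h1) q) / 2\<bar> < k + e)"
      by (rule d_AM_le_iff[OF Teich_lift[OF h(1)] Teich_lift[OF h(2)]])
    \<comment> \<open>Neither value of \<open>nu\<close> is bounded by itself; both stay within a
      bounded distance of the value at the identity.\<close>
    obtain K1 where K1: "\<And>q. q \<in> angle_quads \<Longrightarrow> \<bar>nu (lcr_of (the_lift h1) q) - nu (lcr_id q)\<bar> \<le> K1" using nu_bound[OF h(1)] by blast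
    obtain K2 where K2: "\<And>q. q \<in> angle_quads \<Longrightarrow> \<bar>nu (lcr_of (the_lift h2) q) - nu (lcr_id q)\<bar> \<le> K2" using nu_bound[OF h(2)] by blast
    have "\<bar>nu (lcr_of (the_lift h2) q) / 2 - nu (lcr_of (the_lift h1) q) / 2\<bar> \<le> K1 + K2" if "q \<in> angle_quads" for q
      using K1[OF that] K2[OF that] unfolding abs_le_iff by linarith
    then show "\<exists>K. \<forall>q\<in>angle_quads. \<bar>nu (lcr_of (the_lift h2) q) / 2 - nu (lcr_of (the_lift h1) q) / 2\<bar> \<le> K" by blast
    show "(\<forall>e>0. \<exists>d>0. \<forall>q\<in>angle_quads. min_gap q < d \<longrightarrow> \<bar>nu (lcr_of (the_lift h2) q) / 2 - nu (lcr_of (the_lift h1) q) / 2\<bar> < e) \<longleftrightarrow> (h1, h2) \<in> AT_rel"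
      by (rule kernel_AM[OF h])
  next
    show "\<exists>q\<in>angle_quads. min_gap q < d" if "d > 0" for d using angle_quads_harmonic_small[OF that] by blast
  qed (rule R)
  show "\<exists>d. (\<forall>h1\<in>Teich. \<forall>h2\<in>Teich. ereal (d (AT_class h1) (AT_class h2)) = d_AC h1 h2) \<and> Metric_space AT_space d"
    unfolding AT_class_def AT_space_def
  proof (rule asymptotic_metric[where A = "{q \<in> angle_quads. lcr_id q = 0}" and s = min_gap and \<phi> = "\<lambda>h q. lcr_of (the_lift h) q"])
    fix h1 h2 assume h: "h1 \<in> Teich" "h2 \<in> Teich"
    show "d_AC h1 h2 \<le> ereal k \<longleftrightarrow> (\<forall>e>0. \<exists>d>0. \<forall>q\<in>{q \<in> angle_quads. lcr_id q = 0}. min_gap q < d \<longrightarrow>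
        \<bar>lcr_of (the_lift h2) q - lcr_of (the_lift h1) q\<bar> < k + e)" for k
      unfolding Ball_harmonic by (rule d_AC_le_iff[OF Teich_lift[OF h(1)] Teich_lift[OF h(2)]])
    obtain K1 where K1: "\<And>q. q \<in> angle_quads \<Longrightarrow> lcr_id q = 0 \<Longrightarrow> \<bar>lcr_of (the_lift h1) q\<bar> \<le> K1" using harmonic_bound[OF h(1)] by blast
    obtain K2 where K2: "\<And>q. q \<in> angle_quads \<Longrightarrow> lcr_id q = 0 \<Longrightarrow> \<bar>lcr_of (the_lift h2) q\<bar> \<le> K2" using harmonic_bound[OF h(2)] by blast
    have "\<bar>lcr_of (the_lift h2) q - lcr_of (the_lift h1) q\<bar> \<le> K1 + K2" if "q \<in> angle_quads" "lcr_id q = 0" for q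
      using K1[OF that] K2[OF that] unfolding abs_le_iff by linarith
    then show "\<exists>K. \<forall>q\<in>{q \<in> angle_quads. lcr_id q = 0}. \<bar>lcr_of (the_lift h2) q - lcr_of (the_lift h1) q\<bar> \<le> K" by blast
    show "(\<forall>e>0. \<exists>d>0. \<forall>q\<in>{q \<in> angle_quads. lcr_id q = 0}. min_gap q < d \<longrightarrow> \<bar>lcr_of (the_lift h2) q - lcr_of (the_lift h1) q\<bar> < e) \<longleftrightarrow> (h1, h2) \<in> AT_rel"
      by (rule kernel_AC[OF h])
  next
    show "\<exists>q\<in>{q \<in> angle_quads. lcr_id q = 0}. min_gap q < d" if "d > 0" for d using angle_quads_harmonic_small[OF that] by blast
  qed (rule R)
qed

end
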